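(* Let $h\in L^1(0,T)$, $h\ge0$, and let $f$ be a concave modulus of continuity with $\int_0^\varepsilon\frac{du}{f(u)}=\infty$ for any $\varepsilon>0$. Let $B:[0,T]\times\mathbb{R}^d\times\mathcal{P}_1(\mathbb{R}^d)\to\mathbb{R}^d$ be measurable and such that: (a) for any $t\in[0,T]$, $B_t$ is uniformly continuous on bounded subsets of $\mathbb{R}^d\times\mathcal{P}_1(\mathbb{R}^d)$, and there exists $k\in L^1(0,T)$ with $|B_t(x,\mu)|\le k_t(1+|x|+\|\mu\|_1)$ for all $(t,x,\mu)$; (b) $|B_t(x,\mu)-B_t(y,\nu)|\le h_t\,f(|x-y|+d_1(\mu,\nu))$ for all $t\in[0,T]$, $x,y\in\mathbb{R}^d$, $\mu,\nu\in\mathcal{P}_1(\mathbb{R}^d)$. Then for any $\mu^Y\in\mathcal{P}_1(C_T)$, any sequence $\{Y^i\}_{i\in\mathbb{N}}$ of $C_T$-valued random variables and the associated solutions $X^{(N)}$ of the $N$-particle system, we have $$d_1\big(L^N(X^{(N)}(\omega)),S^B(\mu^Y)\big)\le M\big(d_1(L^N(Y^{(N)}(\omega)),\mu^Y)\big)\quad\mathbb{P}\text{-a.s.},\qquad M(r):=G^{-1}\big(G(r)+2\|h\|_{L^1(0,T)}\big).$$ As a consequence, mean field convergence holds along any sequence $\{Y^i\}$ such that $d_1(L^N(Y^{(N)}(\omega)),\mu^Y)\to0$ $\mathbb{P}$-a.s., which is true in particular if $\{Y^i\}$ are i.i.d. random variables distributed as $\mu^Y$.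
   Context: $T>0$ is fixed, $C_T:=C([0,T];\mathbb{R}^d)$ with supremum norm; $\mathcal{L}(Z)$ is the law of $Z$. For a separable Banach space $E$, $\mathcal{P}_1(E)$ is the set of Borel probability measures $\mu$ on $E$ with $\|\mu\|_1:=\int\|x\|_E\mu(dx)<\infty$, with the $1$-Wasserstein distance $d_1$; $\rightharpoonup$ is weak convergence of measures. A modulus of continuity is a continuous nondecreasing $f:[0,\infty)\to[0,\infty)$ with $f(0)=0$ and $f(u)>0$ for $u>0$. $G(u):=\int_{x_0}^u\frac{dr}{f(r)}$, $u>0$, for an arbitrary $x_0>0$; $G:(0,\infty)\to\mathbb{R}$ is an increasing bijection, and $M(0):=0$ ($M$ does not depend on $x_0$). DDSDE: $X_t=\int_0^tB_s(X_s,\mathcal{L}(X_s))ds+Y_t$, $t\in[0,T]$. A weak solution with input $\mu^Y\in\mathcal{P}_1(C_T)$ is a tuple $(\Omega,\mathcal{F},\mathbb{P};X,Y)$ with $X,Y$ $C_T$-valued, $\mathcal{L}(Y)=\mu^Y$, $\sup_t\|\mathcal{L}(X_t)\|_1<\infty$, $\int_0^T|B_t(X_t,\mathcal{L}(X_t))|dt<\infty$ a.s. and the equation holding a.s. for all $t$. Under the stated hypotheses on $B$ there is, for each $\mu^Y\in\mathcal{P}_1(C_T)$, exactly one law $\mu^X=\mathcal{L}(X)$ of weak solutions; $S^B:\mathcal{P}_1(C_T)\to\mathcal{P}_1(C_T)$ denotes the map $\mu^Y\mapsto\mu^X$. $N$-particle system: $X^{(N)}=\{X^{i,N}\}_{i=1}^N$,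 a $(C_T)^N$-valued random variable, is a solution if for $\mathbb{P}$-a.e. $\omega$, $X^{i,N}_t(\omega)=\int_0^tB_s(X^{i,N}_s(\omega),L^N(X^{(N)}_s(\omega)))ds+Y^i_t(\omega)$ for all $t\in[0,T]$, $i=1,\dots,N$, with $L^N(X^{(N)}_s):=\frac1N\sum_i\delta_{X^{i,N}_s}$. Also $L^N(X^{(N)}):=\frac1N\sum_i\delta_{X^{i,N}}$, $L^N(Y^{(N)}):=\frac1N\sum_{i=1}^N\delta_{Y^i}$ in $\mathcal{P}(C_T)$. Mean field convergence along $\{Y^i\}$, where $L^N(Y^{(N)}(\omega))\rightharpoonup\mu^Y$ $\mathbb{P}$-a.s. and the DDSDE with input $\mu^Y$ has a unique solution $\mu^X$: for any sequence of solutions $\{X^{i,N}\}$ of the associated $N$-particle systems, $\mathbb{P}$-a.s. $L^N(X^{(N)}(\omega))\rightharpoonup\mu^X$ in $\mathcal{P}(C_T)$ as $N\to\infty$. *)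

theory Defs
  imports "HOL-Probability.Probability"
begin

text \<open>
  \<open>C([0,T]; \<real>\<^sup>d)\<close> is realised inside the Banach space of bounded continuous functions on \<open>\<real>\<close>
  as the closed subspace of functions extended by their values at the end points, so that the
  carrier may depend on \<open>T\<close> while the norm and metric are those of the library type. Lemmas
  \<open>ex1_path\<close> and \<open>dist_path\<close> below say that this is \<open>C([0,T]; \<real>\<^sup>d)\<close> with the supremum norm.
\<close>

type_synonym 'd path = "real \<Rightarrow>\<^sub>C (real ^ 'd)"

definition paths :: "real \<Rightarrow> ('d::finite) path set" where
  "paths T = {x. \<forall>t. apply_bcontfun x t = apply_bcontfun x (max 0 (min t T))}"

abbreviation borel_on :: "'e::topological_space set \<Rightarrow> 'e measure" where
  "borel_on E \<equiv> restrict_space borel E"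

lemma ex1_path:
  fixes g :: "real \<Rightarrow> real ^ 'd::finite"
  assumes "0 \<le> T" and "continuous_on {0..T} g"
  shows "\<exists>!x. x \<in> paths T \<and> (\<forall>t\<in>{0..T}. apply_bcontfun x t = g t)"
proof -
  define p where "p = (\<lambda>t::real. max 0 (min t T))"
  have p: "p t \<in> {0..T}" for t using assms(1) by (auto simp: p_def)
  have pid: "p t = t" if "t \<in> {0..T}" for t using that by (auto simp: p_def)
  have pp: "max 0 (min t T) = p t" for t by (simp add: p_def)
  have "continuous_on UNIV p" unfolding p_def by (intro continuous_intros)
  then have c: "continuous_on UNIV (g \<circ> p)"
    using p by (intro continuous_on_compose continuous_on_subset[OF assms(2)]) auto
  have "bounded (g ` {0..T})"
    using assms(2) by (intro compact_imp_bounded compact_continuous_image) auto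
  moreover have "range (g \<circ> p) \<subseteq> g ` {0..T}" using p by auto
  ultimately have b: "g \<circ> p \<in> bcontfun"
    using c by (auto simp: bcontfun_def intro: bounded_subset)
  have 1: "apply_bcontfun (Bcontfun (g \<circ> p)) = g \<circ> p" using b by (simp add: Bcontfun_inverse)
  show ?thesis
  proof (rule ex1I[of _ "Bcontfun (g \<circ> p)"])
    show "Bcontfun (g \<circ> p) \<in> paths T
        \<and> (\<forall>t\<in>{0..T}. apply_bcontfun (Bcontfun (g \<circ> p)) t = g t)"
      using pid pid[OF p] by (simp add: paths_def 1 pp)
  next
    fix x assume x: "x \<in> paths T \<and> (\<forall>t\<in>{0..T}. apply_bcontfun x t = g t)"
    have "apply_bcontfun x t = apply_bcontfun (Bcontfun (g \<circ> p)) t" for t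
    proof -
      have "apply_bcontfun x t = apply_bcontfun x (p t)" using x by (simp add: paths_def p_def)
      then show ?thesis using x p by (simp add: 1)
    qed
    then show "x = Bcontfun (g \<circ> p)" by (intro bcontfun_eqI)
  qed
qed

lemma dist_path:
  assumes "0 \<le> T" and "x \<in> paths T" and "y \<in> paths T"
  shows "dist x y = (SUP t\<in>{0..T}. dist (apply_bcontfun x t) (apply_bcontfun y t))"
proof -
  have "range (\<lambda>t. dist (apply_bcontfun x t) (apply_bcontfun y t))
      = (\<lambda>t. dist (apply_bcontfun x t) (apply_bcontfun y t)) ` {0..T}"
  proof safe
    fix t :: real
    have "apply_bcontfun x t = apply_bcontfun x (max 0 (min t T))"
      "apply_bcontfun y t = apply_bcontfun y (max 0 (min t T))"
      using assms(2,3) by (auto simp: paths_def)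
    moreover have "max 0 (min t T) \<in> {0..T}" using assms(1) by auto
    ultimately show "dist (apply_bcontfun x t) (apply_bcontfun y t)
        \<in> (\<lambda>t. dist (apply_bcontfun x t) (apply_bcontfun y t)) ` {0..T}" by auto
  qed auto
  then show ?thesis by (simp add: dist_bcontfun_def)
qed

text \<open>
  The separable Banach space \<open>E\<close> is given as a carrier set in a normed type; it will only be
  \<open>UNIV\<close> in \<open>\<real>\<^sup>d\<close> or \<open>paths T\<close>.
\<close>

definition P1 :: "'e::real_normed_vector set \<Rightarrow> 'e measure set" where
  "P1 E = {\<mu>. prob_space \<mu> \<and> sets \<mu> = sets (borel_on E) \<and> integrable \<mu> norm}"

definition norm1 :: "'e::real_normed_vector measure \<Rightarrow> real" where
  "norm1 \<mu> = (\<integral>x. norm x \<partial>\<mu>)"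

definition couplings :: "'a measure \<Rightarrow> 'b measure \<Rightarrow> ('a \<times> 'b) measure set" where
  "couplings \<mu> \<nu> = {m. sets m = sets (\<mu> \<Otimes>\<^sub>M \<nu>) \<and> distr m \<mu> fst = \<mu> \<and> distr m \<nu> snd = \<nu>}"

text \<open>
  On a separable carrier the product of the Borel sigma-algebras contains the Borel sets of the
  product, so the distance is measurable; it is integrable against every coupling of two
  measures in \<open>P1 E\<close>.
\<close>

definition d1 :: "'e::real_normed_vector measure \<Rightarrow> 'e measure \<Rightarrow> real" where
  "d1 \<mu> \<nu> = (INF m\<in>couplings \<mu> \<nu>. \<integral>z. dist (fst z) (snd z) \<partial>m)"

definition borel_P1 :: "'e::real_normed_vector set \<Rightarrow> 'e measure measure" where
  "borel_P1 E = sigma (P1 E) {U. openin (Metric_space.mtopology (P1 E) d1) U}"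

definition weakly_converges ::
    "(nat \<Rightarrow> 'e::topological_space measure) \<Rightarrow> 'e measure \<Rightarrow> bool" where
  "weakly_converges \<mu> \<nu> \<longleftrightarrow>
    (\<forall>\<phi>::'e \<Rightarrow> real. continuous_on (space \<nu>) \<phi> \<and> bounded (\<phi> ` space \<nu>)
      \<longrightarrow> (\<lambda>n. \<integral>x. \<phi> x \<partial>\<mu> n) \<longlonglongrightarrow> (\<integral>x. \<phi> x \<partial>\<nu>))"

text \<open>The empirical measure of \<open>z 0, \<dots>, z (N - 1)\<close>; sequences are indexed from \<open>0\<close>.\<close>

definition empirical ::
    "'e::topological_space set \<Rightarrow> nat \<Rightarrow> (nat \<Rightarrow> 'e) \<Rightarrow> 'e measure" where
  "empirical E N z = distr (uniform_count_measure {..<N}) (borel_on E) z"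

lemma emeasure_empirical:
  assumes "\<And>i. i < N \<Longrightarrow> z i \<in> E" and "0 < N" and "A \<in> sets (borel_on E)"
  shows "emeasure (empirical E N z) A
    = ennreal (1 / real N * (\<Sum>i<N. measure (return (borel_on E) (z i)) A))"
proof -
  have m: "z \<in> measurable (uniform_count_measure {..<N}) (borel_on E)"
    using assms(1) by (auto simp: measurable_def sets_uniform_count_measure
        space_uniform_count_measure space_restrict_space)
  have s: "(\<Sum>i<N. measure (return (borel_on E) (z i)) A) = real (card (z -` A \<inter> {..<N}))"
    using assms(3) by (simp add: measure_return indicator_def sum.If_cases Int_def vimage_def conj_commute)
  show ?thesis unfolding empirical_def s
    using m assms(2,3)
    by (simp add: emeasure_distr emeasure_uniform_count_measure space_uniform_count_measure)
qed

definition modulus_of_continuity :: "(real \<Rightarrow> real) \<Rightarrow> bool" where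
  "modulus_of_continuity f \<longleftrightarrow>
    continuous_on {0..} f \<and> mono_on {0..} f \<and> f 0 = 0 \<and> (\<forall>u>0. f u > 0)"

definition osgood_G :: "(real \<Rightarrow> real) \<Rightarrow> real \<Rightarrow> real \<Rightarrow> real" where
  "osgood_G f x0 u = (LBINT r=ereal x0..ereal u. 1 / f r)"

definition osgood_M :: "(real \<Rightarrow> real) \<Rightarrow> real \<Rightarrow> real \<Rightarrow> real \<Rightarrow> real" where
  "osgood_M f x0 c r =
    (if r = 0 then 0 else inv_into {0<..} (osgood_G f x0) (osgood_G f x0 r + c))"

type_synonym 'd drift = "real \<Rightarrow> real ^ 'd \<Rightarrow> (real ^ 'd) measure \<Rightarrow> real ^ 'd"

definition unif_cont_on_bounded ::
    "(real ^ 'd::finite \<Rightarrow> (real ^ 'd) measure \<Rightarrow> real ^ 'd) \<Rightarrow> bool" where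
  "unif_cont_on_bounded b \<longleftrightarrow>
    (\<forall>S \<subseteq> UNIV \<times> P1 UNIV. (\<exists>R. \<forall>(x, \<mu>)\<in>S. norm x \<le> R \<and> norm1 \<mu> \<le> R) \<longrightarrow>
      (\<forall>\<epsilon>>0. \<exists>\<delta>>0. \<forall>(x, \<mu>)\<in>S. \<forall>(y, \<nu>)\<in>S.
        norm (x - y) + d1 \<mu> \<nu> < \<delta> \<longrightarrow> norm (b x \<mu> - b y \<nu>) < \<epsilon>))"

text \<open>
  Integrability is stated so that the integral is not the default value \<open>0\<close>. For weak solutions
  it is part of the definition; for particle systems it follows from the linear growth of \<open>B\<close>.
\<close>

definition solves_equation ::
    "real \<Rightarrow> 'd::finite drift \<Rightarrow> (real \<Rightarrow> (real ^ 'd) measure) \<Rightarrow> 'd path \<Rightarrow> 'd path \<Rightarrow> bool" where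
  "solves_equation T B m x y \<longleftrightarrow>
    set_integrable lborel {0..T} (\<lambda>s. B s (apply_bcontfun x s) (m s)) \<and>
    (\<forall>t\<in>{0..T}. apply_bcontfun x t
      = (LINT s:{0..t}|lborel. B s (apply_bcontfun x s) (m s)) + apply_bcontfun y t)"

definition weak_solution ::
    "real \<Rightarrow> 'd::finite drift \<Rightarrow> 'd path measure \<Rightarrow>
      'w measure \<Rightarrow> ('w \<Rightarrow> 'd path) \<Rightarrow> ('w \<Rightarrow> 'd path) \<Rightarrow> bool" where
  "weak_solution T B \<mu>Y P X Y \<longleftrightarrow>
    (let law = (\<lambda>t. distr P borel (\<lambda>\<omega>. apply_bcontfun (X \<omega>) t)) in
      prob_space P \<and>
      X \<in> measurable P (borel_on (paths T)) \<and> Y \<in> measurable P (borel_on (paths T)) \<and>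
      distr P (borel_on (paths T)) Y = \<mu>Y \<and>
      (\<forall>t\<in>{0..T}. law t \<in> P1 UNIV) \<and> bdd_above ((\<lambda>t. norm1 (law t)) ` {0..T}) \<and>
      (AE \<omega> in P. solves_equation T B law (X \<omega>) (Y \<omega>)))"

text \<open>
  \<open>weak_solution\<close> allows any sample type, which cannot be quantified over inside a definition.
  Being a weak solution depends only on the joint law of \<open>(X, Y)\<close>, so the laws of solutions
  are those obtained on pairs of paths as sample points.
\<close>

definition solution_law ::
    "real \<Rightarrow> 'd::finite drift \<Rightarrow> 'd path measure \<Rightarrow> 'd path measure \<Rightarrow> bool" where
  "solution_law T B \<mu>Y \<mu>X \<longleftrightarrow>
    (\<exists>(P :: ('d path \<times> 'd path) measure) X Y.
      weak_solution T B \<mu>Y P X Y \<and> distr P (borel_on (paths T)) X = \<mu>X)"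

definition solution_map ::
    "real \<Rightarrow> 'd::finite drift \<Rightarrow> 'd path measure \<Rightarrow> 'd path measure" where
  "solution_map T B \<mu>Y = (THE \<mu>X. solution_law T B \<mu>Y \<mu>X)"

definition particle_solution ::
    "real \<Rightarrow> 'd::finite drift \<Rightarrow> 'w measure \<Rightarrow> (nat \<Rightarrow> 'w \<Rightarrow> 'd path) \<Rightarrow>
      nat \<Rightarrow> (nat \<Rightarrow> 'w \<Rightarrow> 'd path) \<Rightarrow> bool" where
  "particle_solution T B P Y N X \<longleftrightarrow>
    (\<forall>i<N. X i \<in> measurable P (borel_on (paths T))) \<and>
    (AE \<omega> in P. \<forall>i<N. solves_equation T B
      (\<lambda>s. empirical UNIV N (\<lambda>j. apply_bcontfun (X j \<omega>) s)) (X i \<omega>) (Y i \<omega>))"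

definition mean_field_convergence ::
    "real \<Rightarrow> 'd::finite drift \<Rightarrow> 'w measure \<Rightarrow> (nat \<Rightarrow> 'w \<Rightarrow> 'd path) \<Rightarrow>
      'd path measure \<Rightarrow> bool" where
  "mean_field_convergence T B P Y \<mu>Y \<longleftrightarrow>
    (AE \<omega> in P. weakly_converges (\<lambda>N. empirical (paths T) N (\<lambda>i. Y i \<omega>)) \<mu>Y) \<and>
    (\<exists>!\<mu>X. solution_law T B \<mu>Y \<mu>X) \<and>
    (\<forall>X :: nat \<Rightarrow> nat \<Rightarrow> 'w \<Rightarrow> 'd path. (\<forall>N\<ge>1. particle_solution T B P Y N (X N)) \<longrightarrow>
      (AE \<omega> in P. weakly_converges (\<lambda>N. empirical (paths T) N (\<lambda>i. X N i \<omega>))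
        (solution_map T B \<mu>Y)))"

end

theory Submission
  imports Defs
begin

text \<open>
  For a fixed flow \<open>m\<close> of marginals the equation is solved path by path: the Osgood condition
  yields a solution map \<open>\<Phi>\<^bsub>m\<^esub>\<close> that is continuous in the driving path, and every weak solution with
  flow \<open>m\<close> is \<open>\<Phi>\<^bsub>m\<^esub>(Y)\<close>. Two weak solutions with inputs \<open>\<mu>\<close>, \<open>\<mu>'\<close> can therefore be realised on any
    coupling
  of \<open>\<mu>\<close> and \<open>\<mu>'\<close>. There the distance of the marginals is at most the expected distance of the
  solutions, so Jensen's inequality for the concave \<open>f\<close> gives a scalar inequality with kernel
  \<open>h f(2 \<cdot>) \<le> 2 h f\<close>, and Bihari's inequality bounds the distance of the laws by \<open>M(d\<^sub>1(\<mu>, \<mu>'))\<close>.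
  Equal inputs give uniqueness in law, and Picard iteration on the flow gives existence. For fixed
  \<open>\<omega>\<close> a solution of the particle system is a weak solution on the uniform space
  \<open>{0, \<dots>, N - 1}\<close> with input the empirical measure of the \<open>Y\<^sup>i(\<omega>)\<close>. For i.i.d. inputs the
  empirical measures converge in \<open>d\<^sub>1\<close> because the frequencies of finitely many small cells
  converge and the remaining mass contributes little to the first moment.
\<close>

section \<open>Osgood's lemma\<close>

text \<open>Two weak solutions live on unrelated probability spaces, and only their inputs can be
  coupled. The estimate is closed for D(t), the mean of |X_t - X'_t|, which dominates the distance
  of the marginals at time t; the distance of the laws on path space is read off afterwards. Optimal
  couplings are replaced by couplings of cost below an arbitrary r > d1, at the price of the right
  continuity of M; at 0 this is the Osgood condition. A modulus f that need not be Lipschitz rules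
  out contraction arguments: uniqueness, Picard convergence and continuous dependence all rest on
  the fact that a bounded nonnegative e with e(t) \<le> r + \<integral> h f(e) on [0,t] is small for
  small r. Measurability of distances goes through countable partitions into cells of small
  diameter, and the same cells carry the coupling behind the convergence of empirical
  measures.\<close>

lemma set_integrable_lborel_subset:
  fixes w :: "real \<Rightarrow> 'b::euclidean_space"
  assumes "set_integrable lborel {0..T} w" "s \<ge> 0" "t \<le> T"
  shows "set_integrable lborel {s<..t} w" "set_integrable lborel {s..t} w"
  using assms by (auto intro!: set_integrable_subset[OF assms(1)])

lemma LINT_split:
  fixes w :: "real \<Rightarrow> 'b::euclidean_space"
  assumes "set_integrable lborel {0..T} w" "0 \<le> s" "s \<le> t" "t \<le> T"
  shows "(LINT u:{0..t}|lborel. w u) - (LINT u:{0..s}|lborel. w u) = (LINT u:{s<..t}|lborel. w u)"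
proof -
  have "{0..t} = {0..s} \<union> {s<..t}" using assms by auto
  moreover have "(LINT u:{0..s} \<union> {s<..t}|lborel. w u)
    = (LINT u:{0..s}|lborel. w u) + (LINT u:{s<..t}|lborel. w u)"
    using assms by (intro set_integral_Un set_integrable_lborel_subset[OF assms(1)]) auto
  ultimately show ?thesis by simp
qed

lemma continuous_on_LINT:
  fixes w :: "real \<Rightarrow> 'b::euclidean_space"
  assumes "set_integrable lborel {0..T} w"
  shows "continuous_on {0..T} (\<lambda>t. LINT u:{0..t}|lborel. w u)"
proof -
  have "w integrable_on {0..T}"
    using set_borel_integral_eq_integral(1)[OF assms] .
  then have "continuous_on {0..T} (\<lambda>t. integral {0..t} w)"
    by (rule indefinite_integral_continuous_1)
  then show ?thesis
    by (rule continuous_on_eq)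
      (use set_borel_integral_eq_integral(2)[OF set_integrable_lborel_subset(2)[OF assms]] in auto)
qed

lemma set_integrable_lborelI:
  fixes w :: "real \<Rightarrow> 'b::euclidean_space"
  assumes "integrable lborel w"
  shows "set_integrable lborel {s..t} w" "set_integrable lborel {s<..t} w"
  using assms unfolding set_integrable_def by (auto intro!: integrable_mult_indicator)

text \<open>The interval is walked back to 0 in steps of length \<delta>/2, the last one cut off at
  0; half of \<delta> because the local hypothesis asks for a gap strictly below \<delta>.\<close>

lemma antitone_of_local:
  fixes \<phi> :: "real \<Rightarrow> real"
  assumes "\<delta> > 0" and "\<And>s t. 0 \<le> s \<Longrightarrow> s \<le> t \<Longrightarrow> t \<le> T \<Longrightarrow> t - s < \<delta> \<Longrightarrow> \<phi> t \<le> \<phi> s"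
    and "0 \<le> t" "t \<le> T"
  shows "\<phi> t \<le> \<phi> 0"
proof -
  have "\<phi> t \<le> \<phi> 0" if "0 \<le> t" "t \<le> T" "t \<le> real n * (\<delta> / 2)" for n t
    using that
  proof (induction n arbitrary: t)
    case 0 then show ?case by simp
  next
    case (Suc n)
    define s where "s = max 0 (t - \<delta> / 2)"
    have "\<phi> t \<le> \<phi> s" using Suc.prems assms(1) by (intro assms(2)) (auto simp: s_def max_def)
    moreover have "\<phi> s \<le> \<phi> 0"
      using Suc.prems assms(1) by (intro Suc.IH) (auto simp: s_def max_def algebra_simps)
    ultimately show ?case by simp
  qed
  moreover obtain n where "t / (\<delta> / 2) \<le> real n" using real_arch_simple by blast
  ultimately show ?thesis using assms by (auto simp: field_simps)
qed

lemma set_LINT_nonneg: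
  fixes w :: "'a \<Rightarrow> real"
  shows "(\<And>x. x \<in> A \<Longrightarrow> 0 \<le> w x) \<Longrightarrow> 0 \<le> (LINT x:A|M. w x)"
  unfolding set_lebesgue_integral_def by (rule integral_nonneg_AE) (auto simp: indicator_def)

section \<open>Moduli of continuity and Bihari's inequality\<close>

locale modulus =
  fixes f :: "real \<Rightarrow> real"
  assumes modulus: "modulus_of_continuity f"
begin

lemma mono: "0 \<le> u \<Longrightarrow> u \<le> v \<Longrightarrow> f u \<le> f v"
  using modulus by (auto simp: modulus_of_continuity_def mono_on_def)

lemma zero: "f 0 = 0" and pos: "u > 0 \<Longrightarrow> f u > 0"
  and cont: "continuous_on {0..} f"
  using modulus by (auto simp: modulus_of_continuity_def)

lemma nonneg: "u \<ge> 0 \<Longrightarrow> f u \<ge> 0"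
  using mono[of 0 u] zero by simp

text \<open>A modulus is constrained on \<open>{0..}\<close> only and is arbitrary at negative
  arguments. Precomposition with \<open>max 0\<close> gives a function continuous on the whole line,
  from which measurability and limits of \<open>f\<close> along nonnegative arguments are read
  off.\<close>

lemma cont_max: "continuous_on UNIV (\<lambda>u. f (max 0 u))"
  by (rule continuous_on_compose2[OF cont]) (auto intro!: continuous_intros)

lemma measurable:
  assumes "\<And>x. 0 \<le> e x" "e \<in> borel_measurable M"
  shows "(\<lambda>x. f (e x)) \<in> borel_measurable M"
proof -
  have "(\<lambda>u. f (max 0 u)) \<in> borel_measurable borel"
    using cont_max by (rule borel_measurable_continuous_onI)
  then have "(\<lambda>x. f (max 0 (e x))) \<in> borel_measurable M"
    using assms(2) by (rule measurable_compose_rev)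
  then show ?thesis using assms(1) by (simp add: max_absorb2)
qed

lemma tendsto:
  assumes "(e \<longlongrightarrow> l) F" "\<And>x. 0 \<le> e x" "0 \<le> l"
  shows "((\<lambda>x. f (e x)) \<longlongrightarrow> f l) F"
proof -
  have "isCont (\<lambda>u. f (max 0 u)) l" using cont_max by (simp add: continuous_on_eq_continuous_at)
  from isCont_tendsto_compose[OF this assms(1)] show ?thesis
    using assms by (simp add: max_absorb2)
qed

lemma integrable_kernel:
  assumes "integrable lborel h" "e \<in> borel_measurable borel" "\<And>s. 0 \<le> e s" "\<And>s. e s \<le> R"
  shows "integrable lborel (\<lambda>s. h s * f (e s))"
proof (rule Bochner_Integration.integrable_bound)
  show "integrable lborel (\<lambda>s. h s * f R)" using assms by simp
  have [measurable]: "h \<in> borel_measurable lborel" "(\<lambda>s. f (e s)) \<in> borel_measurable lborel"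
    using assms measurable by auto
  show "(\<lambda>s. h s * f (e s)) \<in> borel_measurable lborel" by measurable
  have "0 \<le> R" using assms(3,4) order_trans by blast
  then have "\<bar>f (e s)\<bar> \<le> \<bar>f R\<bar>" for s
    using nonneg[OF assms(3)] mono[OF assms(3,4)] nonneg[of R] by simp
  then show "AE s in lborel. norm (h s * f (e s)) \<le> norm (h s * f R)"
    by (auto simp: abs_mult intro!: mult_left_mono)
qed

text \<open>
  On a fine partition \<open>f \<circ> v\<close> varies
    by a factor of at most \<open>1 + \<epsilon>\<close>, so \<open>G \<circ> v - (1 + \<epsilon>) H\<close> is locally
  nonincreasing; this replaces the chain rule for the absolutely continuous function \<open>v\<close>.
\<close>

proposition bihari:
  fixes G h e :: "real \<Rightarrow> real"
  assumes G: "\<And>u. u > 0 \<Longrightarrow> (G has_real_derivative 1 / f u) (at u)"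
    and h: "integrable lborel h" "\<And>s. 0 \<le> h s"
    and e: "e \<in> borel_measurable borel" "\<And>s. 0 \<le> e s" "\<And>s. e s \<le> R"
    and r: "r > 0"
    and le: "\<And>t. 0 \<le> t \<Longrightarrow> t \<le> T \<Longrightarrow> e t \<le> r + (LINT s:{0..t}|lborel. h s * f (e s))"
    and t: "0 \<le> t" "t \<le> T"
  shows "G (r + (LINT s:{0..t}|lborel. h s * f (e s))) \<le> G r + (LINT s:{0..t}|lborel. h s)"
proof -
  define v where "v t = r + (LINT s:{0..t}|lborel. h s * f (e s))" for t
  define H where "H t = (LINT s:{0..t}|lborel. h s)" for t
  have int: "set_integrable lborel {0..T} (\<lambda>s. h s * f (e s))" "set_integrable lborel {0..T} h"
    using integrable_kernel[OF h(1) e] h(1) by (auto intro!: set_integrable_lborelI)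
  have vdiff: "v t - v s = (LINT u:{s<..t}|lborel. h u * f (e u))" if "0 \<le> s" "s \<le> t" "t \<le> T"
    for s t
    using LINT_split[OF int(1) that] by (simp add: v_def)
  have vmono: "v s \<le> v t" if "0 \<le> s" "s \<le> t" "t \<le> T" for s t
  proof -
    have "0 \<le> (LINT u:{s<..t}|lborel. h u * f (e u))"
      using h(2) e(2) nonneg by (auto intro!: set_LINT_nonneg)
    then show ?thesis using vdiff[OF that] by simp
  qed
  have vr: "v s \<ge> r" if "0 \<le> s" "s \<le> T" for s
    using vmono[of 0 s] that unfolding v_def
    by (smt (verit) e(2) h(2) nonneg mult_nonneg_nonneg set_LINT_nonneg)
  \<comment> \<open>The hypothesis says \<open>e u \<le> v u\<close>, and \<open>v\<close> is
    nondecreasing, so \<open>v t\<close> bounds \<open>e\<close> on all of \<open>{s<..t}\<close>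
    and the kernel can be frozen there.\<close>
  have vle: "v t - v s \<le> f (v t) * (H t - H s)" if "0 \<le> s" "s \<le> t" "t \<le> T" for s t
  proof -
    have "(LINT u:{s<..t}|lborel. h u * f (e u)) \<le> (LINT u:{s<..t}|lborel. h u * f (v t))"
    proof (rule set_integral_mono)
      show "set_integrable lborel {s<..t} (\<lambda>u. h u * f (e u))"
        using set_integrable_lborel_subset[OF int(1)] that by auto
      show "set_integrable lborel {s<..t} (\<lambda>u. h u * f (v t))"
        using set_integrable_lborel_subset[OF int(2)] that
          by (auto intro!: set_integrable_mult_left)
      fix u assume u: "u \<in> {s<..t}"
      then have "e u \<le> v u" using le[of u] that by (simp add: v_def)
      also have "v u \<le> v t" using u that by (intro vmono) auto
      finally show "h u * f (e u) \<le> h u * f (v t)"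
        using h(2) e(2) by (intro mult_left_mono mono) auto
    qed
    also have "\<dots> = f (v t) * (H t - H s)"
      using LINT_split[OF int(2) that] by (simp add: H_def mult.commute)
    finally show ?thesis using vdiff[OF that] by simp
  qed
  have Hmono: "H s \<le> H t" if "0 \<le> s" "s \<le> t" "t \<le> T" for s t
  proof -
    have "0 \<le> (LINT u:{s<..t}|lborel. h u)"
      using h(2) by (auto intro!: set_LINT_nonneg)
    then show ?thesis using LINT_split[OF int(2) that] by (simp add: H_def)
  qed
  have vcont: "continuous_on {0..T} v"
    unfolding v_def using continuous_on_LINT[OF int(1)] by (intro continuous_intros)
  have fvcont: "continuous_on {0..T} (\<lambda>t. f (v t))"
    by (rule continuous_on_compose2[OF cont vcont]) (use vr r in force)
  \<comment> \<open>Mean value theorem: \<open>1 / f\<close> is nonincreasing, so the slope at the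
    left end point is the largest one.\<close>
  have Gdiff: "G b - G a \<le> (b - a) / f a" if "0 < a" "a \<le> b" for a b
  proof (cases "a = b")
    case False
    then have "\<exists>z>a. z < b \<and> G b - G a = (b - a) * (1 / f z)"
      using that G by (intro MVT2) auto
    then obtain z where z: "a < z" "z < b" "G b - G a = (b - a) / f z" by auto
    have "(b - a) / f z \<le> (b - a) / f a"
      using that z mono[of a z] pos[of a] by (intro divide_left_mono) auto
    then show ?thesis using z by simp
  qed simp
  have main: "G (v t) - (1 + \<epsilon>) * H t \<le> G (v 0) - (1 + \<epsilon>) * H 0" if \<epsilon>: "\<epsilon> > 0" for \<epsilon>
  proof -
    have "uniformly_continuous_on {0..T} (\<lambda>t. f (v t))"
      using fvcont by (intro compact_uniformly_continuous) auto
    \<comment> \<open>\<open>f r\<close> is a lower bound of \<open>f \<circ> v\<close>, so an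
      absolute oscillation below \<open>\<epsilon> * f r\<close> is a relative oscillation below
      \<epsilon>.\<close>
    moreover have "\<epsilon> * f r > 0" using \<epsilon> pos[OF r] by simp
    ultimately obtain \<delta> where \<delta>: "\<delta> > 0"
      "\<And>s t. s \<in> {0..T} \<Longrightarrow> t \<in> {0..T} \<Longrightarrow> dist t s < \<delta> \<Longrightarrow> dist (f (v t)) (f (v s)) < \<epsilon> * f r"
      unfolding uniformly_continuous_on_def by metis
    show ?thesis
    proof (rule antitone_of_local[OF \<delta>(1) _ t])
      fix s t assume st: "0 \<le> s" "s \<le> t" "t \<le> T" "t - s < \<delta>"
      have "dist (f (v t)) (f (v s)) < \<epsilon> * f r"
        using st by (intro \<delta>(2)) (auto simp: dist_real_def)
      moreover have fr: "f r \<le> f (v s)" using vr[of s] st r by (intro mono) auto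
      ultimately have f1: "f (v t) \<le> (1 + \<epsilon>) * f (v s)"
        using mult_left_mono[OF fr less_imp_le[OF \<epsilon>]]
        unfolding dist_real_def distrib_right by linarith
      have vs: "0 < v s" "f (v s) > 0" using vr[of s] st r pos by (auto intro: less_le_trans)
      have "G (v t) - G (v s) \<le> (v t - v s) / f (v s)"
        using vs vmono st by (intro Gdiff) auto
      also have "\<dots> \<le> (f (v t) * (H t - H s)) / f (v s)"
        using vle[of s t] st vs by (intro divide_right_mono) auto
      also have "\<dots> \<le> ((1 + \<epsilon>) * f (v s)) * (H t - H s) / f (v s)"
        using f1 Hmono[of s t] st vs by (intro divide_right_mono mult_right_mono) auto
      also have "\<dots> = (1 + \<epsilon>) * (H t - H s)" using vs by simp
      finally show "G (v t) - (1 + \<epsilon>) * H t \<le> G (v s) - (1 + \<epsilon>) * H s"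
        by (simp add: algebra_simps)
    qed
  qed
  have "(LINT u:{0..0::real}|lborel. w u) = (0::real)" for w
    unfolding set_lebesgue_integral_def
    by (rule integral_eq_zero_AE, rule eventually_mono[OF AE_lborel_singleton[of 0]]) auto
  then have "v 0 = r" "H 0 = 0" by (auto simp: v_def H_def)
  then have *: "G (v t) \<le> G r + (1 + \<epsilon>) * H t" if "\<epsilon> > 0" for \<epsilon> using main[OF that] by simp
  have "((\<lambda>\<epsilon>. G r + (1 + \<epsilon>) * H t) \<longlongrightarrow> G r + (1 + 0) * H t) (at_right 0)"
    by (intro tendsto_intros)
  then have "G (v t) \<le> G r + (1 + 0) * H t"
    by (rule tendsto_lowerbound) (use * in \<open>auto simp: eventually_at_right_less
      eventually_at_filter\<close>)
  then show ?thesis by (simp add: v_def H_def)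
qed

end

text \<open>Bihari's inequality for the identity modulus, where \<open>G\<close> is the logarithm.
  The exponent is the integral over the whole line, so that one constant serves all
  \<open>t\<close>.\<close>

lemma gronwall:
  fixes k e :: "real \<Rightarrow> real"
  assumes k: "integrable lborel k" "\<And>s. 0 \<le> k s"
    and e: "e \<in> borel_measurable borel" "\<And>s. 0 \<le> e s" "\<And>s. e s \<le> R"
    and r: "r > 0"
    and le: "\<And>t. 0 \<le> t \<Longrightarrow> t \<le> T \<Longrightarrow> e t \<le> r + (LINT s:{0..t}|lborel. k s * e s)"
    and t: "0 \<le> t" "t \<le> T"
  shows "e t \<le> r * exp (LINT s|lborel. k s)"
proof -
  interpret modulus "\<lambda>u. u"
    by unfold_locales (auto simp: modulus_of_continuity_def mono_on_def)
  define v where "v = r + (LINT s:{0..t}|lborel. k s * e s)"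
  have "0 \<le> (LINT s:{0..t}|lborel. k s * e s)"
    using k(2) e(2) by (intro set_LINT_nonneg mult_nonneg_nonneg)
  then have v: "v > 0" using r unfolding v_def by linarith
  have "ln v \<le> ln r + (LINT s:{0..t}|lborel. k s)"
    unfolding v_def by (rule bihari[where G = ln and h = k and e = e and T = T
      and R = R, OF _ k e r _ t])
      (use le in \<open>auto intro: DERIV_ln_divide\<close>)
  also have "(LINT s:{0..t}|lborel. k s) \<le> (LINT s|lborel. k s)"
    using k unfolding set_lebesgue_integral_def
    by (intro integral_mono integrable_mult_indicator) (auto simp: indicator_def)
  finally have "ln v \<le> ln (r * exp (LINT s|lborel. k s))"
    using r by (simp add: ln_mult)
  then have "v \<le> r * exp (LINT s|lborel. k s)"
    by (subst (asm) ln_le_cancel_iff) (use v r in auto)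
  moreover have "e t \<le> v" using le[OF t] by (simp add: v_def)
  ultimately show ?thesis by simp
qed

text \<open>The running maximum over the first iterates turns the recursion into a Gronwall inequality.\<close>

lemma gronwall_iterates:
  fixes k :: "real \<Rightarrow> real" and a :: "nat \<Rightarrow> real \<Rightarrow> real"
  assumes k: "integrable lborel k" "\<And>s. 0 \<le> k s"
    and a: "\<And>n. a n \<in> borel_measurable borel" "\<And>n s. 0 \<le> a n s" "\<And>n s. a n s \<le> R n"
    and c: "0 \<le> c" "\<And>t. 0 \<le> t \<Longrightarrow> t \<le> T \<Longrightarrow> a 0 t \<le> c"
    and le: "\<And>n t. 0 \<le> t \<Longrightarrow> t \<le> T \<Longrightarrow>
      a (Suc n) t \<le> c + (LINT s:{0..t}|lborel. k s * (1 + a n s + a (Suc n) s))"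
    and t: "0 \<le> t" "t \<le> T"
  shows "a n t \<le> (c + 1) * exp (2 * (LINT s|lborel. k s))"
proof -
  define A where "A n t = Max ((\<lambda>i. a i t) ` {..n})" for n t
  have aA: "a i t \<le> A n t" if "i \<le> n" for i n t
    using that by (auto simp: A_def)
  have A[measurable]: "A n \<in> borel_measurable borel" for n
    unfolding A_def using a(1) by (intro borel_measurable_Max) auto
  have A0: "0 \<le> A n t" for n t using a(2)[of n t] aA[of n n t] by simp
  have AR: "A n t \<le> Max (R ` {..n})" for n t
    unfolding A_def
  proof (rule Max.boundedI)
    fix x assume "x \<in> (\<lambda>i. a i t) ` {..n}"
    then obtain i where "i \<le> n" "x = a i t" by auto
    then show "x \<le> Max (R ` {..n})" by (auto intro!: order_trans[OF a(3)] Max_ge)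
  qed auto
  have Ale: "A n t \<le> c + (LINT s:{0..t}|lborel. k s * (1 + 2 * A n s))" if t: "0 \<le> t" "t \<le> T"
    for n t
  proof -
    have int: "integrable lborel (\<lambda>s. k s * (1 + 2 * A n s))"
    proof (rule Bochner_Integration.integrable_bound)
      show "integrable lborel (\<lambda>s. k s * (1 + 2 * Max (R ` {..n})))" using k by simp
      show "(\<lambda>s. k s * (1 + 2 * A n s)) \<in> borel_measurable lborel"
        using k(1) by measurable
      show "AE s in lborel. norm (k s * (1 + 2 * A n s)) \<le> norm (k s * (1 + 2 * Max (R ` {..n})))"
      proof (rule AE_I2)
        fix s
        have "k s * (1 + 2 * A n s) \<le> k s * (1 + 2 * Max (R ` {..n}))" "0 \<le> k s * (1 + 2 * A n s)"
          using k(2)[of s] A0[of n s] AR[of n s] by (auto intro!: mult_left_mono)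
        then show "norm (k s * (1 + 2 * A n s)) \<le> norm (k s * (1 + 2 * Max (R ` {..n})))" by simp
      qed
    qed
    have nonneg: "0 \<le> (LINT s:{0..t}|lborel. k s * (1 + 2 * A n s))"
      using k(2) A0 by (intro set_LINT_nonneg) (simp add: add_nonneg_nonneg)
    have "a i t \<le> c + (LINT s:{0..t}|lborel. k s * (1 + 2 * A n s))" if i: "i \<le> n" for i
    proof (cases i)
      case 0 then show ?thesis using c t nonneg by force
    next
      case (Suc j)
      have ple: "k s * (1 + a j s + a (Suc j) s) \<le> k s * (1 + 2 * A n s)" for s
        using aA[of j n s] aA[of "Suc j" n s] i Suc k(2)[of s] by (intro mult_left_mono) auto
      have "(LINT s:{0..t}|lborel. k s * (1 + a j s + a (Suc j) s))
          \<le> (LINT s:{0..t}|lborel. k s * (1 + 2 * A n s))"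
      proof (rule set_integral_mono)
        show "set_integrable lborel {0..t} (\<lambda>s. k s * (1 + 2 * A n s))"
          using int by (rule set_integrable_lborelI)
        have "norm (k s * (1 + a j s + a (Suc j) s)) \<le> norm (k s * (1 + 2 * A n s))" for s
          using ple[of s] k(2)[of s] a(2)[of j s] a(2)[of "Suc j" s]
          by (smt (verit) mult_nonneg_nonneg real_norm_def)
        moreover have "(\<lambda>s. k s * (1 + a j s + a (Suc j) s)) \<in> borel_measurable lborel"
          using k(1) a(1)[of j] a(1)[of "Suc j"] by measurable
        ultimately have "integrable lborel (\<lambda>s. k s * (1 + a j s + a (Suc j) s))"
          by (intro Bochner_Integration.integrable_bound[OF int]) auto
        then show "set_integrable lborel {0..t} (\<lambda>s. k s * (1 + a j s + a (Suc j) s))"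
          by (rule set_integrable_lborelI)
      qed (use ple in auto)
      then show ?thesis using le[OF t, of j] Suc by simp
    qed
    then show ?thesis unfolding A_def[of n t] by (intro Max.boundedI) auto
  qed
  \<comment> \<open>The shift by 1/2 turns the affine kernel into a linear one,
    \<open>k * (1 + 2 * A) = 2 * k * (A + 1/2)\<close>, and makes the datum positive even for
    \<open>c = 0\<close>.\<close>
  have "A n t + 1/2 \<le> (c + 1/2) * exp (LINT s|lborel. 2 * k s)"
  proof (rule gronwall[where T = T and e = "\<lambda>s. A n s + 1/2" and R = "Max (R ` {..n}) + 1/2"
    and k = "\<lambda>s. 2 * k s"])
    fix t assume t: "0 \<le> t" "t \<le> T"
    show "A n t + 1/2 \<le> c + 1/2 + (LINT s:{0..t}|lborel. 2 * k s * (A n s + 1/2))"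
      using Ale[OF t, of n] by (simp add: algebra_simps)
  next
    show "A n s + 1/2 \<le> Max (R ` {..n}) + 1/2" for s using AR[of n s] by simp
    show "0 \<le> A n s + 1/2" for s using A0[of n s] by simp
    show "integrable lborel (\<lambda>s. 2 * k s)" using k(1) by simp
    show "0 \<le> 2 * k s" for s using k(2)[of s] by simp
    show "(\<lambda>s. A n s + 1/2) \<in> borel_measurable borel" by measurable
  qed (use c(1) t in simp_all)
  also have "\<dots> \<le> (c + 1) * exp (2 * (LINT s|lborel. k s))"
    by simp
  finally show ?thesis using aA[of n n t] by simp
qed

section \<open>Concave moduli and the Osgood condition\<close>

locale concave_modulus = modulus +
  assumes concave: "concave_on {0..} f"
begin

text \<open>Concavity at the midpoint of 0 and \<open>2 * u\<close>, with \<open>f 0 = 0\<close>.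
  The factor 2 in M originates here: position and law each contribute one copy of the mean distance
  to the argument of \<open>f\<close>.\<close>

lemma concave_add: "0 \<le> u \<Longrightarrow> f (2 * u) \<le> 2 * f u"
  using concave_onD[OF concave, of "1/2" 0 "2 * u"] zero by (simp add: field_simps)

text \<open>For \<open>u > 1\<close> the point 1 lies between 0 and \<open>u\<close>, so concavity
  gives \<open>f u \<le> f 1 * u\<close>; up to 1 monotonicity is enough. This makes
  \<open>f\<close> of a nonnegative integrable variable integrable.\<close>

lemma linear_growth: 
  assumes "0 \<le> u" shows "f u \<le> f 1 * (1 + u)"
proof (cases "u \<le> 1")
  case True
  have "f u \<le> f 1 * 1" using mono[OF assms True] by simp
  also have "\<dots> \<le> f 1 * (1 + u)" using pos[of 1] assms by (intro mult_left_mono) auto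
  finally show ?thesis .
next
  case False
  then have "(1 / u) * f u \<le> f 1"
    using concave_onD[OF concave, of "1 / u" 0 u] zero by (simp add: field_simps)
  then have "f u \<le> f 1 * u" using False by (simp add: field_simps)
  then show ?thesis using pos[of 1] by (simp add: algebra_simps)
qed

end

text \<open>\<open>G\<close> is described by its derivative and its range. The derivative fixes it
  up to an additive constant, which cancels when \<open>G v\<close> is compared with
  \<open>G r + c\<close>; this is the independence of M from the base point. \<open>G_small\<close>
  is the Osgood condition at 0, and \<open>G_large\<close> will come from the linear growth of a
  concave \<open>f\<close>.\<close>

locale osgood = concave_modulus +
  fixes G :: "real \<Rightarrow> real"
  assumes G_deriv: "\<And>u. u > 0 \<Longrightarrow> (G has_real_derivative 1 / f u) (at u)"
    and G_small: "\<And>c. \<exists>u>0. G u < c"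
    and G_large: "\<And>c. \<exists>u>0. G u > c"
begin

lemma G_strict_mono: "0 < u \<Longrightarrow> u < v \<Longrightarrow> G u < G v"
  by (rule DERIV_pos_imp_increasing) (auto intro!: exI G_deriv pos)

lemma G_less_iff: "0 < u \<Longrightarrow> 0 < v \<Longrightarrow> G u < G v \<longleftrightarrow> u < v"
  using G_strict_mono by (metis linorder_neq_iff order_less_asym)

lemma G_le_iff: "0 < u \<Longrightarrow> 0 < v \<Longrightarrow> G u \<le> G v \<longleftrightarrow> u \<le> v"
  using G_less_iff linorder_not_less by metis

lemma G_surj: "\<exists>u>0. G u = c"
proof -
  obtain a b where ab: "a > 0" "G a < c" "b > 0" "G b > c" using G_small G_large by blast
  then have "a \<le> b" using G_less_iff[of b a] by force
  then obtain x where "a \<le> x" "G x = c"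
    using IVT'[of G a c b] ab G_deriv
    by (metis DERIV_isCont atLeastAtMost_iff continuous_at_imp_continuous_on less_imp_le
      order_less_le_trans)
  then show ?thesis using ab by (intro exI[of _ x]) auto
qed

text \<open>\<open>G\<close> is unbounded below near 0, so from a small enough start an increment of
  \<open>c\<close> cannot reach \<open>G \<epsilon>\<close>. In other words M(r) tends to 0 with
  r.\<close>

lemma small_data:
  assumes "\<epsilon> > 0"
  obtains \<rho> where "\<rho> > 0" "\<And>r v. 0 < r \<Longrightarrow> r \<le> \<rho> \<Longrightarrow> 0 < v \<Longrightarrow> G v \<le> G r + c \<Longrightarrow> v < \<epsilon>"
proof -
  obtain \<rho> where \<rho>: "\<rho> > 0" "G \<rho> < G \<epsilon> - c" using G_small by blast
  show ?thesis
  proof (rule that[OF \<rho>(1)])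
    fix r v assume "0 < r" "r \<le> \<rho>" "0 < v" "G v \<le> G r + c"
    then have "G v < G \<epsilon>" using \<rho> G_le_iff[of r \<rho>] by simp
    then show "v < \<epsilon>" using G_less_iff \<open>0 < v\<close> assms by blast
  qed
qed

lemma bihari_le:
  fixes h e :: "real \<Rightarrow> real"
  assumes h: "integrable lborel h" "\<And>s. 0 \<le> h s"
    and e: "e \<in> borel_measurable borel" "\<And>s. 0 \<le> e s" "\<And>s. e s \<le> R"
    and r: "r > 0"
    and le: "\<And>t. 0 \<le> t \<Longrightarrow> t \<le> T \<Longrightarrow> e t \<le> r + (LINT s:{0..t}|lborel. h s * f (e s))"
    and T: "0 \<le> T"
  shows "G (r + (LINT s:{0..T}|lborel. h s * f (e s))) \<le> G r + (LINT s|lborel. h s)"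
proof -
  have "G (r + (LINT s:{0..T}|lborel. h s * f (e s))) \<le> G r + (LINT s:{0..T}|lborel. h s)"
    by (rule bihari[where T = T, OF G_deriv h e r le]) (use T in auto)
  also have "(LINT s:{0..T}|lborel. h s) \<le> (LINT s|lborel. h s)"
    using h unfolding set_lebesgue_integral_def
    by (intro integral_mono integrable_mult_indicator) (auto simp: indicator_def)
  finally show ?thesis by simp
qed

lemma kernel_mono:
  fixes h e e' :: "real \<Rightarrow> real"
  assumes h: "integrable lborel h" "\<And>s. 0 \<le> h s"
    and e: "e \<in> borel_measurable borel" "\<And>s. 0 \<le> e s" "\<And>s. e s \<le> R"
    and e': "e' \<in> borel_measurable borel" "\<And>s. 0 \<le> e' s" "\<And>s. e' s \<le> R'"
    and "\<And>s. 0 \<le> s \<Longrightarrow> s \<le> t \<Longrightarrow> e s \<le> e' s" "t \<le> t'"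
  shows "(LINT s:{0..t}|lborel. h s * f (e s)) \<le> (LINT s:{0..t'}|lborel. h s * f (e' s))"
  unfolding set_lebesgue_integral_def
proof (intro integral_mono integrable_mult_indicator)
  show "integrable lborel (\<lambda>s. h s * f (e s))" "integrable lborel (\<lambda>s. h s * f (e' s))"
    using integrable_kernel[OF h(1) e] integrable_kernel[OF h(1) e'] by auto
  fix s
  have "h s * f (e s) \<le> h s * f (e' s)" if "0 \<le> s" "s \<le> t"
    using assms(9)[OF that] e(2) h(2) by (intro mult_left_mono mono)
  moreover have "0 \<le> h s * f (e' s)" using e'(2) h(2) nonneg by auto
  ultimately show "indicator {0..t} s *\<^sub>R (h s * f (e s)) \<le> indicator {0..t'} s *\<^sub>R
    (h s * f (e' s))"
    using order_trans[OF _ \<open>t \<le> t'\<close>, of s] by (auto simp: indicator_def)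
qed auto

text \<open>One \<rho> serves all \<open>e\<close>, whatever their bound \<open>R\<close>. The datum
  \<open>r\<close> is bounded from above only, so that the homogeneous inequality
  \<open>r = 0\<close> is included although \<open>G\<close> is used at positive arguments.\<close>

definition small_within :: "(real \<Rightarrow> real) \<Rightarrow> real \<Rightarrow> real \<Rightarrow> real \<Rightarrow> bool" where
  "small_within h T \<epsilon> \<rho> \<longleftrightarrow> (\<forall>e r R t. e \<in> borel_measurable borel \<longrightarrow> (\<forall>s. 0 \<le> e s) \<longrightarrow> (\<forall>s. e s \<le> R) \<longrightarrow>
    r \<le> \<rho> \<longrightarrow> (\<forall>t. 0 \<le> t \<longrightarrow> t \<le> T \<longrightarrow> e t \<le> r + (LINT s:{0..t}|lborel. h s * f (e s))) \<longrightarrow>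
    0 \<le> t \<longrightarrow> t \<le> T \<longrightarrow> e t < \<epsilon>)"

lemma small_withinD:
  assumes "small_within h T \<epsilon> \<rho>" "e \<in> borel_measurable borel" "\<And>s. 0 \<le> e s" "\<And>s. e s \<le> R" "r \<le> \<rho>"
    "\<And>t. 0 \<le> t \<Longrightarrow> t \<le> T \<Longrightarrow> e t \<le> r + (LINT s:{0..t}|lborel. h s * f (e s))" "0 \<le> t" "t \<le> T"
  shows "e t < \<epsilon>"
  using assms(1)[unfolded small_within_def, rule_format, of e R r t] assms(2-) by blast

lemma small_solution:
  fixes h :: "real \<Rightarrow> real"
  assumes h: "integrable lborel h" "\<And>s. 0 \<le> h s" and T: "0 \<le> T" and "\<epsilon> > 0"
  obtains \<rho> where "\<rho> > 0" "small_within h T \<epsilon> \<rho>"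
proof -
  obtain \<rho> where \<rho>: "\<rho> > 0" "\<And>r v. 0 < r \<Longrightarrow> r \<le> \<rho> \<Longrightarrow> 0 < v \<Longrightarrow>
      G v \<le> G r + (LINT s|lborel. h s) \<Longrightarrow> v < \<epsilon>"
    using small_data[OF assms(4)] by metis
  show ?thesis
  proof (rule that[OF \<rho>(1)], unfold small_within_def, intro allI impI)
    fix e r R t assume e': "e \<in> borel_measurable borel" "\<forall>s. 0 \<le> e s" "\<forall>s. e s \<le> R" and r: "r \<le> \<rho>"
      and le: "\<forall>t. 0 \<le> t \<longrightarrow> t \<le> T \<longrightarrow> e t \<le> r + (LINT s:{0..t}|lborel. h s * f (e s))"
      and t: "0 \<le> t" "t \<le> T"
    note e = e'(1) e'(2,3)[rule_format]
    have le': "e t \<le> \<rho> + (LINT s:{0..t}|lborel. h s * f (e s))" if "0 \<le> t" "t \<le> T" for t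
      using le that r by force
    have *: "G (\<rho> + (LINT s:{0..T}|lborel. h s * f (e s))) \<le> G \<rho> + (LINT s|lborel. h s)"
      by (rule bihari_le[where R = R]) (use h e \<rho>(1) T le' in auto)
    have "0 \<le> (LINT s:{0..T}|lborel. h s * f (e s))"
      using h(2) e(2) nonneg by (intro set_LINT_nonneg) auto
    then have "\<rho> + (LINT s:{0..T}|lborel. h s * f (e s)) < \<epsilon>"
      using \<rho>(1) * by (intro \<rho>(2)[of \<rho>]) auto
    moreover have "(LINT s:{0..t}|lborel. h s * f (e s)) \<le> (LINT s:{0..T}|lborel. h s * f (e s))"
      by (rule kernel_mono[OF h e e]) (use t in auto)
    ultimately show "e t < \<epsilon>" using le'[OF t] by simp
  qed
qed

text \<open>The suprema \<open>c k\<close> over all pairs of indices beyond \<open>k\<close>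
  decrease to a limit \<open>A\<close>. Dominated convergence passes the recursion to the limit,
  where it becomes the homogeneous Osgood inequality with kernel \<open>2 * h\<close>; hence
  \<open>A = 0\<close> on \<open>{0..T}\<close>. Only pointwise convergence comes out of this, and
  one more use of the recursion makes it uniform in time.\<close>

lemma picard_cauchy:
  fixes h :: "real \<Rightarrow> real" and a :: "nat \<Rightarrow> nat \<Rightarrow> real \<Rightarrow> real"
  assumes h: "integrable lborel h" "\<And>s. 0 \<le> h s" and T: "0 \<le> T"
    and a: "\<And>n m. a n m \<in> borel_measurable borel" "\<And>n m s. 0 \<le> a n m s" "\<And>n m s. a n m s \<le> R"
    and le: "\<And>n m t. 0 \<le> t \<Longrightarrow> t \<le> T \<Longrightarrow>
      a (Suc n) (Suc m) t \<le> (LINT s:{0..t}|lborel. h s * f (a n m s + a (Suc n) (Suc m) s))"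
    and \<epsilon>: "\<epsilon> > 0"
  shows "\<exists>N. \<forall>n\<ge>N. \<forall>m\<ge>N. \<forall>t\<in>{0..T}. a n m t < \<epsilon>"
proof -
  define c where "c k s = (SUP p\<in>{k..} \<times> {k..}. a (fst p) (snd p) s)" for k s
  have bdd: "bdd_above ((\<lambda>p. a (fst p) (snd p) s) ` S)" for s S
    by (rule bdd_aboveI2[of _ _ R]) (rule a(3))
  have ac: "a n m s \<le> c k s" if "n \<ge> k" "m \<ge> k" for n m k s
    unfolding c_def using that by (intro cSUP_upper2[OF bdd, of "(n, m)"]) auto
  have c[measurable]: "c k \<in> borel_measurable borel" for k
    unfolding c_def by (rule borel_measurable_cSUP) (use a(1) in \<open>simp_all add: bdd\<close>)
  have cR: "c k s \<le> R" for k s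
    unfolding c_def using a(3) by (intro cSUP_least) auto
  have c0: "0 \<le> c k s" for k s
    using ac[of k k k s] a(2)[of k k s] by simp
  have dec: "decseq (\<lambda>k. c k s)" for s
    unfolding c_def decseq_def by (auto intro!: cSUP_subset_mono bdd)
  have "\<exists>l. (\<lambda>k. c k s) \<longlonglongrightarrow> l \<and> (\<forall>k. l \<le> c k s)" for s
  proof -
    obtain l where "(\<lambda>k. c k s) \<longlonglongrightarrow> l" "\<forall>k. l \<le> c k s"
      using decseq_convergent[of "\<lambda>k. c k s" 0] dec c0 by blast
    then show ?thesis by blast
  qed
  then obtain A where A: "\<And>s. (\<lambda>k. c k s) \<longlonglongrightarrow> A s" "\<And>s k. A s \<le> c k s" by metis
  have A0: "0 \<le> A s" for s by (rule LIMSEQ_le_const[OF A(1)]) (use c0 in auto)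
  have AR: "A s \<le> R" for s using A(2)[of s 0] cR[of 0 s] by simp
  have Am[measurable]: "A \<in> borel_measurable borel"
    using A(1) c by (rule borel_measurable_LIMSEQ_real)
  have lim: "(\<lambda>k. LINT s:{0..t}|lborel. h s * f (2 * c k s))
      \<longlonglongrightarrow> (LINT s:{0..t}|lborel. h s * f (2 * A s))" for t
    unfolding set_lebesgue_integral_def
  proof (rule integral_dominated_convergence[where w = "\<lambda>s. h s * f (2 * R)"])
    have [measurable]: "h \<in> borel_measurable borel" using h(1) by auto
    show "(\<lambda>s. indicator {0..t} s *\<^sub>R (h s * f (2 * A s))) \<in> borel_measurable lborel"
      "(\<lambda>s. indicator {0..t} s *\<^sub>R (h s * f (2 * c i s))) \<in> borel_measurable lborel" for i
      using A0 c0 by (auto intro!: measurable borel_measurable_times borel_measurable_scaleR)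
    show "integrable lborel (\<lambda>s. h s * f (2 * R))" using h by simp
    show "AE s in lborel. (\<lambda>i. indicator {0..t} s *\<^sub>R (h s * f (2 * c i s)))
        \<longlonglongrightarrow> indicator {0..t} s *\<^sub>R (h s * f (2 * A s))"
      using A0 c0 by (intro AE_I2 tendsto_intros tendsto A(1)) auto
    have "f (2 * c i s) \<le> f (2 * R)" for i s using c0 cR by (intro mono) auto
    then show "AE s in lborel. norm (indicator {0..t} s *\<^sub>R (h s * f (2 * c i s)))
      \<le> h s * f (2 * R)" for i
      using h(2) c0 nonneg order_trans[OF c0 cR]
      by (auto simp: indicator_def abs_mult intro!: AE_I2 mult_left_mono)
  qed
  \<comment> \<open>The indices on the left exceed those under the integral by one, so both terms in
    the argument of \<open>f\<close> are bounded by \<open>c k\<close>, and the supremum may be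
    taken.\<close>
  have cle: "c (Suc k) t \<le> (LINT s:{0..t}|lborel. h s * f (2 * c k s))" if t: "0 \<le> t" "t \<le> T"
    for k t
    unfolding c_def[of "Suc k" t]
  proof (rule cSUP_least)
    fix p :: "nat \<times> nat" assume p: "p \<in> {Suc k..} \<times> {Suc k..}"
    obtain n m where nm: "p = (n, m)" by (cases p)
    with p obtain n' m' where n': "n = Suc n'" "m = Suc m'" "n' \<ge> k" "m' \<ge> k"
      by (cases n; cases m) auto
    have "a n m t \<le> (LINT s:{0..t}|lborel. h s * f (a n' m' s + a n m s))"
      unfolding n'(1,2) using le[OF t] .
    also have "\<dots> \<le> (LINT s:{0..t}|lborel. h s * f (2 * c k s))"
    proof (rule kernel_mono[OF h, where R = "2 * R" and R' = "2 * R"])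
      show "a n' m' s + a n m s \<le> 2 * c k s" for s
        using ac[of k n' m' s] ac[of k n m s] n' by simp
      show "a n' m' s + a n m s \<le> 2 * R" for s
        using a(3)[of n' m' s] a(3)[of n m s] by simp
    qed (use a c0 cR in auto)
    finally show "a (fst p) (snd p) t \<le> (LINT s:{0..t}|lborel. h s * f (2 * c k s))"
      by (simp add: nm)
  qed auto
  have Ale: "A t \<le> 0 + (LINT s:{0..t}|lborel. 2 * h s * f (A s))" if t: "0 \<le> t" "t \<le> T" for t
  proof -
    have "A t \<le> (LINT s:{0..t}|lborel. h s * f (2 * A s))"
      using A(2)[of t] cle[OF t] by (intro LIMSEQ_le_const[OF lim]) (auto intro: order_trans)
    also have "\<dots> \<le> (LINT s:{0..t}|lborel. 2 * h s * f (A s))"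
      unfolding set_lebesgue_integral_def
    proof (intro integral_mono integrable_mult_indicator)
      show "integrable lborel (\<lambda>s. h s * f (2 * A s))"
        using A0 AR by (intro integrable_kernel[OF h(1), where R = "2 * R"]) auto
      show "integrable lborel (\<lambda>s. 2 * h s * f (A s))"
        using A0 AR h(1) by (intro integrable_kernel[where R = R]) auto
      fix s
      have "h s * f (2 * A s) \<le> h s * (2 * f (A s))"
        using h(2) concave_add[OF A0] by (intro mult_left_mono) auto
      then show "indicator {0..t} s *\<^sub>R (h s * f (2 * A s)) \<le> indicator {0..t} s *\<^sub>R
        (2 * h s * f (A s))"
        by (auto simp: indicator_def)
    qed auto
    finally show ?thesis by simp
  qed
  have h2: "integrable lborel (\<lambda>s. 2 * h s)" "\<And>s. 0 \<le> 2 * h s" using h by auto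
  have Azero: "A t = 0" if t: "0 \<le> t" "t \<le> T" for t
  proof (rule antisym[OF _ A0], rule field_le_epsilon)
    fix \<eta> :: real assume \<eta>: "\<eta> > 0"
    show "A t \<le> 0 + \<eta>"
    proof (rule small_solution[where h = "\<lambda>s. 2 * h s" and \<epsilon> = \<eta>, OF h2 T \<eta>])
    fix \<rho> :: real assume \<rho>: "\<rho> > 0" "small_within (\<lambda>s. 2 * h s) T \<eta> \<rho>"
    have "A t < \<eta>"
    proof (rule small_withinD[OF \<rho>(2), where e = A and R = R and r = 0])
      show "A t \<le> 0 + (LINT s:{0..t}|lborel. 2 * h s * f (A s))" if "0 \<le> t" "t \<le> T" for t
        using that by (rule Ale)
    qed (use Am A0 AR t \<rho>(1) in simp_all)
    then show "A t \<le> 0 + \<eta>" by simp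
    qed
  qed
  \<comment> \<open>The integral over \<open>{0..T}\<close> bounds \<open>c (Suc k) t\<close> for
    all \<open>t\<close> at once, and it tends to 0: this is the uniformity in time.\<close>
  have "(LINT s:{0..T}|lborel. h s * f (2 * A s)) = (LINT s:{0..T}|lborel. 0)"
    by (rule set_lebesgue_integral_cong) (auto simp: Azero zero)
  then have "(\<lambda>k. LINT s:{0..T}|lborel. h s * f (2 * c k s)) \<longlonglongrightarrow> 0"
    using lim[of T] by simp
  then have "eventually (\<lambda>k. (LINT s:{0..T}|lborel. h s * f (2 * c k s)) < \<epsilon>) sequentially"
    using \<epsilon> by (rule order_tendstoD)
  then obtain k where k: "(LINT s:{0..T}|lborel. h s * f (2 * c k s)) < \<epsilon>"
    by (auto simp: eventually_sequentially)
  show ?thesis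
  proof (intro exI[of _ "Suc k"] allI ballI impI)
    fix n m t assume *: "n \<ge> Suc k" "m \<ge> Suc k" "t \<in> {0..T}"
    have "a n m t \<le> c (Suc k) t" using * by (intro ac) auto
    also have "\<dots> \<le> (LINT s:{0..t}|lborel. h s * f (2 * c k s))" using * by (intro cle) auto
    also have "\<dots> \<le> (LINT s:{0..T}|lborel. h s * f (2 * c k s))"
      by (rule kernel_mono[OF h, where R = "2 * R" and R' = "2 * R"]) (use c0 cR * in auto)
    finally show "a n m t < \<epsilon>" using k by simp
  qed
qed

end

section \<open>The function \<open>osgood_G\<close> meets the Osgood conditions\<close>

lemma osgood_G_deriv:
  assumes "modulus f" "x0 > 0" "u > 0"
  shows "(osgood_G f x0 has_real_derivative 1 / f u) (at u)"
proof -
  interpret modulus f by (rule assms(1))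
  \<comment> \<open>The positive numbers \<open>a\<close> and \<open>b\<close> enclose both
    \<open>x0\<close> and \<open>u\<close> strictly: \<open>1 / f\<close> is continuous on
    \<open>{a..b}\<close>, away from the zero of \<open>f\<close>, and \<open>u\<close> is an
    interior point whatever the order of \<open>x0\<close> and \<open>u\<close>.\<close>
  define a b where "a = min x0 u / 2" and "b = max x0 u + 1"
  have ab: "0 < a" "a < x0" "x0 < b" "a < u" "u < b" using assms by (auto simp: a_def b_def)
  have "continuous_on {a..b} (\<lambda>r. 1 / f r)"
  proof (intro continuous_intros continuous_on_subset[OF cont] ballI)
    fix x assume "x \<in> {a..b}"
    then show "f x \<noteq> 0" using ab pos[of x] by simp
  qed (use ab in auto)
  then have "((\<lambda>u. LBINT y=ereal x0..ereal u. 1 / f y) has_vector_derivative 1 / f u)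
    (at u within {a..b})"
    using ab by (intro interval_integral_FTC2) auto
  then have "((\<lambda>u. LBINT y=ereal x0..ereal u. 1 / f y) has_vector_derivative 1 / f u)
    (at u within {a<..<b})"
    by (rule has_vector_derivative_within_subset) auto
  moreover have "at u within {a<..<b} = at u"
    using ab by (intro at_within_open) auto
  ultimately show ?thesis
    unfolding osgood_G_def[abs_def] has_real_derivative_iff_has_vector_derivative by (simp only:)
qed

text \<open>At infinity, a concave \<open>f\<close> lies below \<open>f 1 * u\<close>, so
  \<open>G\<close> grows at least like \<open>ln u / f 1\<close>. At 0, a lower bound of
  \<open>G\<close> would bound the integrals of \<open>1 / f\<close> over
  \<open>{1 / real (Suc n)..1}\<close>, and monotone convergence would contradict their
  divergence.\<close>

proposition osgood_osgood_G:
  assumes f: "modulus_of_continuity f" and conc: "concave_on {0..} f"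
    and div: "\<forall>\<epsilon>>0. (\<integral>\<^sup>+u\<in>{0<..<\<epsilon>}. ennreal (1 / f u) \<partial>lborel) = \<infinity>"
    and x0: "x0 > 0"
  shows "osgood f (osgood_G f x0)"
proof -
  have mod: "modulus f" using f by unfold_locales
  interpret modulus f by fact
  let ?G = "osgood_G f x0"
  note G = osgood_G_deriv[OF mod x0]
  show ?thesis
  proof unfold_locales
    fix c
    show "\<exists>u>0. ?G u > c"
    proof -
      have mono': "?G 1 - ln 1 / f 1 \<le> ?G u - ln u / f 1" if "1 \<le> u" for u
      proof (rule DERIV_nonneg_imp_nondecreasing[where f = "\<lambda>u. ?G u - ln u / f 1", OF that])
        fix x :: real assume x: "1 \<le> x" "x \<le> u"
        have "(1 / x) * f x \<le> f 1"
          using concave_onD[OF conc, of "1 / x" 0 x] zero x by (simp add: field_simps)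
        then have "f x \<le> f 1 * x" using x by (simp add: field_simps)
        then have "1 / (f 1 * x) \<le> 1 / f x"
          using x pos[of x] pos[of 1] by (intro divide_left_mono) simp_all
        moreover have "((\<lambda>u. ?G u - ln u / f 1) has_real_derivative 1 / f x - 1 / x / f 1) (at x)"
          using x by (intro DERIV_diff[OF G DERIV_cdivide[OF DERIV_ln_divide]]) simp_all
        ultimately show "\<exists>y. ((\<lambda>u. ?G u - ln u / f 1) has_real_derivative y) (at x) \<and> 0 \<le> y"
          by (intro exI[of _ "1 / f x - 1 / x / f 1"] conjI) (simp_all add: mult.commute)
      qed
      \<comment> \<open>Solves \<open>?G 1 + w / f 1 > c\<close>; the maximum with 0 keeps
        \<open>exp w\<close> at or above 1, where the comparison with the logarithm holds.\<close>
      define w where "w = max 0 ((c - ?G 1) * f 1 + 1)"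
      have "(c - ?G 1) * f 1 < w" by (simp add: w_def)
      then have "c - ?G 1 < w / f 1" using pos[of 1] by (simp add: field_simps)
      moreover have "1 \<le> exp w" by (simp add: w_def)
      ultimately have "c < ?G (exp w)" using mono'[of "exp w"] by simp
      then show ?thesis by (intro exI[of _ "exp w"]) auto
    qed
    show "\<exists>u>0. ?G u < c"
    proof (rule ccontr)
      assume "\<not> ?thesis"
      then have c: "c \<le> ?G u" if "u > 0" for u using that not_less by blast
      define g where "g n u = ennreal (1 / f u) * indicator {1 / real (Suc n)..1} u" for n u
      \<comment> \<open>The cut-off is kept as a factor of the integrand, which makes it Borel on
        the whole line; nothing is known about \<open>f\<close> at negative arguments.\<close>
      have mf: "(\<lambda>u. 1 / f u * indicator {1 / real (Suc n)..1} u) \<in> borel_measurable borel" for n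
      proof -
        have "continuous_on {1 / real (Suc n)..1} (\<lambda>u. 1 / f u)"
        proof (intro continuous_intros continuous_on_subset[OF cont] ballI)
          have p: "0 < 1 / real (Suc n)" by simp
          show "{1 / real (Suc n)..1} \<subseteq> {0..}"
            by (rule subsetI) (use order_trans[OF less_imp_le[OF p]] in simp)
          fix x assume "x \<in> {1 / real (Suc n)..1}"
          then have "0 < x" using less_le_trans[OF p, of x] by simp
          then show "f x \<noteq> 0" using pos[of x] by simp
        qed
        then have "(\<lambda>u. indicator {1 / real (Suc n)..1} u *\<^sub>R (1 / f u)) \<in> borel_measurable borel"
          by (intro borel_measurable_continuous_on_indicator) auto
        then show ?thesis by (simp add: mult.commute)
      qed
      have gm: "g n \<in> borel_measurable lborel" for n
      proof -
        have "g n = (\<lambda>u. ennreal (1 / f u * indicator {1 / real (Suc n)..1} u))"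
          by (auto simp: g_def indicator_def)
        then show ?thesis using mf[of n] by simp
      qed
      have "(\<integral>\<^sup>+u\<in>{0<..<1}. ennreal (1 / f u) \<partial>lborel) \<le> (\<integral>\<^sup>+u. (SUP n. g n u) \<partial>lborel)"
      proof (rule nn_integral_mono)
        fix u :: real
        show "ennreal (1 / f u) * indicator {0<..<1} u \<le> (SUP n. g n u)"
        proof (cases "u \<in> {0<..<1}")
          case True
          then obtain n where "1 / real (Suc n) < u" using nat_approx_posE by auto
          then have "ennreal (1 / f u) * indicator {0<..<1} u \<le> g n u" using True
            by (simp add: g_def)
          then show ?thesis by (rule SUP_upper2[OF UNIV_I])
        qed simp
      qed
      also have "\<dots> = (SUP n. \<integral>\<^sup>+u. g n u \<partial>lborel)"
      proof (rule nn_integral_monotone_convergence_SUP[OF _ gm], rule incseq_SucI, rule le_funI)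
        fix n and u :: real
        have "1 / real (Suc (Suc n)) \<le> 1 / real (Suc n)" by (intro divide_left_mono) auto
        then have "indicator {1 / real (Suc n)..1} u
          \<le> (indicator {1 / real (Suc (Suc n))..1} u :: ennreal)"
          by (auto simp: indicator_def)
        then show "g n u \<le> g (Suc n) u" unfolding g_def by (intro mult_left_mono) auto
      qed
      also have "\<dots> \<le> ennreal (?G 1 - c)"
      proof (rule SUP_least)
        fix n
        have p: "0 < 1 / real (Suc n)" "1 / real (Suc n) \<le> 1" by auto
        have "(\<integral>\<^sup>+u. ennreal (1 / f u * indicator {1 / real (Suc n)..1} u) * indicator {1 / real
          (Suc n)..1} u \<partial>lborel)
          = ennreal (?G 1 - ?G (1 / real (Suc n)))"
        proof (rule nn_integral_FTC_Icc[OF _ _ _ p(2)])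
          show "(\<lambda>u. 1 / f u * indicator {1 / real (Suc n)..1} u) \<in> borel_measurable borel"
            by (rule mf)
          fix x :: real assume x: "x \<in> {1 / real (Suc n)..1}"
          then have "x > 0" using less_le_trans[OF p(1), of x] by simp
          then have "(?G has_real_derivative 1 / f x) (at x)" "0 \<le> 1 / f x"
            using G[of x] pos[of x] by auto
          moreover have "indicator {1 / real (Suc n)..1} x = (1::real)" using x by simp
          ultimately show "(?G has_real_derivative 1 / f x * indicator {1 / real (Suc n)..1} x)
            (at x)"
            "0 \<le> 1 / f x * indicator {1 / real (Suc n)..1} x"
            by simp_all
        qed
        moreover have "(\<integral>\<^sup>+u. g n u \<partial>lborel) = 
          (\<integral>\<^sup>+u. ennreal (1 / f u * indicator {1 / real (Suc n)..1} u) * indicator {1 / real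
            (Suc n)..1} u \<partial>lborel)"
          by (rule nn_integral_cong) (auto simp: g_def indicator_def)
        ultimately show "(\<integral>\<^sup>+u. g n u \<partial>lborel) \<le> ennreal (?G 1 - c)"
          using c[OF p(1)] by (simp add: ennreal_leI)
      qed
      finally show False using div[rule_format, of 1] by (simp add: top_unique)
    qed
  qed (fact conc | erule G)+
qed

context osgood
begin

lemma inv_into_G:
  "0 < inv_into {0<..} G c" "G (inv_into {0<..} G c) = c"
proof -
  have "c \<in> G ` {0<..}" using G_surj[of c] by auto
  then show "0 < inv_into {0<..} G c" "G (inv_into {0<..} G c) = c"
    using inv_into_into[of c G "{0<..}"] f_inv_into_f[of c G "{0<..}"] by auto
qed

lemma le_inv_into_G: "0 < v \<Longrightarrow> G v \<le> c \<Longrightarrow> v \<le> inv_into {0<..} G c"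
  using G_le_iff inv_into_G by metis

text \<open>Right continuity of \<open>r \<mapsto> G\<inverse>(G r + c)\<close>, including the limit \<open>0\<close> at \<open>r = 0\<close>.\<close>

lemma le_osgood_M_of_approx:
  assumes "0 \<le> r" "0 \<le> v"
    and *: "\<And>r'. r < r' \<Longrightarrow> v \<le> inv_into {0<..} G (G r' + c)"
  shows "v \<le> (if r = 0 then 0 else inv_into {0<..} G (G r + c))"
proof (cases "r = 0")
  case True
  have "v \<le> \<epsilon>" if "\<epsilon> > 0" for \<epsilon>
  proof -
    obtain \<rho> where \<rho>: "\<rho> > 0" "G \<rho> < G \<epsilon> - c" using G_small by blast
    have "inv_into {0<..} G (G \<rho> + c) < \<epsilon>"
      using \<rho> that inv_into_G[of "G \<rho> + c"] G_less_iff[of "inv_into {0<..} G (G \<rho> + c)" \<epsilon>] by simp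
    then show ?thesis using *[of \<rho>] \<rho> True by simp
  qed
  then show ?thesis using True by (simp add: field_le_epsilon)
next
  case False
  then have r: "r > 0" using assms by simp
  show ?thesis
  proof (rule ccontr)
    assume "\<not> ?thesis"
    then have v: "inv_into {0<..} G (G r + c) < v" using False by simp
    then have v0: "v > 0" using inv_into_G(1)[of "G r + c"] by simp
    have Gv: "G r + c < G v"
      using v v0 inv_into_G[of "G r + c"] G_less_iff by metis
    \<comment> \<open>\<open>G r'\<close> is put halfway between \<open>G r\<close> and
      \<open>G v - c\<close>: then \<open>r < r'\<close>, while \<open>G r' + c\<close> is still
      below \<open>G v\<close>.\<close>
    obtain r' where r': "r' > 0" "G r' = (G r + G v - c) / 2" using G_surj by blast
    then have "r < r'" using G_less_iff[OF r r'(1)] Gv by simp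
    then have "G v \<le> G r' + c"
      using *[of r'] inv_into_G[of "G r' + c"] v0 G_le_iff by metis
    then have "2 * G v \<le> 2 * G r' + 2 * c" by simp
    then show False using r'(2) Gv by (simp add: field_simps)
  qed
qed

end

section \<open>Couplings and the Wasserstein distance\<close>

lemma coupling_distr:
  assumes "X \<in> measurable P \<mu>" "Y \<in> measurable P \<nu>" "distr P \<mu> X = \<mu>" "distr P \<nu> Y = \<nu>"
  shows "distr P (\<mu> \<Otimes>\<^sub>M \<nu>) (\<lambda>\<omega>. (X \<omega>, Y \<omega>)) \<in> couplings \<mu> \<nu>"
  using assms by (auto simp: couplings_def distr_distr comp_def)

lemma couplings_measurable:
  assumes "m \<in> couplings \<mu> \<nu>"
  shows "fst \<in> measurable m \<mu>" "snd \<in> measurable m \<nu>"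
    "\<And>f N. f \<in> measurable (\<mu> \<Otimes>\<^sub>M \<nu>) N \<Longrightarrow> f \<in> measurable m N"
  using assms by (auto simp: couplings_def cong: measurable_cong_sets)

lemma couplings_space: "m \<in> couplings \<mu> \<nu> \<Longrightarrow> space m = space \<mu> \<times> space \<nu>"
  using sets_eq_imp_space_eq[of m "\<mu> \<Otimes>\<^sub>M \<nu>"] by (simp add: couplings_def space_pair_measure)

lemma couplings_prob:
  assumes "m \<in> couplings \<mu> \<nu>" "prob_space \<mu>"
  shows "prob_space m"
  using assms prob_space_distrD[OF couplings_measurable(1)[OF assms(1)]]
    by (auto simp: couplings_def)

lemma couplings_integral:
  fixes \<phi> :: "_ \<Rightarrow> real"
  assumes m: "m \<in> couplings \<mu> \<nu>"
  shows "\<phi> \<in> borel_measurable \<mu> \<Longrightarrow> (\<integral>z. \<phi> (fst z) \<partial>m) = (\<integral>x. \<phi> x \<partial>\<mu>)"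
    "\<phi> \<in> borel_measurable \<nu> \<Longrightarrow> (\<integral>z. \<phi> (snd z) \<partial>m) = (\<integral>x. \<phi> x \<partial>\<nu>)"
    "integrable \<mu> \<phi> \<Longrightarrow> integrable m (\<lambda>z. \<phi> (fst z))"
    "integrable \<nu> \<phi> \<Longrightarrow> integrable m (\<lambda>z. \<phi> (snd z))"
proof -
  have eq: "distr m \<mu> fst = \<mu>" "distr m \<nu> snd = \<nu>" using m by (auto simp: couplings_def)
  note mf = couplings_measurable[OF m]
  show "\<phi> \<in> borel_measurable \<mu> \<Longrightarrow> (\<integral>z. \<phi> (fst z) \<partial>m) = (\<integral>x. \<phi> x \<partial>\<mu>)"
    using integral_distr[OF mf(1), of \<phi>] eq by simp
  show "\<phi> \<in> borel_measurable \<nu> \<Longrightarrow> (\<integral>z. \<phi> (snd z) \<partial>m) = (\<integral>x. \<phi> x \<partial>\<nu>)"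
    using integral_distr[OF mf(2), of \<phi>] eq by simp
  show "integrable \<mu> \<phi> \<Longrightarrow> integrable m (\<lambda>z. \<phi> (fst z))"
    using integrable_distr[OF mf(1), of \<phi>] eq by simp
  show "integrable \<nu> \<phi> \<Longrightarrow> integrable m (\<lambda>z. \<phi> (snd z))"
    using integrable_distr[OF mf(2), of \<phi>] eq by simp
qed

text \<open>Integrating out one variable leaves the other marginal unchanged when the partial
  integrals of \<open>K\<close> are 1. The product measure is the case \<open>K = 1\<close>; the
  coupling along a finite partition, used for empirical measures, is another density of this
  kind.\<close>

lemma density_coupling:
  assumes "prob_space \<mu>" "prob_space \<nu>"
    and K[measurable]: "K \<in> borel_measurable (\<mu> \<Otimes>\<^sub>M \<nu>)"
    and K1: "AE x in \<mu>. (\<integral>\<^sup>+y. K (x, y) \<partial>\<nu>) = 1"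
    and K2: "AE y in \<nu>. (\<integral>\<^sup>+x. K (x, y) \<partial>\<mu>) = 1"
  shows "density (\<mu> \<Otimes>\<^sub>M \<nu>) K \<in> couplings \<mu> \<nu>"
proof -
  interpret \<mu>: prob_space \<mu> by fact
  interpret \<nu>: prob_space \<nu> by fact
  interpret pair_sigma_finite \<mu> \<nu> ..
  have "distr (density (\<mu> \<Otimes>\<^sub>M \<nu>) K) \<mu> fst = \<mu>"
  proof (rule measure_eqI)
    fix A assume "A \<in> sets (distr (density (\<mu> \<Otimes>\<^sub>M \<nu>) K) \<mu> fst)"
    then have A[measurable]: "A \<in> sets \<mu>" by simp
    have "emeasure (distr (density (\<mu> \<Otimes>\<^sub>M \<nu>) K) \<mu> fst) A
        = (\<integral>\<^sup>+z. K z * indicator A (fst z) \<partial>(\<mu> \<Otimes>\<^sub>M \<nu>))"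
      by (subst emeasure_distr, simp, simp, subst emeasure_density, simp, simp)
        (auto intro!: nn_integral_cong simp: indicator_def)
    also have "\<dots> = (\<integral>\<^sup>+x. (\<integral>\<^sup>+y. K (x, y) * indicator A x \<partial>\<nu>) \<partial>\<mu>)"
      by (subst \<nu>.nn_integral_fst[symmetric]) auto
    also have "\<dots> = (\<integral>\<^sup>+x. indicator A x \<partial>\<mu>)"
    proof (rule nn_integral_cong_AE)
      show "AE x in \<mu>. (\<integral>\<^sup>+y. K (x, y) * indicator A x \<partial>\<nu>) = indicator A x"
        using K1 AE_space
      proof eventually_elim
        case (elim x)
        have "(\<integral>\<^sup>+y. K (x, y) * indicator A x \<partial>\<nu>) = (\<integral>\<^sup>+y. K (x, y) \<partial>\<nu>) * indicator A x"
          by (rule nn_integral_multc) (use elim in measurable)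
        then show ?case using elim by simp
      qed
    qed
    also have "\<dots> = emeasure \<mu> A" by simp
    finally show "emeasure (distr (density (\<mu> \<Otimes>\<^sub>M \<nu>) K) \<mu> fst) A = emeasure \<mu> A" .
  qed simp
  moreover have "distr (density (\<mu> \<Otimes>\<^sub>M \<nu>) K) \<nu> snd = \<nu>"
  proof (rule measure_eqI)
    fix A assume "A \<in> sets (distr (density (\<mu> \<Otimes>\<^sub>M \<nu>) K) \<nu> snd)"
    then have A[measurable]: "A \<in> sets \<nu>" by simp
    have "emeasure (distr (density (\<mu> \<Otimes>\<^sub>M \<nu>) K) \<nu> snd) A
        = (\<integral>\<^sup>+z. K z * indicator A (snd z) \<partial>(\<mu> \<Otimes>\<^sub>M \<nu>))"
      by (subst emeasure_distr, simp, simp, subst emeasure_density, simp, simp)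
        (auto intro!: nn_integral_cong simp: indicator_def)
    also have "\<dots> = (\<integral>\<^sup>+y. (\<integral>\<^sup>+x. K (x, y) * indicator A y \<partial>\<mu>) \<partial>\<nu>)"
      by (subst nn_integral_snd[symmetric]) auto
    also have "\<dots> = (\<integral>\<^sup>+y. indicator A y \<partial>\<nu>)"
    proof (rule nn_integral_cong_AE)
      show "AE y in \<nu>. (\<integral>\<^sup>+x. K (x, y) * indicator A y \<partial>\<mu>) = indicator A y"
        using K2 AE_space
      proof eventually_elim
        case (elim y)
        have "(\<integral>\<^sup>+x. K (x, y) * indicator A y \<partial>\<mu>) = (\<integral>\<^sup>+x. K (x, y) \<partial>\<mu>) * indicator A y"
          by (rule nn_integral_multc) (use elim in measurable)
        then show ?case using elim by simp
      qed
    qed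
    also have "\<dots> = emeasure \<nu> A" by simp
    finally show "emeasure (distr (density (\<mu> \<Otimes>\<^sub>M \<nu>) K) \<nu> snd) A = emeasure \<nu> A" .
  qed simp
  ultimately show ?thesis by (simp add: couplings_def)
qed

lemma pair_coupling:
  assumes "prob_space \<mu>" "prob_space \<nu>" shows "\<mu> \<Otimes>\<^sub>M \<nu> \<in> couplings \<mu> \<nu>"
  using density_coupling[OF assms, of "\<lambda>_. 1"] assms
  by (simp add: density_1 prob_space.emeasure_space_1)

text \<open>
  The form in which separability of \<open>E\<close> is used: a countable measurable partition into sets of
  small diameter, coded by the index of the cell.
\<close>

definition small_partitions :: "'e::real_normed_vector set \<Rightarrow> bool" where
  "small_partitions E \<longleftrightarrow> (\<forall>\<epsilon>>0. \<exists>j::'e \<Rightarrow> nat. j \<in> measurable (borel_on E) (count_space UNIV) \<and>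
    (\<forall>x\<in>E. \<forall>y\<in>E. j x = j y \<longrightarrow> dist x y \<le> \<epsilon>))"

lemma space_borel_on[simp]: "space (borel_on E) = E"
  by (simp add: space_restrict_space)

lemma norm_measurable_on[measurable]: "norm \<in> borel_measurable (borel_on E)"
  by (rule measurable_restrict_space1) measurable

lemma small_partitions_UNIV: "small_partitions (UNIV :: 'a::euclidean_space set)"
  unfolding small_partitions_def
proof (intro allI impI)
  fix \<epsilon> :: real assume \<epsilon>: "\<epsilon> > 0"
  obtain D :: "'a set" where D: "countable D" "\<And>X. open X \<Longrightarrow> X \<noteq> {} \<Longrightarrow> \<exists>d\<in>D. d \<in> X"
    using countable_dense_setE by blast
  then have "D \<noteq> {}" by blast
  define d where "d = from_nat_into D"
  have ex: "\<exists>n. dist x (d n) < \<epsilon> / 2" for x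
  proof -
    obtain y where "y \<in> D" "y \<in> ball x (\<epsilon> / 2)" using D(2)[of "ball x (\<epsilon> / 2)"] \<epsilon> by auto
    then show ?thesis using from_nat_into_surj[OF D(1)] by (auto simp: d_def)
  qed
  \<comment> \<open>The cell of a point is the index of the first point of a dense sequence within
    \<epsilon>/2 of it; points of one cell share that centre.\<close>
  define j where "j x = (LEAST n. dist x (d n) < \<epsilon> / 2)" for x
  have j: "dist x (d (j x)) < \<epsilon> / 2" for x
    unfolding j_def using ex by (rule LeastI_ex)
  have "j \<in> measurable borel (count_space UNIV)" unfolding j_def by measurable
  then have "j \<in> measurable (borel_on UNIV) (count_space UNIV)" by (rule measurable_restrict_space1)
  moreover have "dist x y \<le> \<epsilon>" if "j x = j y" for x y
    using dist_triangle2[of x y "d (j x)"] j[of x] j[of y] that by simp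
  ultimately show "\<exists>j. j \<in> measurable (borel_on UNIV) (count_space UNIV) \<and>
      (\<forall>x\<in>(UNIV :: 'a set). \<forall>y\<in>UNIV. j x = (j y :: nat) \<longrightarrow> dist x y \<le> \<epsilon>)" by auto
qed

text \<open>A representative \<open>r n (j n x)\<close> depends on \<open>x\<close> only through a
  countable code, so the distance of two representatives is measurable for the product
  sigma-algebra. The cells have diameter at most \<open>1 / real (Suc n)\<close>, so these distances
  converge to the distance itself.\<close>

lemma dist_measurable_on:
  assumes "small_partitions E"
  shows "(\<lambda>z. dist (fst z) (snd z)) \<in> borel_measurable (borel_on E \<Otimes>\<^sub>M borel_on E)"
proof -
  have "\<exists>j::'a \<Rightarrow> nat. j \<in> measurable (borel_on E) (count_space UNIV) \<and>
    (\<forall>x\<in>E. \<forall>y\<in>E. j x = j y \<longrightarrow> dist x y \<le> 1 / real (Suc n))" for n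
    using assms unfolding small_partitions_def by (auto simp del: of_nat_Suc)
  then obtain j :: "nat \<Rightarrow> 'a \<Rightarrow> nat"
    where j[measurable]: "\<And>n. j n \<in> measurable (borel_on E) (count_space UNIV)"
    and jd: "\<And>n x y. x \<in> E \<Longrightarrow> y \<in> E \<Longrightarrow> j n x = j n y \<Longrightarrow> dist x y \<le> 1 / real (Suc n)" by metis
  define r where "r n k = (SOME x. x \<in> E \<and> j n x = k)" for n k
  have r: "r n (j n x) \<in> E \<and> j n (r n (j n x)) = j n x" if "x \<in> E" for n x
    unfolding r_def by (rule someI[of _ x]) (use that in auto)
  have D: "dist x (r n (j n x)) \<le> 1 / real (Suc n)" if "x \<in> E" for n x
    using r[OF that, of n] that by (intro jd) auto
  show ?thesis
  proof (rule borel_measurable_LIMSEQ_real)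
    fix z assume "z \<in> space (borel_on E \<Otimes>\<^sub>M borel_on E)"
    then have z: "fst z \<in> E" "snd z \<in> E" by (auto simp: space_pair_measure)
    have lim: "(\<lambda>n. 1 / real (Suc n)) \<longlonglongrightarrow> 0" using LIMSEQ_inverse_real_of_nat
      by (simp add: inverse_eq_divide)
    have "(\<lambda>n. r n (j n x)) \<longlonglongrightarrow> x" if "x \<in> E" for x
      by (rule metric_tendsto_imp_tendsto[OF lim]) (use D[OF that] in \<open>auto simp: dist_commute\<close>)
    with z show "(\<lambda>n. dist (r n (j n (fst z))) (r n (j n (snd z)))) \<longlonglongrightarrow> dist (fst z) (snd z)"
      by (intro tendsto_dist) auto
  next
    fix n
    have "(\<lambda>z. (\<lambda>(a, b). dist (r n a) (r n b)) (j n (fst z), j n (snd z)))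
      \<in> borel_measurable (borel_on E \<Otimes>\<^sub>M borel_on E)"
      by (rule measurable_compose[where N = "count_space UNIV"])
        (auto simp flip: pair_measure_countable)
    then show "(\<lambda>z. dist (r n (j n (fst z))) (r n (j n (snd z)))) \<in> borel_measurable
      (borel_on E \<Otimes>\<^sub>M borel_on E)"
      by simp
  qed
qed

section \<open>The distance \<open>d1\<close>, Lipschitz functions and weak convergence\<close>

lemma P1D:
  assumes "\<mu> \<in> P1 E"
  shows "prob_space \<mu>" "sets \<mu> = sets (borel_on E)" "space \<mu> = E" "integrable \<mu> norm"
  using assms sets_eq_imp_space_eq[of \<mu> "borel_on E"] by (auto simp: P1_def)

lemma d1_le:
  assumes "m \<in> couplings \<mu> \<nu>" shows "d1 \<mu> \<nu> \<le> (\<integral>z. dist (fst z) (snd z) \<partial>m)"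
  unfolding d1_def by (rule cINF_lower[OF _ assms]) (auto intro!: bdd_belowI[of _ 0])

text \<open>The product measure shows that the infimum runs over a nonempty set. Almost optimal
  couplings obtained here take the place of optimal ones.\<close>

lemma d1_less:
  assumes "d1 \<mu> \<nu> < r" "prob_space \<mu>" "prob_space \<nu>"
  obtains m where "m \<in> couplings \<mu> \<nu>" "(\<integral>z. dist (fst z) (snd z) \<partial>m) < r"
proof -
  have "bdd_below ((\<lambda>m. \<integral>z. dist (fst z) (snd z) \<partial>m) ` couplings \<mu> \<nu>)"
    by (auto intro!: bdd_belowI[of _ 0])
  then show ?thesis
    using assms that pair_coupling[OF assms(2,3)] unfolding d1_def
      by (subst (asm) cINF_less_iff) auto
qed

lemma d1_nonneg: "prob_space \<mu> \<Longrightarrow> prob_space \<nu> \<Longrightarrow> 0 \<le> d1 \<mu> \<nu>"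
  unfolding d1_def using pair_coupling[of \<mu> \<nu>] by (intro cINF_greatest) auto

lemma dist_coupling:
  assumes "small_partitions E" "\<mu> \<in> P1 E" "\<nu> \<in> P1 E" "m \<in> couplings \<mu> \<nu>"
  shows "(\<lambda>z. dist (fst z) (snd z)) \<in> borel_measurable m" "integrable m (\<lambda>z. dist (fst z) (snd z))"
proof -
  have "(\<lambda>z. dist (fst z) (snd z)) \<in> borel_measurable (\<mu> \<Otimes>\<^sub>M \<nu>)"
    using dist_measurable_on[OF assms(1)] P1D(2)[OF assms(2)] P1D(2)[OF assms(3)]
    by (simp cong: measurable_cong_sets sets_pair_measure_cong)
  then show meas: "(\<lambda>z. dist (fst z) (snd z)) \<in> borel_measurable m"
    using couplings_measurable(3)[OF assms(4)] by blast
  show "integrable m (\<lambda>z. dist (fst z) (snd z))"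
  proof (rule Bochner_Integration.integrable_bound[OF _ meas])
    show "integrable m (\<lambda>z. norm (fst z) + norm (snd z))"
      using couplings_integral(3)[OF assms(4) P1D(4)[OF assms(2)]]
        couplings_integral(4)[OF assms(4) P1D(4)[OF assms(3)]] by simp
    show "AE z in m. norm (dist (fst z) (snd z)) \<le> norm (norm (fst z) + norm (snd z))"
      by (auto simp: dist_norm norm_triangle_ineq4)
  qed
qed

lemma d1_le_expectation:
  assumes "prob_space P" "X \<in> measurable P (borel_on E)" "Y \<in> measurable P (borel_on E)"
    and "small_partitions E"
  shows "d1 (distr P (borel_on E) X) (distr P (borel_on E) Y) \<le> (\<integral>\<omega>. dist (X \<omega>) (Y \<omega>) \<partial>P)"
proof -
  let ?\<mu> = "distr P (borel_on E) X" and ?\<nu> = "distr P (borel_on E) Y"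
  have X: "X \<in> measurable P ?\<mu>" "Y \<in> measurable P ?\<nu>" using assms by auto
  have "distr P (?\<mu> \<Otimes>\<^sub>M ?\<nu>) (\<lambda>\<omega>. (X \<omega>, Y \<omega>)) \<in> couplings ?\<mu> ?\<nu>"
    by (rule coupling_distr[OF X]) (auto intro!: distr_cong)
  then have "d1 ?\<mu> ?\<nu> \<le> (\<integral>z. dist (fst z) (snd z) \<partial>distr P (?\<mu> \<Otimes>\<^sub>M ?\<nu>) (\<lambda>\<omega>. (X \<omega>, Y \<omega>)))"
    by (rule d1_le)
  also have "\<dots> = (\<integral>\<omega>. dist (X \<omega>) (Y \<omega>) \<partial>P)"
    using X dist_measurable_on[OF assms(4)]
    by (subst integral_distr) (auto cong: measurable_cong_sets sets_pair_measure_cong)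
  finally show ?thesis .
qed

lemma distr_in_P1:
  assumes "prob_space P" "X \<in> measurable P (borel_on E)" "integrable P (\<lambda>\<omega>. norm (X \<omega>))"
  shows "distr P (borel_on E) X \<in> P1 E"
  using assms by (auto simp: P1_def integrable_distr_eq intro!: prob_space.prob_space_distr)

lemma couplings_space_P1:
  assumes "m \<in> couplings \<mu> \<nu>" "\<mu> \<in> P1 E" "\<nu> \<in> P1 F"
  shows "space m = E \<times> F"
  by (simp only: couplings_space[OF assms(1)] P1D(3)[OF assms(2)] P1D(3)[OF assms(3)])

text \<open>The easy half of Kantorovich duality: along a coupling the difference of the integrals
  is the integral of \<phi>(x) - \<phi>(y). The slack of an almost optimal coupling is removed in a
  final limit.\<close>

lemma d1_lipschitz:
  assumes P: "\<mu> \<in> P1 E" "\<nu> \<in> P1 E" and E: "small_partitions E"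
    and \<phi>: "\<phi> \<in> borel_measurable (borel_on E)" "\<And>x. x \<in> E \<Longrightarrow> \<bar>\<phi> x\<bar> \<le> C"
    and L: "0 \<le> L" "\<And>x y. x \<in> E \<Longrightarrow> y \<in> E \<Longrightarrow> \<bar>\<phi> x - \<phi> y\<bar> \<le> L * dist x y"
  shows "\<bar>(\<integral>x. \<phi> x \<partial>\<mu>) - (\<integral>x. \<phi> x \<partial>\<nu>)\<bar> \<le> L * d1 \<mu> \<nu>"
proof -
  interpret \<mu>: prob_space \<mu> by (rule P1D(1)[OF P(1)])
  interpret \<nu>: prob_space \<nu> by (rule P1D(1)[OF P(2)])
  have \<phi>m: "\<phi> \<in> borel_measurable \<mu>" "\<phi> \<in> borel_measurable \<nu>"
    using \<phi>(1) P1D(2)[OF P(1)] P1D(2)[OF P(2)] by (simp_all cong: measurable_cong_sets)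
  have i: "integrable \<mu> \<phi>" "integrable \<nu> \<phi>"
    using \<phi>(2) P1D(3)[OF P(1)] P1D(3)[OF P(2)] \<phi>m
    by (auto intro!: \<mu>.integrable_const_bound[of _ C] \<nu>.integrable_const_bound[of _ C])
  have "\<bar>(\<integral>x. \<phi> x \<partial>\<mu>) - (\<integral>x. \<phi> x \<partial>\<nu>)\<bar> \<le> L * r" if r: "d1 \<mu> \<nu> < r" for r
  proof -
    obtain m where m: "m \<in> couplings \<mu> \<nu>" "(\<integral>z. dist (fst z) (snd z) \<partial>m) < r"
      using d1_less[OF r \<mu>.prob_space_axioms \<nu>.prob_space_axioms] by blast
    have "(\<integral>x. \<phi> x \<partial>\<mu>) - (\<integral>x. \<phi> x \<partial>\<nu>) = (\<integral>z. \<phi> (fst z) - \<phi> (snd z) \<partial>m)"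
      using couplings_integral(1)[OF m(1) \<phi>m(1)] couplings_integral(2)[OF m(1) \<phi>m(2)]
        couplings_integral(3)[OF m(1) i(1)] couplings_integral(4)[OF m(1) i(2)]
      by simp
    also have "\<bar>\<dots>\<bar> \<le> (\<integral>z. \<bar>\<phi> (fst z) - \<phi> (snd z)\<bar> \<partial>m)"
      by (rule integral_abs_bound)
    also have "\<dots> \<le> (\<integral>z. L * dist (fst z) (snd z) \<partial>m)"
    proof (rule integral_mono)
      show "integrable m (\<lambda>z. \<bar>\<phi> (fst z) - \<phi> (snd z)\<bar>)"
        using couplings_integral(3)[OF m(1) i(1)] couplings_integral(4)[OF m(1) i(2)] by simp
      show "integrable m (\<lambda>z. L * dist (fst z) (snd z))"
        using dist_coupling(2)[OF E P m(1)] by simp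
      fix z assume "z \<in> space m"
      then have "fst z \<in> E" "snd z \<in> E"
        unfolding couplings_space_P1[OF m(1) P] by auto
      then show "\<bar>\<phi> (fst z) - \<phi> (snd z)\<bar> \<le> L * dist (fst z) (snd z)" by (rule L)
    qed
    also have "\<dots> = L * (\<integral>z. dist (fst z) (snd z) \<partial>m)" by simp
    also have "\<dots> \<le> L * r" using m(2) L(1) by (intro mult_left_mono) auto
    finally show ?thesis .
  qed
  then have "\<bar>(\<integral>x. \<phi> x \<partial>\<mu>) - (\<integral>x. \<phi> x \<partial>\<nu>)\<bar> \<le> L * (d1 \<mu> \<nu> + \<epsilon>)" if "\<epsilon> > 0" for \<epsilon>
    using that by simp
  moreover have "((\<lambda>\<epsilon>. L * (d1 \<mu> \<nu> + \<epsilon>)) \<longlongrightarrow> L * (d1 \<mu> \<nu> + 0)) (at_right 0)"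
    by (intro tendsto_intros)
  ultimately have "\<bar>(\<integral>x. \<phi> x \<partial>\<mu>) - (\<integral>x. \<phi> x \<partial>\<nu>)\<bar> \<le> L * (d1 \<mu> \<nu> + 0)"
    by (intro tendsto_lowerbound) (auto simp: eventually_at_filter)
  then show ?thesis by simp
qed

text \<open>Lower semicontinuity through the Lipschitz inf-convolutions of \<open>\<phi>\<close>.\<close>

lemma integral_lower_bound_of_d1:
  fixes \<phi> :: "'e::real_normed_vector \<Rightarrow> real"
  assumes P: "\<And>n. n \<ge> 1 \<Longrightarrow> \<mu> n \<in> P1 E" "\<nu> \<in> P1 E" and E: "small_partitions E"
    and lim: "(\<lambda>n. d1 (\<mu> n) \<nu>) \<longlonglongrightarrow> 0"
    and \<phi>: "continuous_on E \<phi>" "\<And>x. x \<in> E \<Longrightarrow> \<bar>\<phi> x\<bar> \<le> C" and \<epsilon>: "\<epsilon> > 0"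
  shows "\<forall>\<^sub>F n in sequentially. (\<integral>x. \<phi> x \<partial>\<nu>) - \<epsilon> < (\<integral>x. \<phi> x \<partial>\<mu> n)"
proof -
  interpret \<nu>: prob_space \<nu> by (rule P1D(1)[OF P(2)])
  have Ene: "E \<noteq> {}" using \<nu>.not_empty P1D(3)[OF P(2)] by simp
  define \<psi> where "\<psi> k x = (INF y\<in>E. \<phi> y + real k * dist x y)" for k :: nat and x
  have C0: "0 \<le> C" using Ene \<phi>(2) by (meson abs_ge_zero equals0I order_trans)
  have bdd: "bdd_below ((\<lambda>y. \<phi> y + real k * dist x y) ` E)" for k x
    using \<phi>(2) by (intro bdd_belowI2[of _ "- C"]) (smt (verit) mult_nonneg_nonneg of_nat_0_le_iff
      zero_le_dist)
  have le\<phi>: "\<psi> k x \<le> \<phi> x" if "x \<in> E" for k x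
    using cINF_lower[OF bdd that, of k x] by (simp add: \<psi>_def)
  have geC: "- C \<le> \<psi> k x" for k x
    unfolding \<psi>_def using Ene \<phi>(2)
    by (intro cINF_greatest) (auto, smt (verit) mult_nonneg_nonneg of_nat_0_le_iff zero_le_dist)
  have absC: "\<bar>\<psi> k x\<bar> \<le> C" if "x \<in> E" for k x
    using le\<phi>[OF that, of k] geC[of k x] \<phi>(2)[OF that] by simp
  have lip': "\<psi> k x \<le> \<psi> k x' + real k * dist x x'" for k x x'
  proof -
    have "\<psi> k x - real k * dist x x' \<le> \<psi> k x'"
      unfolding \<psi>_def[of k x']
    proof (rule cINF_greatest[OF Ene])
      fix y assume y: "y \<in> E"
      have "\<psi> k x \<le> \<phi> y + real k * dist x y"
        unfolding \<psi>_def by (rule cINF_lower[OF bdd y])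
      also have "\<dots> \<le> \<phi> y + real k * (dist x x' + dist x' y)"
        by (intro add_left_mono mult_left_mono dist_triangle) auto
      finally show "\<psi> k x - real k * dist x x' \<le> \<phi> y + real k * dist x' y"
        by (simp add: algebra_simps)
    qed
    then show ?thesis by simp
  qed
  have lip: "\<bar>\<psi> k x - \<psi> k y\<bar> \<le> real k * dist x y" for k x y
    using lip'[of k x y] lip'[of k y x] by (simp add: dist_commute)
  have cont\<psi>: "continuous_on E (\<psi> k)" for k
  proof (rule continuous_onI)
    fix x \<epsilon> :: real assume "0 < \<epsilon>"
    fix x assume "x \<in> E"
    show "\<exists>d>0. \<forall>x'\<in>E. dist x' x < d \<longrightarrow> dist (\<psi> k x') (\<psi> k x) \<le> \<epsilon>"
    proof (intro exI[of _ "\<epsilon> / (real k + 1)"] conjI ballI impI)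
      fix x' assume *: "dist x' x < \<epsilon> / (real k + 1)"
      have "dist (\<psi> k x') (\<psi> k x) \<le> real k * dist x' x" using lip by (simp add: dist_real_def)
      also have "\<dots> \<le> (real k + 1) * dist x' x" by (intro mult_right_mono) auto
      also have "\<dots> \<le> \<epsilon>" using * by (simp add: field_simps)
      finally show "dist (\<psi> k x') (\<psi> k x) \<le> \<epsilon>" .
    qed (use \<open>0 < \<epsilon>\<close> in simp)
  qed
  have m: "\<psi> k \<in> borel_measurable (borel_on E)" "\<phi> \<in> borel_measurable (borel_on E)" for k
    using cont\<psi> \<phi>(1) by (auto intro: borel_measurable_continuous_on_restrict)
  have conv: "(\<lambda>k. \<psi> k x) \<longlonglongrightarrow> \<phi> x" if x: "x \<in> E" for x
  proof (rule LIMSEQ_I)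
    fix \<eta> :: real assume \<eta>: "\<eta> > 0"
    obtain \<delta> where \<delta>: "\<delta> > 0" "\<And>y. y \<in> E \<Longrightarrow> dist y x < \<delta> \<Longrightarrow> dist (\<phi> y) (\<phi> x) < \<eta> / 2"
      using \<phi>(1) x \<eta> unfolding continuous_on_iff by (metis half_gt_zero)
    \<comment> \<open>For \<open>k \<ge> N\<close> the penalty at distance \<delta> or more is at
      least \<open>2 * C\<close>, the largest possible gap between two values of \<phi>; only points
      near \<open>x\<close> can undercut \<phi>(x).\<close>
    obtain N where N: "2 * C / \<delta> \<le> real N" using real_arch_simple by blast
    show "\<exists>no. \<forall>k\<ge>no. norm (\<psi> k x - \<phi> x) < \<eta>"
    proof (intro exI[of _ N] allI impI)
      fix k assume k: "N \<le> k"
      have "\<phi> x - \<eta> / 2 \<le> \<psi> k x"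
        unfolding \<psi>_def
      proof (rule cINF_greatest[OF Ene])
        fix y assume y: "y \<in> E"
        show "\<phi> x - \<eta> / 2 \<le> \<phi> y + real k * dist x y"
        proof (cases "dist y x < \<delta>")
          case True
          have "0 \<le> real k * dist x y" by simp
          with \<delta>(2)[OF y True] show ?thesis unfolding dist_real_def by linarith
        next
          case False
          have "2 * C \<le> real N * \<delta>" using N \<delta>(1) by (simp add: field_simps)
          also have "\<dots> \<le> real k * dist x y"
            using k False \<delta>(1) by (intro mult_mono) (auto simp: dist_commute)
          finally show ?thesis using \<phi>(2)[OF x] \<phi>(2)[OF y] \<eta> by linarith
        qed
      qed
      then show "norm (\<psi> k x - \<phi> x) < \<eta>" using le\<phi>[OF x, of k] \<eta> by simp
    qed
  qed
  \<comment> \<open>The minorants converge pointwise only, so this limit is taken under the fixed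
    \<nu> and serves to choose \<open>k\<close>. The Lipschitz bound then carries the integral of
    \<open>\<psi> k\<close> to \<open>\<mu> n\<close>, and \<open>\<psi> k \<le> \<phi>\<close>
    leads back to \<phi>, which is why the estimate is one-sided.\<close>
  have "(\<lambda>k. \<integral>x. \<psi> k x \<partial>\<nu>) \<longlonglongrightarrow> (\<integral>x. \<phi> x \<partial>\<nu>)"
  proof (rule integral_dominated_convergence[where w = "\<lambda>_. C"])
    show "\<phi> \<in> borel_measurable \<nu>" "\<And>k. \<psi> k \<in> borel_measurable \<nu>"
      using m P1D(2)[OF P(2)] by (simp_all cong: measurable_cong_sets)
  qed (use conv absC P1D(3)[OF P(2)] in auto)
  then have "\<forall>\<^sub>F k in sequentially. (\<integral>x. \<phi> x \<partial>\<nu>) - \<epsilon> / 2 < (\<integral>x. \<psi> k x \<partial>\<nu>)"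
    using \<epsilon> by (intro order_tendstoD(1)) auto
  then obtain k where k: "(\<integral>x. \<phi> x \<partial>\<nu>) - \<epsilon> / 2 < (\<integral>x. \<psi> k x \<partial>\<nu>)"
    by (auto simp: eventually_sequentially)
  have "(\<lambda>n. real k * d1 (\<mu> n) \<nu>) \<longlonglongrightarrow> real k * 0" by (intro tendsto_intros lim)
  then have "\<forall>\<^sub>F n in sequentially. real k * d1 (\<mu> n) \<nu> < \<epsilon> / 2"
    using \<epsilon> by (intro order_tendstoD(2)) auto
  then show ?thesis
    using eventually_ge_at_top[of 1]
  proof eventually_elim
    case (elim n)
    interpret \<mu>: prob_space "\<mu> n" by (rule P1D(1)[OF P(1)[OF elim(2)]])
    have "\<bar>(\<integral>x. \<psi> k x \<partial>\<mu> n) - (\<integral>x. \<psi> k x \<partial>\<nu>)\<bar> \<le> real k * d1 (\<mu> n) \<nu>"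
      by (rule d1_lipschitz[OF P(1)[OF elim(2)] P(2) E m(1) absC]) (use lip in auto)
    moreover have "(\<integral>x. \<psi> k x \<partial>\<mu> n) \<le> (\<integral>x. \<phi> x \<partial>\<mu> n)"
    proof (rule integral_mono)
      have "\<psi> k \<in> borel_measurable (\<mu> n)" "\<phi> \<in> borel_measurable (\<mu> n)"
        using m P1D(2)[OF P(1)[OF elim(2)]] by (simp_all cong: measurable_cong_sets)
      then show "integrable (\<mu> n) (\<psi> k)" "integrable (\<mu> n) \<phi>"
        using absC \<phi>(2) P1D(3)[OF P(1)[OF elim(2)]]
        by (auto intro!: \<mu>.integrable_const_bound[of _ C])
    qed (use le\<phi> P1D(3)[OF P(1)[OF elim(2)]] in auto)
    ultimately show ?case using k elim by linarith
  qed
qed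

text \<open>The one-sided bound is applied to \<phi> and to -\<phi>. Membership in \<open>P1\<close>
  starts at \<open>n = 1\<close> because the empirical measure of no points is not a probability
  measure.\<close>

lemma weakly_converges_of_d1:
  fixes \<nu> :: "'e::real_normed_vector measure"
  assumes P: "\<And>n. n \<ge> 1 \<Longrightarrow> \<mu> n \<in> P1 E" "\<nu> \<in> P1 E" and E: "small_partitions E"
    and lim: "(\<lambda>n. d1 (\<mu> n) \<nu>) \<longlonglongrightarrow> 0"
  shows "weakly_converges \<mu> \<nu>"
  unfolding weakly_converges_def
proof (intro allI impI)
  fix \<phi> :: "'e \<Rightarrow> real" assume *: "continuous_on (space \<nu>) \<phi> \<and> bounded (\<phi> ` space \<nu>)"
  have sp: "space \<nu> = E" using P1D(3)[OF P(2)] .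
  obtain C where C: "\<And>x. x \<in> E \<Longrightarrow> \<bar>\<phi> x\<bar> \<le> C" using * by (auto simp: sp bounded_iff)
  have c: "continuous_on E \<phi>" using * by (simp add: sp)
  show "(\<lambda>n. \<integral>x. \<phi> x \<partial>\<mu> n) \<longlonglongrightarrow> (\<integral>x. \<phi> x \<partial>\<nu>)"
  proof (rule tendstoI)
    fix \<epsilon> :: real assume \<epsilon>: "\<epsilon> > 0"
    have "\<forall>\<^sub>F n in sequentially. (\<integral>x. - \<phi> x \<partial>\<nu>) - \<epsilon> < (\<integral>x. - \<phi> x \<partial>\<mu> n)"
      by (rule integral_lower_bound_of_d1[OF P E lim _ _ \<epsilon>, where C = C])
        (use c C in \<open>auto intro: continuous_intros\<close>)
    moreover have "\<forall>\<^sub>F n in sequentially. (\<integral>x. \<phi> x \<partial>\<nu>) - \<epsilon> < (\<integral>x. \<phi> x \<partial>\<mu> n)"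
      by (rule integral_lower_bound_of_d1[OF _ P(2) E lim c _ \<epsilon>, where C = C]) (use P(1) C in auto)
    ultimately show "\<forall>\<^sub>F n in sequentially. dist (\<integral>x. \<phi> x \<partial>\<mu> n) (\<integral>x. \<phi> x \<partial>\<nu>) < \<epsilon>"
      by eventually_elim (auto simp: dist_real_def)
  qed
qed

section \<open>Empirical measures and path space\<close>

lemma integrable_uniform_count_measure:
  fixes \<phi> :: "'a \<Rightarrow> real"
  assumes "finite A" "A \<noteq> {}"
  shows "integrable (uniform_count_measure A) \<phi>"
proof -
  interpret prob_space "uniform_count_measure A"
    by (rule prob_space_uniform_count_measure[OF assms])
  have "\<bar>\<phi> a\<bar> \<le> (\<Sum>a\<in>A. \<bar>\<phi> a\<bar>)" if "a \<in> A" for a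
    using assms(1) that by (intro member_le_sum) auto
  then show ?thesis
    by (intro integrable_const_bound[of _ "\<Sum>a\<in>A. \<bar>\<phi> a\<bar>"])
      (auto simp: space_uniform_count_measure measurable_def sets_uniform_count_measure intro!:
        AE_I2)
qed

lemma empirical_in_P1:
  assumes "N \<ge> 1" "\<And>i. i < N \<Longrightarrow> z i \<in> E"
  shows "empirical E N z \<in> P1 E" "prob_space (uniform_count_measure {..<N})"
    "z \<in> measurable (uniform_count_measure {..<N}) (borel_on E)"
proof -
  show p: "prob_space (uniform_count_measure {..<N})"
    using assms(1) by (intro prob_space_uniform_count_measure) (auto simp: lessThan_empty_iff)
  show z: "z \<in> measurable (uniform_count_measure {..<N}) (borel_on E)"
    using assms(2) by (auto simp: measurable_def sets_uniform_count_measure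
      space_uniform_count_measure
        space_restrict_space)
  show "empirical E N z \<in> P1 E"
    unfolding empirical_def
    using assms(1) by (intro distr_in_P1[OF p z] integrable_uniform_count_measure)
      (auto simp: lessThan_empty_iff)
qed

lemma integral_empirical:
  fixes \<phi> :: "'e::real_normed_vector \<Rightarrow> real"
  assumes "N \<ge> 1" "\<And>i. i < N \<Longrightarrow> z i \<in> E" "\<phi> \<in> borel_measurable (borel_on E)"
  shows "(\<integral>x. \<phi> x \<partial>empirical E N z) = (\<Sum>i<N. \<phi> (z i)) / real N"
  unfolding empirical_def using empirical_in_P1(3)[OF assms(1,2)] assms(3)
  by (subst integral_distr) (auto simp: integral_uniform_count_measure)

lemma apply_bcontfun_measurable:
  "(\<lambda>x. apply_bcontfun x t) \<in> borel_measurable (borel_on (E :: 'd::finite path set))"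
proof (rule measurable_restrict_space1, rule borel_measurable_continuous_onI, rule continuous_onI)
  fix x :: "'d path" and \<epsilon> :: real assume "0 < \<epsilon>"
  then show "\<exists>d>0. \<forall>x'\<in>UNIV. dist x' x < d \<longrightarrow> dist (apply_bcontfun x' t) (apply_bcontfun x t) \<le> \<epsilon>"
    using dist_bounded order_trans less_imp_le by blast
qed

text \<open>Finite lists over a countable type form a countable type again, so several codes of a
  path can be joined into one; each entry is prepended by a countable case distinction.\<close>

lemma measurable_map_countable:
  fixes g :: "'b \<Rightarrow> 'a \<Rightarrow> 'c::countable"
  assumes "\<And>k. k \<in> set ks \<Longrightarrow> g k \<in> measurable M (count_space UNIV)"
  shows "(\<lambda>x. map (\<lambda>k. g k x) ks) \<in> measurable M (count_space UNIV)"
  using assms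
proof (induction ks)
  case (Cons k ks)
  then have IH: "(\<lambda>x. map (\<lambda>k. g k x) ks) \<in> measurable M (count_space UNIV)"
    and g: "g k \<in> measurable M (count_space UNIV)" by auto
  have "(\<lambda>x. i # map (\<lambda>k. g k x) ks) \<in> measurable M (count_space UNIV)" for i
    by (rule measurable_compose[OF IH]) simp
  from measurable_compose_countable[OF this g] show ?case by simp
qed simp

section \<open>Small partitions of path space\<close>

lemma path_clamp: "x \<in> paths T \<Longrightarrow> apply_bcontfun x t = apply_bcontfun x (max 0 (min t T))"
  by (simp add: paths_def)

lemma path_uniformly_continuous:
  assumes "x \<in> paths T" "\<epsilon> > 0"
  shows "\<exists>n::nat. \<forall>p q. \<bar>p - q\<bar> < 1 / real (Suc n) \<longrightarrow>
    dist (apply_bcontfun x p) (apply_bcontfun x q) \<le> \<epsilon>"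
proof -
  \<comment> \<open>The sign of \<open>T\<close> is left open here; \<open>max 0 T\<close> makes the
    interval contain all clamped times, and clamping does not increase distances of times.\<close>
  have "uniformly_continuous_on {0..max 0 T} (apply_bcontfun x)"
    by (intro compact_uniformly_continuous) auto
  then obtain \<delta> where \<delta>: "\<delta> > 0" "\<And>p q. p \<in> {0..max 0 T} \<Longrightarrow> q \<in> {0..max 0 T} \<Longrightarrow> dist q p < \<delta> \<Longrightarrow>
      dist (apply_bcontfun x q) (apply_bcontfun x p) < \<epsilon>"
    using assms(2) unfolding uniformly_continuous_on_def by metis
  obtain n where n: "1 / real (Suc n) < \<delta>" using nat_approx_posE[OF \<delta>(1)] by blast
  show ?thesis
  proof (intro exI[of _ n] allI impI)
    fix p q :: real assume pq: "\<bar>p - q\<bar> < 1 / real (Suc n)"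
    have "dist (apply_bcontfun x (max 0 (min p T))) (apply_bcontfun x (max 0 (min q T))) < \<epsilon>"
      using pq n by (intro \<delta>(2)) (auto simp: dist_real_def max_def min_def)
    then show "dist (apply_bcontfun x p) (apply_bcontfun x q) \<le> \<epsilon>"
      using path_clamp[OF assms(1), of p] path_clamp[OF assms(1), of q] by simp
  qed
qed

text \<open>A path is coded by a resolution at which it oscillates by at most \<epsilon>/4, together
  with the \<epsilon>/4-cells of its values at the grid times of that resolution. For paths with
  equal codes the way from a rational time to the grid, across, and back costs three times
  \<epsilon>/4; density of the rationals gives all times.\<close>

lemma small_partitions_paths: "small_partitions (paths T :: 'd::finite path set)"
  unfolding small_partitions_def
proof (intro allI impI)
  fix \<epsilon> :: real assume "\<epsilon> > 0"
  then have \<epsilon>: "\<epsilon> / 4 > 0" by simp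
  obtain r :: "real ^ 'd \<Rightarrow> nat" where r: "r \<in> measurable (borel_on UNIV) (count_space UNIV)"
    "\<And>x y. r x = r y \<Longrightarrow> dist x y \<le> \<epsilon> / 4"
    using small_partitions_UNIV[where 'a = "real ^ 'd", unfolded small_partitions_def,
      rule_format, OF \<epsilon>]
    by auto
  then have rm[measurable]: "r \<in> measurable borel (count_space UNIV)"
    by (simp add: measurable_def sets_restrict_space space_restrict_space)
  obtain N :: nat where N: "T \<le> real N" using real_arch_simple by blast
  \<comment> \<open>Only rational times are compared, so that \<open>osc n\<close> is a countable
    intersection of measurable conditions.\<close>
  define osc where "osc n x \<longleftrightarrow> (\<forall>p q :: rat. \<bar>of_rat p - of_rat q :: real\<bar> < 1 / real (Suc n) \<longrightarrow>
    dist (apply_bcontfun x (of_rat p)) (apply_bcontfun x (of_rat q)) \<le> \<epsilon> / 4)" for n and x :: "'d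
      path"
  define n where "n x = (LEAST n. osc n x)" for x
  have n: "osc (n x) x" if x: "x \<in> paths T" for x
    unfolding n_def
  proof (rule LeastI_ex)
    obtain n where "\<forall>p q. \<bar>p - q\<bar> < 1 / real (Suc n) \<longrightarrow>
        dist (apply_bcontfun x p) (apply_bcontfun x q) \<le> \<epsilon> / 4"
      using path_uniformly_continuous[OF x \<epsilon>] by blast
    then have "osc n x" unfolding osc_def by blast
    then show "\<exists>n. osc n x" ..
  qed
  \<comment> \<open>The resolution \<open>i\<close> is part of the code, so that equal codes force
    equal grids; the grid times run from 0 to the integer \<open>N \<ge> T\<close>.\<close>
  define F where "F i x = to_nat (i, map (\<lambda>k. r (apply_bcontfun x (real k / real (Suc i))))
    [0..<Suc i * N + 1])"
    for i :: nat and x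
  note [measurable] = apply_bcontfun_measurable
  have "n \<in> measurable (borel_on (paths T)) (count_space UNIV)"
    unfolding n_def osc_def by measurable
  moreover have "F i \<in> measurable (borel_on (paths T)) (count_space UNIV)" for i
    unfolding F_def
  proof (rule measurable_compose[OF measurable_map_countable])
    show "(\<lambda>x. r (apply_bcontfun x (real k / real (Suc i)))) \<in> measurable (borel_on (paths T))
      (count_space UNIV)" for k
      by (rule measurable_compose[OF apply_bcontfun_measurable rm])
  qed simp
  ultimately have "(\<lambda>x. F (n x) x) \<in> measurable (borel_on (paths T)) (count_space UNIV)"
    by (rule measurable_compose_countable[rotated])
  moreover have "dist x y \<le> \<epsilon>" if xy: "x \<in> paths T" "y \<in> paths T" "F (n x) x = F (n y) y" for x y
  proof (rule dist_bound)
    fix t :: real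
    define i where "i = n x"
    have ni: "n y = i" using xy(3) by (simp add: F_def i_def)
    have ox: "osc i x" "osc i y" using n[OF xy(1)] n[OF xy(2)] ni by (auto simp: i_def)
    have rk: "r (apply_bcontfun x (real k / real (Suc i)))
      = r (apply_bcontfun y (real k / real (Suc i)))"
      if "k \<le> Suc i * N" for k
    proof -
      have "map (\<lambda>k. r (apply_bcontfun x (real k / real (Suc i)))) [0..<Suc i * N + 1]
          = map (\<lambda>k. r (apply_bcontfun y (real k / real (Suc i)))) [0..<Suc i * N + 1]"
        using xy(3) ni by (simp add: F_def i_def del: upt_Suc)
      then show ?thesis using that by (auto simp del: upt_Suc)
    qed
    have rat: "dist (apply_bcontfun x (of_rat q)) (apply_bcontfun y (of_rat q)) \<le> \<epsilon>" for q :: rat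
    proof -
      \<comment> \<open>The time is clamped to \<open>{0..N}\<close> instead of
        \<open>{0..T}\<close>, because it has to stay rational and \<open>T\<close> may not be;
        \<open>T \<le> N\<close> ensures that paths take the same value at both times.\<close>
      define q' where "q' = max 0 (min q (of_nat N))"
      have eq: "apply_bcontfun w (of_rat q) = apply_bcontfun w (of_rat q')" if "w \<in> paths T"
        for w :: "'d path"
      proof -
        have "of_rat (max a b) = max (of_rat a) (of_rat b :: real)"
          "of_rat (min a b) = min (of_rat a) (of_rat b :: real)" for a b
          by (simp_all add: max_def min_def of_rat_less_eq)
        then have "of_rat q' = max 0 (min (of_rat q) (real N))" by (simp add: q'_def)
        moreover have "max 0 (min (max 0 (min u (real N))) T) = max 0 (min u T)" for u :: real
          using N by (simp add: max_def min_def)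
        ultimately have "max 0 (min (of_rat q') T) = max 0 (min (of_rat q) T)" by (simp only:)
        then show ?thesis using path_clamp[OF that, of "of_rat q"]
          path_clamp[OF that, of "of_rat q'"] by simp
      qed
      define k where "k = nat \<lfloor>of_nat (Suc i) * q'\<rfloor>"
      have q': "0 \<le> q'" "q' \<le> of_nat N" by (auto simp: q'_def)
      then have "0 \<le> of_nat (Suc i) * q'" by simp
      then have kk: "of_nat k \<le> of_nat (Suc i) * q'" "of_nat (Suc i) * q' < of_nat k + 1"
        unfolding k_def using floor_correct[of "of_nat (Suc i) * q'"]
        by (simp_all only: of_nat_nat zero_le_floor of_int_add of_int_1)
      have "(of_nat k :: rat) \<le> of_nat (Suc i) * of_nat N"
        by (rule order_trans[OF kk(1) mult_left_mono[OF q'(2)]]) simp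
      then have kN: "k \<le> Suc i * N" by (metis of_nat_le_iff of_nat_mult)
      define p :: rat where "p = of_nat k / of_nat (Suc i)"
      have p: "p \<le> q'" "q' - p < 1 / of_nat (Suc i)"
      proof -
        define S :: rat where "S = of_nat (Suc i)"
        have S: "S > 0" by (simp add: S_def)
        show "p \<le> q'" using kk(1) S unfolding p_def S_def[symmetric] by (simp add: field_simps)
        have "q' - p = (S * q' - of_nat k) / S"
          using S unfolding p_def S_def[symmetric] by (simp add: field_simps)
        also have "\<dots> < 1 / S"
          using kk(2) S unfolding S_def[symmetric] by (intro divide_strict_right_mono) auto
        finally show "q' - p < 1 / of_nat (Suc i)" by (simp only: S_def)
      qed
      have pr: "of_rat p = real k / real (Suc i)" by (simp add: p_def of_rat_divide of_rat_add)
      have "(of_rat (q' - p) :: real) < of_rat (1 / of_nat (Suc i))" using p(2)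
        by (simp only: of_rat_less)
      moreover have "(of_rat p :: real) \<le> of_rat q'" using p(1) by (simp only: of_rat_less_eq)
      ultimately have d: "\<bar>of_rat q' - of_rat p :: real\<bar> < 1 / real (Suc i)"
        by (simp add: of_rat_diff of_rat_divide of_rat_add)
      have 1: "dist (apply_bcontfun x (of_rat q')) (apply_bcontfun x (of_rat p)) \<le> \<epsilon> / 4"
        "dist (apply_bcontfun y (of_rat q')) (apply_bcontfun y (of_rat p)) \<le> \<epsilon> / 4"
        using ox d unfolding osc_def by blast+
      have 2: "dist (apply_bcontfun x (of_rat p)) (apply_bcontfun y (of_rat p)) \<le> \<epsilon> / 4"
        using rk[OF kN] by (intro r(2)) (simp only: pr)
      show ?thesis
        unfolding eq[OF xy(1)] eq[OF xy(2)]
        using 1 2 dist_triangle[of "apply_bcontfun x (of_rat q')" "apply_bcontfun y (of_rat q')"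
          "apply_bcontfun x (of_rat p)"]
          dist_triangle[of "apply_bcontfun x (of_rat p)" "apply_bcontfun y (of_rat q')"
            "apply_bcontfun y (of_rat p)"] \<epsilon>
          dist_commute[of "apply_bcontfun y (of_rat p)" "apply_bcontfun y (of_rat q')"]
        by linarith
    qed
    have "t \<in> closure \<rat>" by (simp add: Rats_closure_real)
    then show "dist (apply_bcontfun x t) (apply_bcontfun y t) \<le> \<epsilon>"
      by (rule continuous_le_on_closure[rotated])
        (auto intro!: continuous_intros elim!: Rats_cases simp: rat)
  qed
  ultimately show "\<exists>j. j \<in> measurable (borel_on (paths T)) (count_space UNIV) \<and>
      (\<forall>x\<in>(paths T :: 'd path set). \<forall>y\<in>paths T. j x = (j y :: nat) \<longrightarrow> dist x y \<le> \<epsilon>)" by blast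
qed

section \<open>The equation with a prescribed flow of marginals\<close>

lemma d1_refl:
  assumes "\<mu> \<in> P1 E" "small_partitions E" shows "d1 \<mu> \<mu> = 0"
proof (rule antisym)
  have "distr \<mu> (\<mu> \<Otimes>\<^sub>M \<mu>) (\<lambda>x. (x, x)) \<in> couplings \<mu> \<mu>"
    by (rule coupling_distr) (auto simp: distr_id2)
  from d1_le[OF this] show "d1 \<mu> \<mu> \<le> 0"
    using dist_measurable_on[OF assms(2)] P1D(2)[OF assms(1)]
    by (subst (asm) integral_distr) (auto cong: measurable_cong_sets sets_pair_measure_cong)
  show "0 \<le> d1 \<mu> \<mu>" using P1D(1)[OF assms(1)] by (intro d1_nonneg)
qed

section \<open>Flows of marginals\<close>

lemma distr_borel_on_UNIV: "distr P (borel_on UNIV) X = distr P borel X"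
  by (rule distr_cong) (simp_all add: sets_restrict_space)

text \<open>What the pathwise equation asks of its frozen flow. Continuity in time is stated along
  sequences because it is consumed along grid approximations of a time, and with
  \<open>d1 (m s)\<close> on the left so that no symmetry of \<open>d1\<close> is called
  for.\<close>

definition admissible :: "real \<Rightarrow> (real \<Rightarrow> (real ^ 'd::finite) measure) \<Rightarrow> bool" where
  "admissible T m \<longleftrightarrow> (\<forall>s\<in>{0..T}. m s \<in> P1 UNIV) \<and> (\<exists>C. \<forall>s\<in>{0..T}. norm1 (m s) \<le> C) \<and>
    (\<forall>s\<in>{0..T}. \<forall>\<sigma>. (\<forall>n. \<sigma> n \<in> {0..T}) \<longrightarrow> \<sigma> \<longlonglongrightarrow> s \<longrightarrow> (\<lambda>n. d1 (m s) (m (\<sigma> n))) \<longlonglongrightarrow> 0)"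

lemma admissibleD:
  assumes "admissible T m"
  shows "s \<in> {0..T} \<Longrightarrow> m s \<in> P1 UNIV"
    "s \<in> {0..T} \<Longrightarrow> (\<And>n. \<sigma> n \<in> {0..T}) \<Longrightarrow> \<sigma> \<longlonglongrightarrow> s \<Longrightarrow> (\<lambda>n. d1 (m s) (m (\<sigma> n))) \<longlonglongrightarrow> 0"
  using assms unfolding admissible_def by (blast, simp)

lemma admissible_bounded: "admissible T m \<Longrightarrow> \<exists>C. \<forall>s\<in>{0..T}. norm1 (m s) \<le> C"
  unfolding admissible_def by (elim conjE)

definition marginal :: "'w measure \<Rightarrow> ('w \<Rightarrow> ('d::finite) path) \<Rightarrow> real \<Rightarrow> (real ^ 'd) measure" where
  "marginal P X t = distr P borel (\<lambda>\<omega>. apply_bcontfun (X \<omega>) t)"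

lemma norm_apply_le: "norm (apply_bcontfun x t) \<le> norm x"
  by (rule norm_bounded)

lemma dist_apply_le: "norm (apply_bcontfun x t - apply_bcontfun y t) \<le> norm (x - y)"
  using norm_bounded[of "x - y" t] by simp

lemma dist_path_le:
  assumes "0 \<le> T" "x \<in> paths T" "y \<in> paths T"
    "\<And>t. 0 \<le> t \<Longrightarrow> t \<le> T \<Longrightarrow> norm (apply_bcontfun x t - apply_bcontfun y t) \<le> b"
  shows "norm (x - y) \<le> b"
proof (rule norm_bound)
  fix t
  have "norm (apply_bcontfun x (max 0 (min t T)) - apply_bcontfun y (max 0 (min t T))) \<le> b"
    using assms(1) by (intro assms(4)) auto
  then show "norm (apply_bcontfun (x - y) t) \<le> b"
    using path_clamp[OF assms(2), of t] path_clamp[OF assms(3), of t] by simp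
qed

lemma zero_path: "0 \<in> paths T"
  by (simp add: paths_def)

context
  fixes P :: "'w measure" and X :: "'w \<Rightarrow> 'd::finite path" and T :: real
  assumes P: "prob_space P" and X: "X \<in> measurable P (borel_on (paths T))"
    and int: "integrable P (\<lambda>\<omega>. norm (X \<omega>))"
begin

interpretation prob_space P by (rule P)

lemma apply_measurable: "(\<lambda>\<omega>. apply_bcontfun (X \<omega>) t) \<in> borel_measurable P"
  by (rule measurable_compose[OF X apply_bcontfun_measurable])

lemma integrable_apply: "integrable P (\<lambda>\<omega>. norm (apply_bcontfun (X \<omega>) t))"
  by (rule Bochner_Integration.integrable_bound[OF int])
    (use apply_measurable[of t] norm_apply_le in auto)

lemma marginal_P1: "marginal P X t \<in> P1 UNIV"
  using distr_in_P1[OF P, of "\<lambda>\<omega>. apply_bcontfun (X \<omega>) t" UNIV] apply_measurable[of t]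
    integrable_apply[of t]
  unfolding marginal_def distr_borel_on_UNIV
  by (auto simp: measurable_restrict_space2_iff)

lemma norm1_marginal: "norm1 (marginal P X t) = (\<integral>\<omega>. norm (apply_bcontfun (X \<omega>) t) \<partial>P)"
  unfolding norm1_def marginal_def using apply_measurable[of t] by (subst integral_distr) auto

lemma norm1_marginal_le: "norm1 (marginal P X t) \<le> (\<integral>\<omega>. norm (X \<omega>) \<partial>P)"
  unfolding norm1_marginal by (intro integral_mono integrable_apply int norm_apply_le)

end

lemma d1_marginal_le:
  assumes "prob_space P" "X \<in> measurable P (borel_on (paths T))"
    "Y \<in> measurable P (borel_on (paths T))"
  shows "d1 (marginal P X s) (marginal P Y t)
    \<le> (\<integral>\<omega>. norm (apply_bcontfun (X \<omega>) s - apply_bcontfun (Y \<omega>) t) \<partial>P)"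
proof -
  have "(\<lambda>\<omega>. apply_bcontfun (X \<omega>) s) \<in> measurable P (borel_on UNIV)"
    "(\<lambda>\<omega>. apply_bcontfun (Y \<omega>) t) \<in> measurable P (borel_on UNIV)"
    using measurable_compose[OF assms(2) apply_bcontfun_measurable[of s]]
      measurable_compose[OF assms(3) apply_bcontfun_measurable[of t]]
    by (auto simp: measurable_restrict_space2_iff)
  from d1_le_expectation[OF assms(1) this small_partitions_UNIV]
  show ?thesis unfolding marginal_def distr_borel_on_UNIV by (simp add: dist_norm)
qed

text \<open>The values of one random path at two times form a coupling of the two marginals; the
  mean distance tends to 0 by continuity of paths, dominated by twice the supremum norm.\<close>

lemma admissible_marginal:
  assumes "prob_space P" "X \<in> measurable P (borel_on (paths T))" "integrable P (\<lambda>\<omega>. norm (X \<omega>))"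
  shows "admissible T (marginal P X)"
  unfolding admissible_def
proof (intro conjI ballI allI impI)
  show "marginal P X s \<in> P1 UNIV" for s by (rule marginal_P1[OF assms])
  show "\<exists>C. \<forall>s\<in>{0..T}. norm1 (marginal P X s) \<le> C" using norm1_marginal_le[OF assms] by blast
  fix s :: real and \<sigma> assume \<sigma>: "\<sigma> \<longlonglongrightarrow> s"
  have "(\<lambda>n. \<integral>\<omega>. norm (apply_bcontfun (X \<omega>) s - apply_bcontfun (X \<omega>) (\<sigma> n)) \<partial>P) \<longlonglongrightarrow> (\<integral>\<omega>. 0 \<partial>P)"
  proof (rule integral_dominated_convergence[where w = "\<lambda>\<omega>. 2 * norm (X \<omega>)"])
    show "(\<lambda>\<omega>. norm (apply_bcontfun (X \<omega>) s - apply_bcontfun (X \<omega>) (\<sigma> n))) \<in> borel_measurable P"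
      for n
      using apply_measurable[OF assms] by measurable
    show "AE \<omega> in P. (\<lambda>n. norm (apply_bcontfun (X \<omega>) s - apply_bcontfun (X \<omega>) (\<sigma> n))) \<longlonglongrightarrow> 0"
    proof (rule AE_I2)
      fix \<omega>
      have "isCont (apply_bcontfun (X \<omega>)) s" using continuous_on_eq_continuous_at[of UNIV] by auto
      from isCont_tendsto_compose[OF this \<sigma>]
      have "(\<lambda>n. norm (apply_bcontfun (X \<omega>) s - apply_bcontfun (X \<omega>) (\<sigma> n))) \<longlonglongrightarrow>
        norm (apply_bcontfun (X \<omega>) s - apply_bcontfun (X \<omega>) s)" by (intro tendsto_intros)
      then show "(\<lambda>n. norm (apply_bcontfun (X \<omega>) s - apply_bcontfun (X \<omega>) (\<sigma> n))) \<longlonglongrightarrow> 0" by simp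
    qed
    show "AE \<omega> in P. norm (norm (apply_bcontfun (X \<omega>) s - apply_bcontfun (X \<omega>) (\<sigma> n)))
      \<le> 2 * norm (X \<omega>)" for n
    proof (rule AE_I2)
      fix \<omega>
      show "norm (norm (apply_bcontfun (X \<omega>) s - apply_bcontfun (X \<omega>) (\<sigma> n))) \<le> 2 * norm (X \<omega>)"
        using norm_triangle_ineq4[of "apply_bcontfun (X \<omega>) s" "apply_bcontfun (X \<omega>) (\<sigma> n)"]
          norm_apply_le[of "X \<omega>" s] norm_apply_le[of "X \<omega>" "\<sigma> n"] by simp
    qed
  qed (use assms(3) in auto)
  then have lim: "(\<lambda>n. \<integral>\<omega>. norm (apply_bcontfun (X \<omega>) s - apply_bcontfun (X \<omega>) (\<sigma> n)) \<partial>P) \<longlonglongrightarrow> 0"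
    by simp
  show "(\<lambda>n. d1 (marginal P X s) (marginal P X (\<sigma> n))) \<longlonglongrightarrow> 0"
    by (rule tendsto_sandwich[OF _ _ tendsto_const lim])
      (use d1_marginal_le[OF assms(1,2,2)] P1D(1)[OF marginal_P1[OF assms]] in
        \<open>auto intro!: always_eventually d1_nonneg\<close>)
qed

section \<open>Measurability and integrability of the drift along a path\<close>

lemma norm_LINT_le:
  fixes w :: "real \<Rightarrow> 'b::euclidean_space"
  assumes "set_integrable lborel {0..t} w" "set_integrable lborel {0..t} g"
    and "AE s in lborel. s \<in> {0..t} \<longrightarrow> norm (w s) \<le> g s"
  shows "norm (LINT s:{0..t}|lborel. w s) \<le> (LINT s:{0..t}|lborel. g s)"
proof -
  have "norm (LINT s:{0..t}|lborel. w s) \<le> (\<integral>s. norm (indicator {0..t} s *\<^sub>R w s) \<partial>lborel)"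
    unfolding set_lebesgue_integral_def by (rule integral_norm_bound)
  also have "\<dots> \<le> (\<integral>s. indicator {0..t} s *\<^sub>R g s \<partial>lborel)"
  proof (rule integral_mono_AE)
    show "integrable lborel (\<lambda>s. norm (indicator {0..t} s *\<^sub>R w s))"
      by (rule integrable_norm[OF assms(1)[unfolded set_integrable_def]])
    show "integrable lborel (\<lambda>s. indicator {0..t} s *\<^sub>R g s)"
      using assms(2) unfolding set_integrable_def .
    show "AE s in lborel. norm (indicator {0..t} s *\<^sub>R w s) \<le> indicator {0..t} s *\<^sub>R g s"
      using assms(3) by eventually_elim (auto simp: indicator_def)
  qed
  finally show ?thesis unfolding set_lebesgue_integral_def .
qed

text \<open>Rounds down to multiples of \<open>1 / real (Suc n)\<close>. Countably many values
  reduce measurability in time to fixed times, and rounding down keeps \<open>{0..T}\<close>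
  invariant.\<close>

definition grid :: "nat \<Rightarrow> real \<Rightarrow> real" where
  "grid n s = real_of_int \<lfloor>real (Suc n) * s\<rfloor> / real (Suc n)"

lemma grid_bounds: "grid n s \<le> s" "s - 1 / real (Suc n) \<le> grid n s"
proof -
  define S where "S = real (Suc n)"
  have S: "S > 0" by (simp add: S_def)
  have eq: "grid n s = of_int \<lfloor>S * s\<rfloor> / S" by (simp add: grid_def S_def)
  have fl: "of_int \<lfloor>S * s\<rfloor> \<le> S * s" "S * s - 1 \<le> of_int \<lfloor>S * s\<rfloor>" by linarith+
  have "grid n s \<le> s" "s - 1 / S \<le> grid n s"
    unfolding eq using fl S divide_right_mono[OF fl(2), of S]
    by (simp add: pos_divide_le_eq mult.commute, simp add: diff_divide_distrib)
  then show "grid n s \<le> s" "s - 1 / real (Suc n) \<le> grid n s" unfolding S_def by simp_all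
qed

lemma grid_mem: "s \<in> {0..T} \<Longrightarrow> grid n s \<in> {0..T}"
  using grid_bounds(1)[where n = n and s = s] by (auto simp: grid_def)

lemma grid_tendsto: "(\<lambda>n. grid n s) \<longlonglongrightarrow> s"
proof (rule metric_tendsto_imp_tendsto[OF LIMSEQ_inverse_real_of_nat], rule always_eventually,
  rule allI)
  fix n
  show "dist (grid n s) s \<le> dist (inverse (real (Suc n))) 0"
    using grid_bounds[where n = n and s = s] by (simp add: dist_real_def inverse_eq_divide)
qed

text \<open>
  The kernels are Borel versions of those in the theorem, hence the bounds that hold only almost
  everywhere; continuity of \<open>B s\<close> is needed for every \<open>s\<close>.
\<close>

locale mckean = osgood f G
  for f G :: "real \<Rightarrow> real" +
  fixes T :: real and h k :: "real \<Rightarrow> real" and B :: "('d::finite) drift"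
  assumes T: "0 < T"
    and h: "integrable lborel h" "\<And>s. 0 \<le> h s"
    and k: "integrable lborel k" "\<And>s. 0 \<le> k s"
    and B_meas: "\<And>x \<mu>. \<mu> \<in> P1 UNIV \<Longrightarrow> (\<lambda>s. B s x \<mu>) \<in> borel_measurable (restrict_space borel {0..T})"
    and B_cont: "\<And>s. s \<in> {0..T} \<Longrightarrow> \<exists>c. \<forall>x y. \<forall>\<mu>\<in>P1 UNIV. \<forall>\<nu>\<in>P1 UNIV.
      norm (B s x \<mu> - B s y \<nu>) \<le> c * f (norm (x - y) + d1 \<mu> \<nu>)"
    and B_growth: "AE s in lborel. s \<in> {0..T} \<longrightarrow> (\<forall>x. \<forall>\<mu>\<in>P1 UNIV.
      norm (B s x \<mu>) \<le> k s * (1 + norm x + norm1 \<mu>))"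
    and B_lip: "AE s in lborel. s \<in> {0..T} \<longrightarrow> (\<forall>x y. \<forall>\<mu>\<in>P1 UNIV. \<forall>\<nu>\<in>P1 UNIV.
      norm (B s x \<mu> - B s y \<nu>) \<le> h s * f (norm (x - y) + d1 \<mu> \<nu>))"
begin

text \<open>
  Joint measurability of \<open>B\<close> enters only through its sections \<open>s \<mapsto> B s x \<mu>\<close>. Nothing can be said
    about the
  sigma-algebra \<open>borel_P1\<close> itself: the locale \<open>Metric_space\<close> requires \<open>d1 \<ge> 0\<close> also
    for measures outside
  \<open>P1\<close>, where \<open>d1\<close> may be an infimum over the empty set.
\<close>

lemma drift_measurable:
  assumes m: "admissible T m"
  shows "(\<lambda>s. B s (apply_bcontfun x s) (m s)) \<in> borel_measurable (restrict_space borel {0..T})"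
proof -
  note q = grid_mem and qlim = grid_tendsto
  show ?thesis
  proof (rule borel_measurable_LIMSEQ_metric)
    fix n
    \<comment> \<open>Only the position and the flow are frozen at the grid time, while the first
      argument of \<open>B\<close> remains \<open>s\<close>; each \<open>F i\<close> is thus a
      section of \<open>B\<close>. The guard is there because \<open>m\<close> is known to be in
      \<open>P1 UNIV\<close> on \<open>{0..T}\<close> only.\<close>
    define F where "F i s = (if real_of_int i / real (Suc n) \<in> {0..T}
      then B s (apply_bcontfun x (real_of_int i / real (Suc n)))
        (m (real_of_int i / real (Suc n))) else 0)" for i s
    have "F i \<in> borel_measurable (restrict_space borel {0..T})" for i
    proof (cases "real_of_int i / real (Suc n) \<in> {0..T}")
      case True
      then show ?thesis unfolding F_def[abs_def]
        by (simp only: if_True B_meas[OF admissibleD(1)[OF m]])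
    next
      case False
      then show ?thesis unfolding F_def[abs_def]
        by (simp only: if_False measurable_const UNIV_I space_borel)
    qed
    moreover have "(\<lambda>s. \<lfloor>real (Suc n) * s\<rfloor>) \<in> measurable (restrict_space borel {0..T})
      (count_space UNIV)"
      by (rule measurable_restrict_space1) measurable
    ultimately have "(\<lambda>s. F \<lfloor>real (Suc n) * s\<rfloor> s) \<in> borel_measurable (restrict_space borel {0..T})"
      by (rule measurable_compose_countable)
    then show "(\<lambda>s. if grid n s \<in> {0..T} then B s (apply_bcontfun x (grid n s)) (m (grid n s))
      else 0)
      \<in> borel_measurable (restrict_space borel {0..T})"
      unfolding F_def grid_def .
  next
    fix s assume "s \<in> space (restrict_space borel {0..T})"
    then have s: "s \<in> {0..T}" by simp
    obtain c where c: "\<And>x y \<mu> \<nu>. \<mu> \<in> P1 UNIV \<Longrightarrow> \<nu> \<in> P1 UNIV \<Longrightarrow>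
        norm (B s x \<mu> - B s y \<nu>) \<le> c * f (norm (x - y) + d1 \<mu> \<nu>)"
      using B_cont[OF s] by blast
    have mP: "m s \<in> P1 UNIV" "m (grid n s) \<in> P1 UNIV" for n using admissibleD(1)[OF m] q[OF s] s
      by auto
    define e where "e n = norm (apply_bcontfun x s - apply_bcontfun x (grid n s)) + d1 (m s)
      (m (grid n s))" for n
    have "isCont (apply_bcontfun x) s" using continuous_on_eq_continuous_at[of UNIV] by auto
    from isCont_tendsto_compose[OF this qlim[where s = s]]
    have 1: "(\<lambda>n. norm (apply_bcontfun x s - apply_bcontfun x (grid n s))) \<longlonglongrightarrow>
        norm (apply_bcontfun x s - apply_bcontfun x s)"
      by (intro tendsto_intros)
    have 2: "(\<lambda>n. d1 (m s) (m (grid n s))) \<longlonglongrightarrow> 0"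
      by (rule admissibleD(2)[OF m s q[OF s] qlim[where s = s]])
    have "e \<longlonglongrightarrow> 0" unfolding e_def using tendsto_add[OF 1 2] by simp
    moreover have e0: "0 \<le> e n" for n
      unfolding e_def using d1_nonneg[OF P1D(1) P1D(1), OF mP] by (intro add_nonneg_nonneg) auto
    ultimately have "(\<lambda>n. f (e n)) \<longlonglongrightarrow> f 0" by (intro tendsto) auto
    then have "(\<lambda>n. c * f (e n)) \<longlonglongrightarrow> c * f 0" by (intro tendsto_intros)
    then have lim: "(\<lambda>n. c * f (e n)) \<longlonglongrightarrow> 0" by (simp add: zero)
    have "(\<lambda>n. B s (apply_bcontfun x (grid n s)) (m (grid n s))) \<longlonglongrightarrow> B s (apply_bcontfun x s) (m s)"
    proof (rule metric_tendsto_imp_tendsto[OF lim], rule always_eventually, rule allI)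
      fix n
      have "norm (B s (apply_bcontfun x s) (m s) - B s (apply_bcontfun x (grid n s))
        (m (grid n s))) \<le> c * f (e n)"
        unfolding e_def by (rule c[OF mP])
      then show "dist (B s (apply_bcontfun x (grid n s)) (m (grid n s)))
        (B s (apply_bcontfun x s) (m s))
          \<le> dist (c * f (e n)) 0"
        by (simp add: dist_norm norm_minus_commute)
    qed
    then show "(\<lambda>n. if grid n s \<in> {0..T} then B s (apply_bcontfun x (grid n s)) (m (grid n s))
      else 0)
        \<longlonglongrightarrow> B s (apply_bcontfun x s) (m s)"
      using q[OF s] by simp
  qed
qed

lemma drift_bound:
  assumes "\<And>s. s \<in> {0..T} \<Longrightarrow> m s \<in> P1 UNIV"
  shows "AE s in lborel. s \<in> {0..T} \<longrightarrow> norm (B s (apply_bcontfun x s) (m s))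
    \<le> k s * (1 + norm (apply_bcontfun x s) + norm1 (m s))"
  using B_growth by eventually_elim (use assms in auto)

lemma drift_integrable:
  assumes m: "admissible T m"
  shows "set_integrable lborel {0..T} (\<lambda>s. B s (apply_bcontfun x s) (m s))"
proof -
  obtain C where C: "\<And>s. s \<in> {0..T} \<Longrightarrow> norm1 (m s) \<le> C" using admissible_bounded[OF m] by blast
  show ?thesis
    unfolding set_integrable_def
  proof (rule Bochner_Integration.integrable_bound)
    show "integrable lborel (\<lambda>s. k s * (1 + norm x + C))" using k by simp
    show "(\<lambda>s. indicator {0..T} s *\<^sub>R B s (apply_bcontfun x s) (m s)) \<in> borel_measurable lborel"
      using drift_measurable[OF m, of x] by (simp add: borel_measurable_restrict_space_iff)
    have bd: "AE s in lborel. s \<in> {0..T} \<longrightarrow> norm (B s (apply_bcontfun x s) (m s))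
        \<le> k s * (1 + norm (apply_bcontfun x s) + norm1 (m s))"
      by (rule drift_bound) (rule admissibleD(1)[OF m])
    show "AE s in lborel. norm (indicator {0..T} s *\<^sub>R B s (apply_bcontfun x s) (m s))
        \<le> norm (k s * (1 + norm x + C))"
      using bd
    proof eventually_elim
      case (elim s)
      show ?case
      proof (cases "s \<in> {0..T}")
        case True
        then have "norm (B s (apply_bcontfun x s) (m s))
          \<le> k s * (1 + norm (apply_bcontfun x s) + norm1 (m s))"
          using elim by simp
        also have "\<dots> \<le> k s * (1 + norm x + C)"
          using k(2) C[OF True] norm_apply_le[of x s] by (intro mult_left_mono) auto
        finally show ?thesis using True by simp
      qed simp
    qed
  qed
qed

end

lemma integrable_mult_bounded:
  fixes k u :: "real \<Rightarrow> real"
  assumes "integrable lborel k" "u \<in> borel_measurable borel" "\<And>s. 0 \<le> u s" "\<And>s. u s \<le> R"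
  shows "integrable lborel (\<lambda>s. k s * u s)"
proof -
  interpret modulus "\<lambda>u. u" by unfold_locales (auto simp: modulus_of_continuity_def mono_on_def)
  show ?thesis by (rule integrable_kernel[OF assms])
qed

lemma apply_borel_measurable: "apply_bcontfun x \<in> borel_measurable borel"
  for x :: "('d::finite) path"
  by (rule borel_measurable_continuous_onI) simp

lemma paths_limit:
  assumes z: "\<And>n. z n \<in> paths T" and lim: "z \<longlonglongrightarrow> x"
  shows "x \<in> paths T"
proof -
  have pt: "(\<lambda>n. apply_bcontfun (z n) t) \<longlonglongrightarrow> apply_bcontfun x t" for t
    by (rule metric_tendsto_imp_tendsto[OF lim]) (simp add: dist_bounded)
  have "apply_bcontfun x t = apply_bcontfun x (max 0 (min t T))" for t
    using LIMSEQ_unique[OF pt[of t]] pt[of "max 0 (min t T)"] path_clamp[OF z, of _ t] by simp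
  then show ?thesis by (simp add: paths_def)
qed

section \<open>Bounds, stability and solvability for a frozen flow\<close>

context mckean
begin

lemma drift_norm_le:
  assumes m: "\<And>s. s \<in> {0..T} \<Longrightarrow> m s \<in> P1 UNIV"
    and int: "set_integrable lborel {0..T} (\<lambda>s. B s (apply_bcontfun x s) (m s))"
    and c: "c \<in> borel_measurable borel" "\<And>s. 0 \<le> c s" "\<And>s. c s \<le> C"
    and mc: "\<And>s. s \<in> {0..T} \<Longrightarrow> norm1 (m s) \<le> c s" and t: "0 \<le> t" "t \<le> T"
  shows "norm (LINT s:{0..t}|lborel. B s (apply_bcontfun x s) (m s))
    \<le> (LINT s:{0..t}|lborel. k s * (1 + c s + norm (apply_bcontfun x s)))"
proof (rule norm_LINT_le)
  show "set_integrable lborel {0..t} (\<lambda>s. B s (apply_bcontfun x s) (m s))"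
    by (rule set_integrable_lborel_subset[OF int _ t(2)]) simp
  have "integrable lborel (\<lambda>s. k s * (1 + c s + norm (apply_bcontfun x s)))"
    using c apply_borel_measurable[of x] norm_apply_le[of x]
    by (intro integrable_mult_bounded[OF k(1), where R = "1 + C + norm x"])
      (auto intro!: add_mono add_nonneg_nonneg)
  then show "set_integrable lborel {0..t} (\<lambda>s. k s * (1 + c s + norm (apply_bcontfun x s)))"
    by (rule set_integrable_lborelI)
    have bd: "AE s in lborel. s \<in> {0..T} \<longrightarrow> norm (B s (apply_bcontfun x s) (m s))
        \<le> k s * (1 + norm (apply_bcontfun x s) + norm1 (m s))"
      by (rule drift_bound) (rule m)
  show "AE s in lborel. s \<in> {0..t} \<longrightarrow> norm (B s (apply_bcontfun x s) (m s))
    \<le> k s * (1 + c s + norm (apply_bcontfun x s))"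
    using bd
  proof eventually_elim
    case (elim s)
    show ?case
    proof
      assume "s \<in> {0..t}"
      then have s: "s \<in> {0..T}" using t by simp
      then have "norm (B s (apply_bcontfun x s) (m s))
        \<le> k s * (1 + norm (apply_bcontfun x s) + norm1 (m s))"
        using elim by simp
      also have "\<dots> \<le> k s * (1 + c s + norm (apply_bcontfun x s))"
        using mc[OF s] k(2) by (intro mult_left_mono) auto
      finally show "norm (B s (apply_bcontfun x s) (m s))
        \<le> k s * (1 + c s + norm (apply_bcontfun x s))" .
    qed
  qed
qed

lemma drift_diff_le:
  assumes m: "admissible T m" "admissible T m'"
    and e: "e \<in> borel_measurable borel" "\<And>s. 0 \<le> e s" "\<And>s. e s \<le> R"
    and me: "\<And>s. s \<in> {0..T} \<Longrightarrow> d1 (m s) (m' s) \<le> e s" and t: "0 \<le> t" "t \<le> T"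
  shows "norm ((LINT s:{0..t}|lborel. B s (apply_bcontfun x s) (m s)) -
    (LINT s:{0..t}|lborel. B s (apply_bcontfun x' s) (m' s)))
    \<le> (LINT s:{0..t}|lborel. h s * f (norm (apply_bcontfun x s - apply_bcontfun x' s) + e s))"
proof -
  have i: "set_integrable lborel {0..t} (\<lambda>s. B s (apply_bcontfun x s) (m s))"
    "set_integrable lborel {0..t} (\<lambda>s. B s (apply_bcontfun x' s) (m' s))"
    using set_integrable_lborel_subset[OF drift_integrable[OF m(1)] _ t(2)]
      set_integrable_lborel_subset[OF drift_integrable[OF m(2)] _ t(2)] by auto
  have "norm (LINT s:{0..t}|lborel. B s (apply_bcontfun x s) (m s) - B s (apply_bcontfun x' s)
    (m' s))
    \<le> (LINT s:{0..t}|lborel. h s * f (norm (apply_bcontfun x s - apply_bcontfun x' s) + e s))"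
  proof (rule norm_LINT_le)
    show "set_integrable lborel {0..t} (\<lambda>s. B s (apply_bcontfun x s) (m s) - B s
      (apply_bcontfun x' s) (m' s))"
      by (rule set_integral_diff(1)[OF i])
    have "integrable lborel (\<lambda>s. h s * f (norm (apply_bcontfun x s - apply_bcontfun x' s) + e s))"
      using e apply_borel_measurable[of x] apply_borel_measurable[of x'] dist_apply_le[of x _ x']
      by (intro integrable_kernel[OF h(1), where R = "norm (x - x') + R"]) (auto intro!: add_mono)
    then show "set_integrable lborel {0..t}
      (\<lambda>s. h s * f (norm (apply_bcontfun x s - apply_bcontfun x' s) + e s))"
      by (rule set_integrable_lborelI)
    show "AE s in lborel. s \<in> {0..t} \<longrightarrow>
      norm (B s (apply_bcontfun x s) (m s) - B s (apply_bcontfun x' s) (m' s))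
        \<le> h s * f (norm (apply_bcontfun x s - apply_bcontfun x' s) + e s)"
      using B_lip
    proof eventually_elim
      case (elim s)
      show ?case
      proof
        assume "s \<in> {0..t}"
        then have s: "s \<in> {0..T}" using t by simp
        note P = admissibleD(1)[OF m(1) s] admissibleD(1)[OF m(2) s]
        have "norm (B s (apply_bcontfun x s) (m s) - B s (apply_bcontfun x' s) (m' s))
            \<le> h s * f (norm (apply_bcontfun x s - apply_bcontfun x' s) + d1 (m s) (m' s))"
          using elim s P by blast
        also have "\<dots> \<le> h s * f (norm (apply_bcontfun x s - apply_bcontfun x' s) + e s)"
          using me[OF s] h(2) d1_nonneg[OF P1D(1)[OF P(1)] P1D(1)[OF P(2)]]
          by (intro mult_left_mono mono) auto
        finally show "norm (B s (apply_bcontfun x s) (m s) - B s (apply_bcontfun x' s) (m' s))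
            \<le> h s * f (norm (apply_bcontfun x s - apply_bcontfun x' s) + e s)" .
      qed
    qed
  qed
  then show ?thesis using set_integral_diff(2)[OF i] by simp
qed

lemma solution_norm_le:
  assumes m: "\<And>s. s \<in> {0..T} \<Longrightarrow> m s \<in> P1 UNIV"
    and c: "c \<in> borel_measurable borel" "\<And>s. 0 \<le> c s" "\<And>s. c s \<le> C"
    and mc: "\<And>s. s \<in> {0..T} \<Longrightarrow> norm1 (m s) \<le> c s" and t: "0 \<le> t" "t \<le> T"
    and sol: "solves_equation T B m x y"
  shows "norm (apply_bcontfun x t)
    \<le> norm y + (LINT s:{0..t}|lborel. k s * (1 + c s + norm (apply_bcontfun x s)))"
proof -
  have "apply_bcontfun x t = (LINT s:{0..t}|lborel. B s (apply_bcontfun x s) (m s)) +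
    apply_bcontfun y t"
    using sol t by (auto simp: solves_equation_def)
  then have "norm (apply_bcontfun x t)
      \<le> norm (LINT s:{0..t}|lborel. B s (apply_bcontfun x s) (m s)) + norm (apply_bcontfun y t)"
    by (simp only: norm_triangle_ineq)
  then show ?thesis
    using drift_norm_le[OF m _ c mc t, of x] sol norm_apply_le[of y t]
    unfolding solves_equation_def by linarith
qed

lemma solution_diff_le:
  assumes m: "admissible T m" "admissible T m'"
    and e: "e \<in> borel_measurable borel" "\<And>s. 0 \<le> e s" "\<And>s. e s \<le> R"
    and me: "\<And>s. s \<in> {0..T} \<Longrightarrow> d1 (m s) (m' s) \<le> e s" and t: "0 \<le> t" "t \<le> T"
    and sol: "solves_equation T B m x y" "solves_equation T B m' x' y'"
  shows "norm (apply_bcontfun x t - apply_bcontfun x' t) \<le> norm (y - y')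
    + (LINT s:{0..t}|lborel. h s * f (norm (apply_bcontfun x s - apply_bcontfun x' s) + e s))"
proof -
  let ?I = "LINT s:{0..t}|lborel. B s (apply_bcontfun x s) (m s)"
  let ?I' = "LINT s:{0..t}|lborel. B s (apply_bcontfun x' s) (m' s)"
  have "apply_bcontfun x t = ?I + apply_bcontfun y t"
    "apply_bcontfun x' t = ?I' + apply_bcontfun y' t"
    using sol t by (auto simp: solves_equation_def)
  then have "apply_bcontfun x t - apply_bcontfun x' t
    = (?I - ?I') + (apply_bcontfun y t - apply_bcontfun y' t)"
    by simp
  then have "norm (apply_bcontfun x t - apply_bcontfun x' t)
      \<le> norm (?I - ?I') + norm (apply_bcontfun y t - apply_bcontfun y' t)"
    by (simp only: norm_triangle_ineq)
  then show ?thesis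
    using drift_diff_le[OF m e me t, of x x'] dist_apply_le[of y t y'] by linarith
qed

text \<open>Flow and input are perturbed together with one tolerance. With equal flows and inputs
  this gives uniqueness, with equal flows continuity in the input, and with equal inputs convergence
  of iterates uniformly in the driving path.\<close>

definition stable_within :: "real \<Rightarrow> real \<Rightarrow> bool" where
  "stable_within \<epsilon> \<rho> \<longleftrightarrow> (\<forall>m m' x x' y y'. admissible T m \<longrightarrow> admissible T m' \<longrightarrow>
    x \<in> paths T \<longrightarrow> x' \<in> paths T \<longrightarrow> solves_equation T B m x y \<longrightarrow> solves_equation T B m' x' y' \<longrightarrow>
    (\<forall>s\<in>{0..T}. d1 (m s) (m' s) \<le> \<rho>) \<longrightarrow> norm (y - y') \<le> \<rho> \<longrightarrow> norm (x - x') \<le> \<epsilon>)"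

lemma stable_withinD:
  assumes "stable_within \<epsilon> \<rho>" "admissible T m" "admissible T m'" "x \<in> paths T" "x' \<in> paths T"
    "solves_equation T B m x y" "solves_equation T B m' x' y'"
    "\<And>s. s \<in> {0..T} \<Longrightarrow> d1 (m s) (m' s) \<le> \<rho>" "norm (y - y') \<le> \<rho>"
  shows "norm (x - x') \<le> \<epsilon>"
  using assms unfolding stable_within_def by blast

lemma solution_stable:
  assumes "\<epsilon> > 0"
  obtains \<rho> where "\<rho> > 0" "stable_within \<epsilon> \<rho>"
proof (rule small_solution[OF h _ assms, of T])
  fix \<rho> :: real assume \<rho>: "\<rho> > 0" and sw: "small_within h T \<epsilon> \<rho>"
  note small = small_withinD[OF sw]
  have \<rho>2: "\<rho> / 2 > 0" using \<rho> by simp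
  show thesis
  proof (rule that[OF \<rho>2], unfold stable_within_def, intro allI impI)
    fix m m' x x' y y'
    assume m: "admissible T m" "admissible T m'" and x: "x \<in> paths T" "x' \<in> paths T"
      and sol: "solves_equation T B m x y" "solves_equation T B m' x' y'"
      and d: "\<forall>s\<in>{0..T}. d1 (m s) (m' s) \<le> \<rho> / 2" and y: "norm (y - y') \<le> \<rho> / 2"
    \<comment> \<open>The perturbation of the flow is added to the unknown: the kernel becomes
      \<open>f (e s)\<close>, and the datum is \<rho>/2 from the input plus \<rho>/2 from the
      shift.\<close>
    define e where "e s = norm (apply_bcontfun x s - apply_bcontfun x' s) + \<rho> / 2" for s
    have "e t < \<epsilon>" if t: "0 \<le> t" "t \<le> T" for t
    proof (rule small[where e = e and t = t and r = \<rho> and R = "norm (x - x') + \<rho> / 2"])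
      show "e \<in> borel_measurable borel"
        unfolding e_def using apply_borel_measurable[of x] apply_borel_measurable[of x']
          by measurable
      show "0 \<le> e s" "e s \<le> norm (x - x') + \<rho> / 2" for s
        using \<rho> dist_apply_le[of x s x'] by (auto simp: e_def)
      show "e t \<le> \<rho> + (LINT s:{0..t}|lborel. h s * f (e s))" if "0 \<le> t" "t \<le> T" for t
        using solution_diff_le[OF m _ _ _ bspec[OF d] that sol, of "\<rho> / 2"] \<rho> y by (simp add: e_def)
    qed (use t in auto)
    note less = this
    show "norm (x - x') \<le> \<epsilon>"
    proof (rule dist_path_le[OF less_imp_le[OF T] x])
      fix t assume "0 \<le> t" "t \<le> T"
      from less[OF this] \<rho> show "norm (apply_bcontfun x t - apply_bcontfun x' t) \<le> \<epsilon>"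
        unfolding e_def by linarith
    qed
  qed
qed (use T in simp)

lemma solution_unique:
  assumes "admissible T m" "x \<in> paths T" "x' \<in> paths T"
    "solves_equation T B m x y" "solves_equation T B m x' y"
  shows "x = x'"
proof -
  have "norm (x - x') \<le> 0 + \<epsilon>" if \<epsilon>: "\<epsilon> > 0" for \<epsilon>
  proof (rule solution_stable[OF \<epsilon>])
    fix \<rho> :: real assume \<rho>: "\<rho> > 0" and st: "stable_within \<epsilon> \<rho>"
    note * = stable_withinD[OF st]
    have "norm (x - x') \<le> \<epsilon>"
      by (rule *[OF assms(1,1,2,3,4,5)])
        (use \<rho> d1_refl[OF admissibleD(1)[OF assms(1)] small_partitions_UNIV] in auto)
    then show "norm (x - x') \<le> 0 + \<epsilon>" by simp
  qed
  then have "norm (x - x') \<le> 0" by (rule field_le_epsilon)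
  then show ?thesis by simp
qed

text \<open>Picard iteration in path space. A Gronwall bound common to all iterates supplies the
  uniform bound required by the Osgood argument for differences, in which the input cancels. The
  Cauchy limit stays in the closed set \<open>paths T\<close>, and continuity of \<open>f\<close> at
  0 passes the equation to it.\<close>

lemma solution_exists:
  assumes m: "admissible T m" and y: "y \<in> paths T"
  shows "\<exists>x\<in>paths T. solves_equation T B m x y"
proof -
  define I where "I x t = (LINT s:{0..t}|lborel. B s (apply_bcontfun x s) (m s))" for x t
  have "\<exists>x'. x' \<in> paths T \<and> (\<forall>t\<in>{0..T}. apply_bcontfun x' t = I x t + apply_bcontfun y t)" for x
  proof -
    have "continuous_on {0..T} (\<lambda>t. I x t + apply_bcontfun y t)"
      unfolding I_def by (intro continuous_on_add continuous_on_LINT[OF drift_integrable[OF m]])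
        simp
    from ex1_path[OF less_imp_le[OF T] this] show ?thesis by blast
  qed
  then obtain \<Psi> where \<Psi>: "\<And>x. \<Psi> x \<in> paths T"
    "\<And>x t. t \<in> {0..T} \<Longrightarrow> apply_bcontfun (\<Psi> x) t = I x t + apply_bcontfun y t" by metis
  define z where "z n = (\<Psi> ^^ n) y" for n
  have z0: "z 0 = y" and zS: "z (Suc n) = \<Psi> (z n)" for n by (simp_all add: z_def)
  have zp: "z n \<in> paths T" for n by (cases n) (use z0 zS y \<Psi>(1) in auto)
  obtain C' where C': "\<And>s. s \<in> {0..T} \<Longrightarrow> norm1 (m s) \<le> C'" using admissible_bounded[OF m] by blast
  define C where "C = max 0 C'"
  have C: "norm1 (m s) \<le> C" if "s \<in> {0..T}" for s using C'[OF that] by (simp add: C_def)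
  have C0: "0 \<le> C" by (simp add: C_def)
  \<comment> \<open>The constant of the iterated Gronwall bound with datum \<open>norm y\<close> and
    kernel \<open>(1 + C) * k\<close>; the factor absorbs the moments of the flow, since 1 + C + a
    \<le> (1 + C) (1 + a) for a \<ge> 0.\<close>
  define K where "K = (norm y + 1) * exp (2 * (LINT s|lborel. (1 + C) * k s))"
  have meas[measurable]: "apply_bcontfun (z n) \<in> borel_measurable borel" for n
    by (rule apply_borel_measurable)
  have zK': "norm (apply_bcontfun (z n) t) \<le> K" if t: "0 \<le> t" "t \<le> T" for n t
    unfolding K_def
  proof (rule gronwall_iterates[where a = "\<lambda>n s. norm (apply_bcontfun (z n) s)" and T = T and
        R = "\<lambda>n. norm (z n)"])
    show "integrable lborel (\<lambda>s. (1 + C) * k s)" using k by simp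
    show "0 \<le> (1 + C) * k s" for s using k C0 by simp
    fix n t assume t: "0 \<le> t" "t \<le> T"
    have "norm (apply_bcontfun (z (Suc n)) t) \<le> norm (I (z n) t) + norm (apply_bcontfun y t)"
      using zS[of n] \<Psi>(2)[of t "z n"] t norm_triangle_ineq[of "I (z n) t" "apply_bcontfun y t"]
        by simp
    also have "\<dots> \<le> (LINT s:{0..t}|lborel. k s * (1 + C + norm (apply_bcontfun (z n) s))) + norm y"
      using drift_norm_le[OF admissibleD(1)[OF m] drift_integrable[OF m] _ _ _ C t, of C "z n"] C0
        norm_apply_le[of y t] unfolding I_def by auto
    also have "(LINT s:{0..t}|lborel. k s * (1 + C + norm (apply_bcontfun (z n) s)))
      \<le> (LINT s:{0..t}|lborel. (1 + C) * k s * (1 + norm (apply_bcontfun (z n) s) + norm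
        (apply_bcontfun (z (Suc n)) s)))"
    proof (rule set_integral_mono)
      have "integrable lborel (\<lambda>s. k s * (1 + C + norm (apply_bcontfun (z n) s)))"
        using C0 norm_apply_le[of "z n"]
        by (intro integrable_mult_bounded[OF k(1), where R = "1 + C + norm (z n)"]) auto
      then show "set_integrable lborel {0..t} (\<lambda>s. k s * (1 + C + norm (apply_bcontfun (z n) s)))"
        by (rule set_integrable_lborelI)
      have "integrable lborel
        (\<lambda>s. (1 + C) * k s * (1 + norm (apply_bcontfun (z n) s) + norm
        (apply_bcontfun (z (Suc n)) s)))"
        using norm_apply_le[of "z n"] norm_apply_le[of "z (Suc n)"] k(1)
        by (intro integrable_mult_bounded[where k = "\<lambda>s. (1 + C) * k s"
          and R = "1 + norm (z n) + norm (z (Suc n))"])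
            (auto intro!: add_mono)
      then show "set_integrable lborel {0..t}
        (\<lambda>s. (1 + C) * k s * (1 + norm (apply_bcontfun (z n) s) + norm
        (apply_bcontfun (z (Suc n)) s)))"
        by (rule set_integrable_lborelI)
      fix s
      have "1 + C + norm (apply_bcontfun (z n) s)
          \<le> (1 + C) * (1 + norm (apply_bcontfun (z n) s) + norm (apply_bcontfun (z (Suc n)) s))"
        using C0 by (simp add: algebra_simps)
      then have "k s * (1 + C + norm (apply_bcontfun (z n) s))
          \<le> k s * ((1 + C) * (1 + norm (apply_bcontfun (z n) s) + norm
            (apply_bcontfun (z (Suc n)) s)))"
        using k(2) by (intro mult_left_mono)
      then show "k s * (1 + C + norm (apply_bcontfun (z n) s))
          \<le> (1 + C) * k s * (1 + norm (apply_bcontfun (z n) s) + norm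
            (apply_bcontfun (z (Suc n)) s))"
        by (simp add: ac_simps)
    qed
    finally show "norm (apply_bcontfun (z (Suc n)) t)
      \<le> norm y + (LINT s:{0..t}|lborel. (1 + C) * k s *
        (1 + norm (apply_bcontfun (z n) s) + norm (apply_bcontfun (z (Suc n)) s)))"
      by simp
  qed (use t norm_apply_le z0 in auto)
  have zK: "norm (apply_bcontfun (z n) t) \<le> K" for n t
    using zK'[of "max 0 (min t T)" n] T path_clamp[OF zp[of n], of t] by simp
  have Cauchy: "\<exists>N. \<forall>n\<ge>N. \<forall>p\<ge>N. \<forall>t\<in>{0..T}. norm (apply_bcontfun (z n) t - apply_bcontfun (z p) t)
    < \<epsilon>"
    if \<epsilon>: "\<epsilon> > 0" for \<epsilon>
  proof (rule picard_cauchy[OF h, where R = "2 * K"])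
    fix n p
    show "(\<lambda>t. norm (apply_bcontfun (z n) t - apply_bcontfun (z p) t)) \<in> borel_measurable borel"
      by measurable
    show le2K: "norm (apply_bcontfun (z n) s - apply_bcontfun (z p) s) \<le> 2 * K" for s
      using norm_triangle_ineq4[of "apply_bcontfun (z n) s" "apply_bcontfun (z p) s"] zK[of n s]
        zK[of p s] by simp
    fix t assume t: "0 \<le> t" "t \<le> T"
    have "apply_bcontfun (z (Suc n)) t - apply_bcontfun (z (Suc p)) t = I (z n) t - I (z p) t"
      using zS \<Psi>(2) t by simp
    also have "norm \<dots>
      \<le> (LINT s:{0..t}|lborel. h s * f (norm (apply_bcontfun (z n) s - apply_bcontfun (z p) s) +
      0))"
      unfolding I_def using d1_refl[OF admissibleD(1)[OF m] small_partitions_UNIV]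
      by (intro drift_diff_le[OF m m _ _ _ _ t]) auto
    also have "\<dots> \<le>
      (LINT s:{0..t}|lborel. h s * f (norm (apply_bcontfun (z n) s - apply_bcontfun (z p) s) +
        norm (apply_bcontfun (z (Suc n)) s - apply_bcontfun (z (Suc p)) s)))"
      using dist_apply_le[of "z n" _ "z p"] dist_apply_le[of "z (Suc n)" _ "z (Suc p)"]
      by (intro kernel_mono[OF h, where R = "norm (z n - z p)"
        and R' = "norm (z n - z p) + norm (z (Suc n) - z (Suc p))"])
        (auto intro!: add_mono)
    finally show "norm (apply_bcontfun (z (Suc n)) t - apply_bcontfun (z (Suc p)) t)
      \<le> (LINT s:{0..t}|lborel. h s * f (norm (apply_bcontfun (z n) s - apply_bcontfun (z p) s) +
        norm (apply_bcontfun (z (Suc n)) s - apply_bcontfun (z (Suc p)) s)))" .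
  qed (use T \<epsilon> in auto)
  have "Cauchy z"
  proof (rule metric_CauchyI)
    fix \<epsilon> :: real assume "\<epsilon> > 0"
    then have "\<epsilon> / 2 > 0" by simp
    then obtain N where N: "\<And>n p t. n \<ge> N \<Longrightarrow> p \<ge> N \<Longrightarrow> t \<in> {0..T} \<Longrightarrow>
        norm (apply_bcontfun (z n) t - apply_bcontfun (z p) t) < \<epsilon> / 2" using Cauchy by blast
    have "dist (z n) (z p) < \<epsilon>" if "n \<ge> N" "p \<ge> N" for n p
    proof -
      have "norm (z n - z p) \<le> \<epsilon> / 2"
        using T by (intro dist_path_le[of T] zp less_imp_le[OF N[OF that]]) auto
      then show ?thesis using \<open>\<epsilon> > 0\<close> by (simp add: dist_norm)
    qed
    then show "\<exists>M. \<forall>n\<ge>M. \<forall>p\<ge>M. dist (z n) (z p) < \<epsilon>" by blast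
  qed
  then obtain x where x: "z \<longlonglongrightarrow> x" using convergent_eq_Cauchy by blast
  have xp: "x \<in> paths T" by (rule paths_limit[OF zp x])
  have "apply_bcontfun x t = I x t + apply_bcontfun y t" if t: "t \<in> {0..T}" for t
  proof -
    have t': "0 \<le> t" "t \<le> T" using t by auto
    have "(\<lambda>n. norm (z n - x)) \<longlonglongrightarrow> 0"
      using x by (simp add: tendsto_norm_zero_iff LIM_zero)
    then have l1: "(\<lambda>n. norm (z (Suc n) - x)) \<longlonglongrightarrow> 0" and
      l2: "(\<lambda>n. f (norm (z n - x)) * (LINT s:{0..t}|lborel. h s))
        \<longlonglongrightarrow> f 0 * (LINT s:{0..t}|lborel. h s)"
      by (auto intro!: tendsto_intros tendsto LIMSEQ_Suc)
    have lim: "(\<lambda>n. norm (z (Suc n) - x) + f (norm (z n - x)) * (LINT s:{0..t}|lborel. h s)) \<longlonglongrightarrow> 0"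
      using tendsto_add[OF l1 l2] by (simp add: zero)
    have "norm (apply_bcontfun x t - (I x t + apply_bcontfun y t))
        \<le> norm (z (Suc n) - x) + f (norm (z n - x)) * (LINT s:{0..t}|lborel. h s)" for n
    proof -
      have "norm (apply_bcontfun x t - (I x t + apply_bcontfun y t))
          = norm ((I (z n) t - I x t) - (apply_bcontfun (z (Suc n)) t - apply_bcontfun x t))"
        using zS[of n] \<Psi>(2)[OF t, of "z n"] by (simp add: algebra_simps)
      also have "\<dots> \<le> norm (I (z n) t - I x t) + norm
        (apply_bcontfun (z (Suc n)) t - apply_bcontfun x t)"
        by (rule norm_triangle_ineq4)
      also have "norm (apply_bcontfun (z (Suc n)) t - apply_bcontfun x t) \<le> norm (z (Suc n) - x)"
        by (rule dist_apply_le)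
      also have "norm (I (z n) t - I x t)
          \<le> (LINT s:{0..t}|lborel. h s * f (norm (apply_bcontfun (z n) s - apply_bcontfun x s) +
            0))"
        unfolding I_def using d1_refl[OF admissibleD(1)[OF m] small_partitions_UNIV]
        by (intro drift_diff_le[OF m m _ _ _ _ t']) auto
      also have "\<dots> \<le> (LINT s:{0..t}|lborel. h s * f (norm (z n - x)))"
        using dist_apply_le[of "z n" _ x] apply_borel_measurable[of x]
        by (intro kernel_mono[OF h, where R = "norm (z n - x)" and R' = "norm (z n - x)"]) auto
      also have "\<dots> = f (norm (z n - x)) * (LINT s:{0..t}|lborel. h s)" by (simp add: mult.commute)
      finally show ?thesis by simp
    qed
    then have "norm (apply_bcontfun x t - (I x t + apply_bcontfun y t)) \<le> 0"
      by (intro LIMSEQ_le_const[OF lim]) auto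
    then show ?thesis by simp
  qed
  then have "solves_equation T B m x y"
    using drift_integrable[OF m, of x] by (simp add: solves_equation_def I_def)
  then show ?thesis using xp by blast
qed

text \<open>A genuine description for admissible \<open>m\<close> and
  \<open>y \<in> paths T\<close>, where a unique solution exists; elsewhere its value is
  unspecified.\<close>

definition flow_map :: "(real \<Rightarrow> (real ^ 'd) measure) \<Rightarrow> 'd path \<Rightarrow> 'd path" where
  "flow_map m y = (THE x. x \<in> paths T \<and> solves_equation T B m x y)"

lemma flow_map:
  assumes "admissible T m" "y \<in> paths T"
  shows "flow_map m y \<in> paths T" "solves_equation T B m (flow_map m y) y"
proof -
  have "\<exists>!x. x \<in> paths T \<and> solves_equation T B m x y"
    using solution_exists[OF assms] solution_unique[OF assms(1)] by blast
  from theI'[OF this] show "flow_map m y \<in> paths T" "solves_equation T B m (flow_map m y) y"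
    unfolding flow_map_def by auto
qed

lemma flow_map_eqI:
  assumes "admissible T m" "y \<in> paths T" "x \<in> paths T" "solves_equation T B m x y"
  shows "flow_map m y = x"
  by (rule solution_unique[OF assms(1) _ assms(3) _ assms(4)]) (use flow_map[OF assms(1,2)] in auto)

lemma flow_map_measurable:
  assumes m: "admissible T m"
  shows "flow_map m \<in> measurable (borel_on (paths T)) (borel_on (paths T))"
proof -
  have "continuous_on (paths T) (flow_map m)"
  proof (rule continuous_onI)
    fix y :: "'d path" and \<epsilon> :: real assume y: "y \<in> paths T" and \<epsilon>: "\<epsilon> > 0"
    show "\<exists>d>0. \<forall>y'\<in>paths T. dist y' y < d \<longrightarrow> dist (flow_map m y') (flow_map m y) \<le> \<epsilon>"
    proof (rule solution_stable[OF \<epsilon>])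
      fix \<rho> :: real assume \<rho>: "\<rho> > 0" and st: "stable_within \<epsilon> \<rho>"
      note * = stable_withinD[OF st]
      have "norm (flow_map m y' - flow_map m y) \<le> \<epsilon>" if y': "y' \<in> paths T" "dist y' y < \<rho>" for y'
        by (rule *[OF m m flow_map(1)[OF m y'(1)] flow_map(1)[OF m y] flow_map(2)[OF m y'(1)]
          flow_map(2)[OF m y]])
          (use \<rho> y'(2) d1_refl[OF admissibleD(1)[OF m] small_partitions_UNIV] in \<open>auto simp:
            dist_norm\<close>)
      then show ?thesis using \<rho> by (auto simp: dist_norm)
    qed
  qed
  then have "flow_map m \<in> borel_measurable (borel_on (paths T))"
    by (rule borel_measurable_continuous_on_restrict)
  then show ?thesis
    using flow_map(1)[OF m] by (intro measurable_restrict_space2) auto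
qed

text \<open>The flow is assumed to have bounded first moments, which is all that the definition of a
  weak solution grants. The bound makes the supremum norm of X integrable, and only from there does
  admissibility of the flow follow.\<close>

lemma solution_growth:
  assumes m: "\<And>s. s \<in> {0..T} \<Longrightarrow> m s \<in> P1 UNIV" and C': "\<And>s. s \<in> {0..T} \<Longrightarrow> norm1 (m s) \<le> C'"
  obtains D where "\<And>x y. x \<in> paths T \<Longrightarrow> solves_equation T B m x y \<Longrightarrow> norm x \<le> D * (1 + norm y)"
proof -
  define C where "C = max 0 C'"
  have C: "norm1 (m s) \<le> C" if "s \<in> {0..T}" for s using C'[OF that] by (simp add: C_def)
  have C0: "0 \<le> C" by (simp add: C_def)
  define E where "E = exp (LINT s|lborel. k s)"
  have E: "E \<ge> 1" using k(2) by (simp add: E_def)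
  show ?thesis
  proof (rule that[of "(1 + C) * E"])
    fix x y assume x: "x \<in> paths T" and sol: "solves_equation T B m x y"
    have "norm (apply_bcontfun x t) + (1 + C) \<le> (norm y + (1 + C)) * E" if t: "0 \<le> t" "t \<le> T" for t
      unfolding E_def
    proof (rule gronwall[OF k, where T = T and R = "norm x + (1 + C)"
          and e = "\<lambda>t. norm (apply_bcontfun x t) + (1 + C)"])
      show "(\<lambda>t. norm (apply_bcontfun x t) + (1 + C)) \<in> borel_measurable borel"
        using apply_borel_measurable[of x] by measurable
      fix t assume t: "0 \<le> t" "t \<le> T"
      show "norm (apply_bcontfun x t) + (1 + C)
          \<le> norm y + (1 + C) + (LINT s:{0..t}|lborel. k s * (norm (apply_bcontfun x s) + (1 + C)))"
        using solution_norm_le[OF m _ _ _ C t sol, of C] C0 by (simp add: add.commute)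
    qed (use C0 norm_apply_le[of x] t in \<open>auto intro: add_nonneg_pos\<close>)
    moreover have "(norm y + (1 + C)) * E \<le> (1 + C) * E * (1 + norm y)"
      using C0 E by (simp add: algebra_simps mult_nonneg_nonneg)
    ultimately have *: "norm (apply_bcontfun x t) \<le> (1 + C) * E * (1 + norm y)" if "0 \<le> t" "t \<le> T"
      for t
      using that C0 by fastforce
    show "norm x \<le> (1 + C) * E * (1 + norm y)"
      using dist_path_le[OF less_imp_le[OF T] x zero_path] * by simp
  qed
qed

end

section \<open>Stability, existence and uniqueness in law\<close>

text \<open>The usual argument for a family that is continuous in time and measurable in \<omega>:
  at rounded times countably many sections are glued together, and continuity gives the
  limit.\<close>

lemma path_jointly_measurable:
  fixes X :: "'w \<Rightarrow> ('d::finite) path"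
  assumes X: "X \<in> measurable Q (borel_on (paths T))"
  shows "(\<lambda>z. apply_bcontfun (X (snd z)) (fst z)) \<in> borel_measurable (borel \<Otimes>\<^sub>M Q)"
proof (rule borel_measurable_LIMSEQ_metric)
  fix n
  have "(\<lambda>z. apply_bcontfun (X (snd z)) (real_of_int i / real (Suc n))) \<in> borel_measurable
    (borel \<Otimes>\<^sub>M Q)" for i
    by (rule measurable_compose[OF measurable_snd
      measurable_compose[OF X apply_bcontfun_measurable]])
  moreover have "(\<lambda>z. \<lfloor>real (Suc n) * fst z\<rfloor>) \<in> measurable (borel \<Otimes>\<^sub>M Q) (count_space UNIV)"
    by measurable
  ultimately show "(\<lambda>z. apply_bcontfun (X (snd z)) (grid n (fst z))) \<in> borel_measurable
    (borel \<Otimes>\<^sub>M Q)"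
    unfolding grid_def by (rule measurable_compose_countable)
next
  fix z :: "real \<times> 'w"
  have "isCont (apply_bcontfun (X (snd z))) (fst z)"
    using continuous_on_eq_continuous_at[of UNIV] by auto
  from isCont_tendsto_compose[OF this grid_tendsto]
  show "(\<lambda>n. apply_bcontfun (X (snd z)) (grid n (fst z))) \<longlonglongrightarrow> apply_bcontfun (X (snd z)) (fst z)" .
qed

section \<open>Averaging the pathwise inequality\<close>

context concave_modulus
begin

text \<open>Jensen's inequality is applied on the open half-line, so the variable, which may vanish,
  is first shifted by \<delta> > 0. Monotonicity of \<open>f\<close> allows the shift and continuity
  removes it. Integrability is the linear growth of \<open>f\<close>.\<close>

lemma jensen:
  assumes Q: "prob_space Q" and X: "integrable Q X" "\<And>\<omega>. 0 \<le> X \<omega>"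
  shows "integrable Q (\<lambda>\<omega>. f (X \<omega>))" "(\<integral>\<omega>. f (X \<omega>) \<partial>Q) \<le> f (\<integral>\<omega>. X \<omega> \<partial>Q)"
proof -
  interpret prob_space Q by (rule Q)
  have int: "integrable Q (\<lambda>\<omega>. f (Z \<omega>))" if Z: "integrable Q Z" "\<And>\<omega>. 0 \<le> Z \<omega>" for Z
  proof (rule Bochner_Integration.integrable_bound)
    show "integrable Q (\<lambda>\<omega>. f 1 * (1 + Z \<omega>))" using Z by simp
    show "(\<lambda>\<omega>. f (Z \<omega>)) \<in> borel_measurable Q" using Z by (intro measurable) auto
    show "AE \<omega> in Q. norm (f (Z \<omega>)) \<le> norm (f 1 * (1 + Z \<omega>))"
    proof (rule AE_I2)
      fix \<omega>
      show "norm (f (Z \<omega>)) \<le> norm (f 1 * (1 + Z \<omega>))"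
        using linear_growth[OF Z(2)[of \<omega>]] nonneg[OF Z(2)[of \<omega>]] by simp
    qed
  qed
  show "integrable Q (\<lambda>\<omega>. f (X \<omega>))" by (rule int[OF X])
  have *: "(\<integral>\<omega>. f (X \<omega>) \<partial>Q) \<le> f ((\<integral>\<omega>. X \<omega> \<partial>Q) + \<delta>)" if \<delta>: "\<delta> > 0" for \<delta>
  proof -
    have Z: "integrable Q (\<lambda>\<omega>. X \<omega> + \<delta>)" "\<And>\<omega>. 0 \<le> X \<omega> + \<delta>" using X \<delta>
      by (auto intro: add_nonneg_nonneg)
    have "(\<integral>\<omega>. f (X \<omega>) \<partial>Q) \<le> (\<integral>\<omega>. f (X \<omega> + \<delta>) \<partial>Q)"
      using X \<delta> by (intro integral_mono int[OF X] int[OF Z] mono) auto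
    moreover have "- f (\<integral>\<omega>. X \<omega> + \<delta> \<partial>Q) \<le> (\<integral>\<omega>. - f (X \<omega> + \<delta>) \<partial>Q)"
    proof (rule jensens_inequality[where I = "{0<..}" and q = "\<lambda>u. - f u"])
      show "AE \<omega> in Q. X \<omega> + \<delta> \<in> {0<..}" using X(2) \<delta> by (auto intro: add_nonneg_pos)
      show "convex_on {0<..} (\<lambda>u. - f u)"
        using concave unfolding concave_on_def by (rule convex_on_subset) auto
      show "integrable Q (\<lambda>\<omega>. - f (X \<omega> + \<delta>))" using int[OF Z] by simp
    qed (use Z in auto)
    moreover have "(\<integral>\<omega>. X \<omega> + \<delta> \<partial>Q) = (\<integral>\<omega>. X \<omega> \<partial>Q) + \<delta>" using X by (simp add: prob_space)
    ultimately show ?thesis by simp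
  qed
  have EX: "0 \<le> (\<integral>\<omega>. X \<omega> \<partial>Q)" using X by simp
  have "((\<lambda>n. (\<integral>\<omega>. X \<omega> \<partial>Q) + 1 / real (Suc n)) \<longlonglongrightarrow> (\<integral>\<omega>. X \<omega> \<partial>Q) + 0)"
    using LIMSEQ_inverse_real_of_nat by (intro tendsto_intros) (simp add: inverse_eq_divide)
  then have "(\<lambda>n. f ((\<integral>\<omega>. X \<omega> \<partial>Q) + 1 / real (Suc n))) \<longlonglongrightarrow> f ((\<integral>\<omega>. X \<omega> \<partial>Q) + 0)"
    using EX by (intro tendsto) auto
  then have "(\<integral>\<omega>. f (X \<omega>) \<partial>Q) \<le> f ((\<integral>\<omega>. X \<omega> \<partial>Q) + 0)"
  proof (rule LIMSEQ_le_const)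
    show "\<exists>N. \<forall>n\<ge>N. (\<integral>\<omega>. f (X \<omega>) \<partial>Q) \<le> f ((\<integral>\<omega>. X \<omega> \<partial>Q) + 1 / real (Suc n))"
      by (intro exI[of _ 0] allI impI *) simp
  qed
  then show "(\<integral>\<omega>. f (X \<omega>) \<partial>Q) \<le> f (\<integral>\<omega>. X \<omega> \<partial>Q)" by simp
qed

text \<open>Fubini exchanges expectation and time integral, and Jensen moves the expectation into
  \<open>f\<close>. \<open>Z\<close> is the random distance of positions and \<open>e\<close> the
  deterministic distance of flows. With the identity as modulus the same lemma yields moment
  bounds.\<close>

lemma expectation_kernel_le:
  fixes Z :: "real \<Rightarrow> 'w \<Rightarrow> real" and h e :: "real \<Rightarrow> real"
  assumes Q: "prob_space Q" and Z: "(\<lambda>z. Z (fst z) (snd z)) \<in> borel_measurable (borel \<Otimes>\<^sub>M Q)"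
    "\<And>s \<omega>. 0 \<le> Z s \<omega>" "\<And>s \<omega>. Z s \<omega> \<le> W \<omega>" "integrable Q W"
    and h: "integrable lborel h" "\<And>s. 0 \<le> h s"
    and e: "e \<in> borel_measurable borel" "\<And>s. 0 \<le> e s" "\<And>s. e s \<le> R"
  shows "(\<lambda>s. \<integral>\<omega>. Z s \<omega> \<partial>Q) \<in> borel_measurable borel"
    "integrable Q (\<lambda>\<omega>. LINT s:{0..t}|lborel. h s * f (Z s \<omega> + e s))"
    "(\<integral>\<omega>. (LINT s:{0..t}|lborel. h s * f (Z s \<omega> + e s)) \<partial>Q)
      \<le> (LINT s:{0..t}|lborel. h s * f ((\<integral>\<omega>. Z s \<omega> \<partial>Q) + e s))"
proof -
  interpret prob_space Q by (rule Q)
  note bm = borel_measurable_lebesgue_integral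
  interpret pair_sigma_finite lborel Q ..
  show Dm: "(\<lambda>s. \<integral>\<omega>. Z s \<omega> \<partial>Q) \<in> borel_measurable borel"
    using bm[of "\<lambda>s \<omega>. Z s \<omega>" borel] Z(1) by (simp add: split_beta')
  have Zs: "integrable Q (Z s)" for s
  proof (rule Bochner_Integration.integrable_bound[OF Z(4)])
    show "Z s \<in> borel_measurable Q"
      using measurable_compose[OF measurable_Pair1' Z(1), of s] by simp
    show "AE \<omega> in Q. norm (Z s \<omega>) \<le> norm (W \<omega>)" using Z(2,3) order_trans[OF Z(2,3)] by auto
  qed
  have D: "0 \<le> (\<integral>\<omega>. Z s \<omega> \<partial>Q)" "(\<integral>\<omega>. Z s \<omega> \<partial>Q) \<le> (\<integral>\<omega>. W \<omega> \<partial>Q)" for s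
    using Z(2,3) by (auto intro!: integral_mono Zs Z(4))
  define g where "g s \<omega> = indicator {0..t} s *\<^sub>R (h s * f (Z s \<omega> + e s))" for s \<omega>
  have "(\<lambda>z. Z (fst z) (snd z) + e (fst z)) \<in> borel_measurable (borel \<Otimes>\<^sub>M Q)" using Z(1) e(1)
    by measurable
  then have "(\<lambda>z. f (Z (fst z) (snd z) + e (fst z))) \<in> borel_measurable (borel \<Otimes>\<^sub>M Q)"
    using Z(2) e(2) by (intro measurable) auto
  then have "(\<lambda>z. indicator {0..t} (fst z) *\<^sub>R (h (fst z) * f (Z (fst z) (snd z) + e (fst z)))) \<in>
    borel_measurable (borel \<Otimes>\<^sub>M Q)"
    using h(1) by measurable
  then have gm: "(\<lambda>(s, \<omega>). g s \<omega>) \<in> borel_measurable (lborel \<Otimes>\<^sub>M Q)"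
    unfolding g_def split_beta' by (simp cong: measurable_cong_sets sets_pair_measure_cong)
  have Ze: "integrable Q (\<lambda>\<omega>. Z s \<omega> + e s)" "\<And>\<omega>. 0 \<le> Z s \<omega> + e s" for s
    using Zs Z(2) e(2) by (auto intro: add_nonneg_nonneg)
  note J = jensen[OF Q Ze]
  have EZe: "(\<integral>\<omega>. Z s \<omega> + e s \<partial>Q) = (\<integral>\<omega>. Z s \<omega> \<partial>Q) + e s" for s
    using Zs by (simp add: prob_space)
  have gs: "integrable Q (g s)" for s
    unfolding g_def by (intro integrable_scaleR_right integrable_mult_right J)
  have g0: "0 \<le> g s \<omega>" for s \<omega>
    unfolding g_def using h(2) nonneg[OF Ze(2)] by simp
  have Eg: "(\<integral>\<omega>. g s \<omega> \<partial>Q) \<le> indicator {0..t} s *\<^sub>R (h s * f ((\<integral>\<omega>. Z s \<omega> \<partial>Q) + e s))" for s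
    unfolding g_def integral_scaleR_right integral_mult_right_zero EZe[symmetric]
    using J(2) h(2) by (auto simp: indicator_def intro!: mult_left_mono)
  have rhs: "integrable lborel (\<lambda>s. indicator {0..t} s *\<^sub>R (h s * f ((\<integral>\<omega>. Z s \<omega> \<partial>Q) + e s)))"
    using D e Dm
    by (intro integrable_mult_indicator integrable_kernel[OF h(1), where R = "(\<integral>\<omega>. W \<omega> \<partial>Q) + R"])
      (auto intro!: add_mono add_nonneg_nonneg)
  have gEm: "(\<lambda>s. \<integral>\<omega>. g s \<omega> \<partial>Q) \<in> borel_measurable lborel"
    by (rule bm[OF gm])
  \<comment> \<open>Jensen's bound \<open>Eg\<close> does double duty: the inner integrals of the
    nonnegative \<open>g\<close> are dominated by the integrable right-hand side, which is what
    integrability on the product requires.\<close>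
  have gint: "integrable (lborel \<Otimes>\<^sub>M Q) (\<lambda>(s, \<omega>). g s \<omega>)"
  proof (rule Fubini_integrable[OF gm])
    show "AE s in lborel. integrable Q (\<lambda>\<omega>. case (s, \<omega>) of (s, \<omega>) \<Rightarrow> g s \<omega>)" using gs by simp
    show "integrable lborel (\<lambda>s. \<integral>\<omega>. norm (case (s, \<omega>) of (s, \<omega>) \<Rightarrow> g s \<omega>) \<partial>Q)"
    proof (rule Bochner_Integration.integrable_bound[OF rhs])
      show "(\<lambda>s. \<integral>\<omega>. norm (case (s, \<omega>) of (s, \<omega>) \<Rightarrow> g s \<omega>) \<partial>Q) \<in> borel_measurable lborel"
        using gEm g0 by simp
      show "AE s in lborel. norm (\<integral>\<omega>. norm (case (s, \<omega>) of (s, \<omega>) \<Rightarrow> g s \<omega>) \<partial>Q)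
          \<le> norm (indicator {0..t} s *\<^sub>R (h s * f ((\<integral>\<omega>. Z s \<omega> \<partial>Q) + e s)))"
      proof (rule AE_I2)
        fix s
        have 1: "(\<integral>\<omega>. norm (case (s, \<omega>) of (s, \<omega>) \<Rightarrow> g s \<omega>) \<partial>Q) = (\<integral>\<omega>. g s \<omega> \<partial>Q)"
          using g0 by simp
        have "0 \<le> (\<integral>\<omega>. g s \<omega> \<partial>Q)" using g0 by simp
        then show "norm (\<integral>\<omega>. norm (case (s, \<omega>) of (s, \<omega>) \<Rightarrow> g s \<omega>) \<partial>Q)
          \<le> norm (indicator {0..t} s *\<^sub>R (h s * f ((\<integral>\<omega>. Z s \<omega> \<partial>Q) + e s)))"
          unfolding 1 using Eg[of s] unfolding real_norm_def by linarith
      qed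
    qed
  qed
  have inner: "(LINT s:{0..t}|lborel. h s * f (Z s \<omega> + e s)) = (\<integral>s. g s \<omega> \<partial>lborel)" for \<omega>
    unfolding set_lebesgue_integral_def g_def ..
  show "integrable Q (\<lambda>\<omega>. LINT s:{0..t}|lborel. h s * f (Z s \<omega> + e s))"
    unfolding inner by (rule integrable_snd[OF gint])
  have "(\<integral>\<omega>. (LINT s:{0..t}|lborel. h s * f (Z s \<omega> + e s)) \<partial>Q) = (\<integral>s. (\<integral>\<omega>. g s \<omega> \<partial>Q) \<partial>lborel)"
    unfolding inner by (rule Fubini_integral[OF gint])
  also have "\<dots> \<le> (\<integral>s. indicator {0..t} s *\<^sub>R (h s * f ((\<integral>\<omega>. Z s \<omega> \<partial>Q) + e s)) \<partial>lborel)"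
    by (rule integral_mono[OF integrable_fst[OF gint] rhs Eg])
  finally show "(\<integral>\<omega>. (LINT s:{0..t}|lborel. h s * f (Z s \<omega> + e s)) \<partial>Q)
      \<le> (LINT s:{0..t}|lborel. h s * f ((\<integral>\<omega>. Z s \<omega> \<partial>Q) + e s))"
    unfolding set_lebesgue_integral_def .
qed

end

lemma integrable_norm_of_P1:
  assumes "X \<in> measurable P (borel_on E)" "distr P (borel_on E) X \<in> P1 E"
  shows "integrable P (\<lambda>\<omega>. norm (X \<omega>))"
  using integrable_distr_eq[OF assms(1) norm_measurable_on] P1D(4)[OF assms(2)] by simp

lemma norm_diff_measurable:
  fixes X X' :: "'w \<Rightarrow> ('d::finite) path"
  assumes "X \<in> measurable Q (borel_on (paths T))" "X' \<in> measurable Q (borel_on (paths T))"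
  shows "(\<lambda>\<omega>. norm (X \<omega> - X' \<omega>)) \<in> borel_measurable Q"
  using measurable_compose[OF measurable_Pair[OF assms]
    dist_measurable_on[OF small_partitions_paths]]
  by (simp add: dist_norm)

lemma integrable_norm_diff:
  fixes X X' :: "'w \<Rightarrow> ('d::finite) path"
  assumes X: "X \<in> measurable Q (borel_on (paths T))" "X' \<in> measurable Q (borel_on (paths T))"
    and int: "integrable Q (\<lambda>\<omega>. norm (X \<omega>))" "integrable Q (\<lambda>\<omega>. norm (X' \<omega>))"
  shows "integrable Q (\<lambda>\<omega>. norm (X \<omega> - X' \<omega>))"
proof (rule Bochner_Integration.integrable_bound)
  show "integrable Q (\<lambda>\<omega>. norm (X \<omega>) + norm (X' \<omega>))" using int by simp
  show "AE \<omega> in Q. norm (norm (X \<omega> - X' \<omega>)) \<le> norm (norm (X \<omega>) + norm (X' \<omega>))"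
    by (simp add: norm_triangle_ineq4)
qed (rule norm_diff_measurable[OF X])

lemma marginal_comp:
  assumes "Y \<in> measurable P N" "X \<in> measurable N (borel_on (paths T))"
  shows "marginal (distr P N Y) X s = marginal P (\<lambda>\<omega>. X (Y \<omega>)) s"
  unfolding marginal_def using measurable_compose[OF assms(2) apply_bcontfun_measurable, of s]
  by (subst distr_distr[OF _ assms(1)]) (simp_all add: comp_def)

lemma marginal_cong_AE:
  assumes "X \<in> measurable P (borel_on (paths T))" "X' \<in> measurable P (borel_on (paths T))"
    and "AE \<omega> in P. X \<omega> = X' \<omega>"
  shows "marginal P X s = marginal P X' s"
  unfolding marginal_def
proof (rule distr_cong_AE)
  show "AE \<omega> in P. apply_bcontfun (X \<omega>) s = apply_bcontfun (X' \<omega>) s"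
    using assms(3) by eventually_elim simp
qed (simp_all add: measurable_compose[OF assms(1) apply_bcontfun_measurable]
    measurable_compose[OF assms(2) apply_bcontfun_measurable])

lemma mean_distance:
  fixes X X' :: "'w \<Rightarrow> ('d::finite) path"
  assumes Q: "prob_space Q"
    and X: "X \<in> measurable Q (borel_on (paths T))" "X' \<in> measurable Q (borel_on (paths T))"
    and int: "integrable Q (\<lambda>\<omega>. norm (X \<omega>))" "integrable Q (\<lambda>\<omega>. norm (X' \<omega>))"
  defines "D \<equiv> \<lambda>s. \<integral>\<omega>. norm (apply_bcontfun (X \<omega>) s - apply_bcontfun (X' \<omega>) s) \<partial>Q"
  shows "D \<in> borel_measurable borel" "0 \<le> D s"
    "D s \<le> (\<integral>\<omega>. norm (X \<omega>) \<partial>Q) + (\<integral>\<omega>. norm (X' \<omega>) \<partial>Q)"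
    "integrable Q (\<lambda>\<omega>. norm (apply_bcontfun (X \<omega>) s - apply_bcontfun (X' \<omega>) s))"
proof -
  interpret prob_space Q by (rule Q)
  have "(\<lambda>z. norm (apply_bcontfun (X (snd z)) (fst z) - apply_bcontfun (X' (snd z)) (fst z)))
      \<in> borel_measurable (borel \<Otimes>\<^sub>M Q)"
    using path_jointly_measurable[OF X(1)] path_jointly_measurable[OF X(2)] by measurable
  then show "D \<in> borel_measurable borel"
    unfolding D_def
    using borel_measurable_lebesgue_integral[of
      "\<lambda>s \<omega>. norm (apply_bcontfun (X \<omega>) s - apply_bcontfun (X' \<omega>) s)" borel]
    by (simp add: split_beta')
  show "0 \<le> D s" by (simp add: D_def)
  have le: "norm (apply_bcontfun (X \<omega>) s - apply_bcontfun (X' \<omega>) s) \<le> norm (X \<omega>) + norm (X' \<omega>)"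
    for \<omega>
    using norm_triangle_ineq4[of "apply_bcontfun (X \<omega>) s" "apply_bcontfun (X' \<omega>) s"]
      norm_apply_le[of "X \<omega>" s] norm_apply_le[of "X' \<omega>" s] by linarith
  have W: "integrable Q (\<lambda>\<omega>. norm (X \<omega>) + norm (X' \<omega>))" using int by simp
  show i: "integrable Q (\<lambda>\<omega>. norm (apply_bcontfun (X \<omega>) s - apply_bcontfun (X' \<omega>) s))"
  proof (rule Bochner_Integration.integrable_bound[OF W])
    show "(\<lambda>\<omega>. norm (apply_bcontfun (X \<omega>) s - apply_bcontfun (X' \<omega>) s)) \<in> borel_measurable Q"
      using measurable_compose[OF X(1) apply_bcontfun_measurable[of s]]
        measurable_compose[OF X(2) apply_bcontfun_measurable[of s]] by measurable
  qed (use le in simp)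
  have "D s \<le> (\<integral>\<omega>. norm (X \<omega>) + norm (X' \<omega>) \<partial>Q)"
    unfolding D_def by (rule integral_mono[OF i W le])
  then show "D s \<le> (\<integral>\<omega>. norm (X \<omega>) \<partial>Q) + (\<integral>\<omega>. norm (X' \<omega>) \<partial>Q)" using int by simp
qed

section \<open>Stability of weak solutions with respect to the input\<close>

context mckean
begin

text \<open>The bound \<open>e\<close> on the distance of flows is left free: stability in law takes
  \<open>e = D\<close>, Picard iteration takes the mean distance of the preceding iterates. The
  first estimate is the one that is closed, in terms of means at single times; the second then
  controls the mean of the supremum norm.\<close>

lemma expectation_diff_le:
  fixes X X' Y Y' :: "'w \<Rightarrow> 'd path"
  assumes Q: "prob_space Q"
    and X: "X \<in> measurable Q (borel_on (paths T))" "X' \<in> measurable Q (borel_on (paths T))"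
    and int: "integrable Q (\<lambda>\<omega>. norm (X \<omega>))" "integrable Q (\<lambda>\<omega>. norm (X' \<omega>))"
      "integrable Q (\<lambda>\<omega>. norm (Y \<omega> - Y' \<omega>))"
    and m: "admissible T m" "admissible T m'"
    and e: "e \<in> borel_measurable borel" "\<And>s. 0 \<le> e s" "\<And>s. e s \<le> R"
    and me: "\<And>s. s \<in> {0..T} \<Longrightarrow> d1 (m s) (m' s) \<le> e s"
    and sol: "AE \<omega> in Q. solves_equation T B m (X \<omega>) (Y \<omega>) \<and> solves_equation T B m' (X' \<omega>) (Y' \<omega>)"
  defines "D \<equiv> \<lambda>s. \<integral>\<omega>. norm (apply_bcontfun (X \<omega>) s - apply_bcontfun (X' \<omega>) s) \<partial>Q"
  shows "0 \<le> t \<Longrightarrow> t \<le> T \<Longrightarrow>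
      D t \<le> (\<integral>\<omega>. norm (Y \<omega> - Y' \<omega>) \<partial>Q) + (LINT s:{0..t}|lborel. h s * f (D s + e s))"
    "(\<integral>\<omega>. norm (X \<omega> - X' \<omega>) \<partial>Q)
      \<le> (\<integral>\<omega>. norm (Y \<omega> - Y' \<omega>) \<partial>Q) + (LINT s:{0..T}|lborel. h s * f (D s + e s))"
proof -
  interpret prob_space Q by (rule Q)
  define Z where "Z s \<omega> = norm (apply_bcontfun (X \<omega>) s - apply_bcontfun (X' \<omega>) s)" for s \<omega>
  define W where "W \<omega> = norm (X \<omega>) + norm (X' \<omega>)" for \<omega>
  have Zm: "(\<lambda>z. Z (fst z) (snd z)) \<in> borel_measurable (borel \<Otimes>\<^sub>M Q)"
    unfolding Z_def using path_jointly_measurable[OF X(1)] path_jointly_measurable[OF X(2)]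
      by measurable
  have Z0: "0 \<le> Z s \<omega>" for s \<omega> by (simp add: Z_def)
  have ZW: "Z s \<omega> \<le> W \<omega>" for s \<omega>
    using norm_triangle_ineq4[of "apply_bcontfun (X \<omega>) s" "apply_bcontfun (X' \<omega>) s"]
      norm_apply_le[of "X \<omega>" s] norm_apply_le[of "X' \<omega>" s] unfolding Z_def W_def by linarith
  have W: "integrable Q W" unfolding W_def using int by simp
  have DZ: "D = (\<lambda>s. \<integral>\<omega>. Z s \<omega> \<partial>Q)" by (simp add: D_def Z_def)
  note K = expectation_kernel_le[OF Q Zm Z0 ZW W h e]
  have Zi: "integrable Q (Z s)" for s
    using mean_distance(4)[OF Q X int(1,2)] unfolding Z_def .
  have pathwise: "AE \<omega> in Q. \<forall>t. 0 \<le> t \<longrightarrow> t \<le> T \<longrightarrow>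
      Z t \<omega> \<le> norm (Y \<omega> - Y' \<omega>) + (LINT s:{0..t}|lborel. h s * f (Z s \<omega> + e s))"
    using sol
  proof eventually_elim
    case (elim \<omega>)
    then show ?case
      unfolding Z_def using solution_diff_le[OF m e me] by blast
  qed
  show "D t \<le> (\<integral>\<omega>. norm (Y \<omega> - Y' \<omega>) \<partial>Q) + (LINT s:{0..t}|lborel. h s * f (D s + e s))"
    if t: "0 \<le> t" "t \<le> T" for t
  proof -
    have "D t \<le> (\<integral>\<omega>. norm (Y \<omega> - Y' \<omega>) + (LINT s:{0..t}|lborel. h s * f (Z s \<omega> + e s)) \<partial>Q)"
      unfolding DZ
    proof (rule integral_mono_AE[OF Zi])
      show "integrable Q (\<lambda>\<omega>. norm (Y \<omega> - Y' \<omega>) + (LINT s:{0..t}|lborel. h s * f (Z s \<omega> + e s)))"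
        by (intro Bochner_Integration.integrable_add int(3) K(2))
      show "AE \<omega> in Q. Z t \<omega> \<le> norm (Y \<omega> - Y' \<omega>) + (LINT s:{0..t}|lborel. h s * f (Z s \<omega> + e s))"
        using pathwise by eventually_elim (use t in blast)
    qed
    also have "\<dots> = (\<integral>\<omega>. norm (Y \<omega> - Y' \<omega>) \<partial>Q) + (\<integral>\<omega>. (LINT s:{0..t}|lborel. h s * f (Z s \<omega> + e s))
      \<partial>Q)"
      by (rule Bochner_Integration.integral_add[OF int(3) K(2)])
    also have "\<dots> \<le> (\<integral>\<omega>. norm (Y \<omega> - Y' \<omega>) \<partial>Q) + (LINT s:{0..t}|lborel. h s * f (D s + e s))"
      unfolding DZ by (intro add_left_mono K(3))
    finally show ?thesis .
  qed
  \<comment> \<open>The right-hand side grows with the time, so its value at \<open>T\<close> bounds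
    the supremum over all times before the expectation is taken.\<close>
  have "AE \<omega> in Q. norm (X \<omega> - X' \<omega>)
      \<le> norm (Y \<omega> - Y' \<omega>) + (LINT s:{0..T}|lborel. h s * f (Z s \<omega> + e s))"
    using pathwise AE_space
  proof eventually_elim
    case (elim \<omega>)
    have p: "X \<omega> \<in> paths T" "X' \<omega> \<in> paths T"
      using measurable_space[OF X(1) elim(2)] measurable_space[OF X(2) elim(2)] by simp_all
    have meas: "(\<lambda>s. Z s \<omega> + e s) \<in> borel_measurable borel"
      unfolding Z_def using apply_borel_measurable[of "X \<omega>"] apply_borel_measurable[of "X' \<omega>"]
        e(1) by measurable
    have bnd: "0 \<le> Z s \<omega> + e s" "Z s \<omega> + e s \<le> W \<omega> + R" for s
      using Z0 e(2) ZW e(3) by (auto intro: add_nonneg_nonneg add_mono)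
    show ?case
    proof (rule dist_path_le[OF less_imp_le[OF T] p])
      fix t assume t: "0 \<le> t" "t \<le> T"
      have "Z t \<omega> \<le> norm (Y \<omega> - Y' \<omega>) + (LINT s:{0..t}|lborel. h s * f (Z s \<omega> + e s))"
        using elim(1) t by blast
      also have "(LINT s:{0..t}|lborel. h s * f (Z s \<omega> + e s))
        \<le> (LINT s:{0..T}|lborel. h s * f (Z s \<omega> + e s))"
        by (rule kernel_mono[OF h meas bnd meas bnd _ t(2)]) simp
      finally show "norm (apply_bcontfun (X \<omega>) t - apply_bcontfun (X' \<omega>) t)
          \<le> norm (Y \<omega> - Y' \<omega>) + (LINT s:{0..T}|lborel. h s * f (Z s \<omega> + e s))"
        by (simp add: Z_def)
    qed
  qed
  then have "(\<integral>\<omega>. norm (X \<omega> - X' \<omega>) \<partial>Q)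
      \<le> (\<integral>\<omega>. norm (Y \<omega> - Y' \<omega>) + (LINT s:{0..T}|lborel. h s * f (Z s \<omega> + e s)) \<partial>Q)"
    by (intro integral_mono_AE integrable_norm_diff[OF X int(1,2)]
      Bochner_Integration.integrable_add int(3) K(2))
  also have "\<dots> = (\<integral>\<omega>. norm (Y \<omega> - Y' \<omega>) \<partial>Q) + (\<integral>\<omega>. (LINT s:{0..T}|lborel. h s * f (Z s \<omega> + e s))
    \<partial>Q)"
    by (rule Bochner_Integration.integral_add[OF int(3) K(2)])
  also have "\<dots> \<le> (\<integral>\<omega>. norm (Y \<omega> - Y' \<omega>) \<partial>Q) + (LINT s:{0..T}|lborel. h s * f (D s + e s))"
    unfolding DZ by (intro add_left_mono K(3))
  finally show "(\<integral>\<omega>. norm (X \<omega> - X' \<omega>) \<partial>Q)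
      \<le> (\<integral>\<omega>. norm (Y \<omega> - Y' \<omega>) \<partial>Q) + (LINT s:{0..T}|lborel. h s * f (D s + e s))" .
qed

text \<open>Pathwise uniqueness identifies X with \<open>flow_map m\<close> applied to Y almost
  surely. The law of X and the fixed point property of \<open>m\<close> are thereby expressed
  through \<open>\<mu>Y\<close> alone, and can be carried to any space on which the input has this
  law.\<close>

lemma weak_solution_flow:
  fixes X Y :: "'w \<Rightarrow> 'd path"
  assumes w: "weak_solution T B \<mu>Y P X Y" and \<mu>Y: "\<mu>Y \<in> P1 (paths T)"
  defines "m \<equiv> marginal P X"
  shows "prob_space P" "X \<in> measurable P (borel_on (paths T))" "integrable P (\<lambda>\<omega>. norm (X \<omega>))"
    "admissible T m" "distr P (borel_on (paths T)) X = distr \<mu>Y (borel_on (paths T)) (flow_map m)"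
    "marginal \<mu>Y (flow_map m) s = m s" "distr P (borel_on (paths T)) X \<in> P1 (paths T)"
proof -
  note w' = w[unfolded weak_solution_def Let_def, folded marginal_def[abs_def]]
  show P: "prob_space P" and X: "X \<in> measurable P (borel_on (paths T))"
    using w' by auto
  have Y: "Y \<in> measurable P (borel_on (paths T))" and dY: "distr P (borel_on (paths T)) Y = \<mu>Y"
    using w' by auto
  interpret prob_space P by (rule P)
  have mP: "m s \<in> P1 UNIV" if "s \<in> {0..T}" for s
    using w' that unfolding m_def marginal_def by blast
  obtain C where C: "\<And>s. s \<in> {0..T} \<Longrightarrow> norm1 (m s) \<le> C"
    using w' unfolding m_def marginal_def bdd_above_def by blast
  have sol: "AE \<omega> in P. solves_equation T B m (X \<omega>) (Y \<omega>)"
    using w' unfolding m_def marginal_def[abs_def] by blast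
  have sp: "X \<omega> \<in> paths T" "Y \<omega> \<in> paths T" if "\<omega> \<in> space P" for \<omega>
    using measurable_space[OF X that] measurable_space[OF Y that] by simp_all
  obtain D where D: "\<And>x y. x \<in> paths T \<Longrightarrow> solves_equation T B m x y \<Longrightarrow> norm x \<le> D * (1 + norm y)"
  proof -
    have "\<exists>D. \<forall>x y. x \<in> paths T \<longrightarrow> solves_equation T B m x y \<longrightarrow> norm x \<le> D * (1 + norm y)"
      by (rule solution_growth[of m C]) (use mP C in \<open>blast+\<close>)
    then show ?thesis using that by blast
  qed
  have intY: "integrable P (\<lambda>\<omega>. norm (Y \<omega>))"
    by (rule integrable_norm_of_P1[OF Y]) (simp only: dY \<mu>Y)
  show int: "integrable P (\<lambda>\<omega>. norm (X \<omega>))"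
  proof (rule Bochner_Integration.integrable_bound)
    show "integrable P (\<lambda>\<omega>. D * (1 + norm (Y \<omega>)))" using intY by simp
    show "(\<lambda>\<omega>. norm (X \<omega>)) \<in> borel_measurable P"
      by (rule measurable_compose[OF X norm_measurable_on])
    show "AE \<omega> in P. norm (norm (X \<omega>)) \<le> norm (D * (1 + norm (Y \<omega>)))"
      using sol AE_space
    proof eventually_elim
      case (elim \<omega>)
      have "norm (X \<omega>) \<le> D * (1 + norm (Y \<omega>))" by (rule D[OF sp(1)[OF elim(2)] elim(1)])
      then show ?case by simp
    qed
  qed
  show adm: "admissible T m" unfolding m_def by (rule admissible_marginal[OF P X int])
  note \<Phi>m = flow_map_measurable[OF adm]
  have \<Phi>Y: "(\<lambda>\<omega>. flow_map m (Y \<omega>)) \<in> measurable P (borel_on (paths T))"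
    by (rule measurable_compose[OF Y \<Phi>m])
  have ae: "AE \<omega> in P. X \<omega> = flow_map m (Y \<omega>)"
    using sol AE_space
  proof eventually_elim
    case (elim \<omega>)
    show ?case using flow_map_eqI[OF adm sp(2)[OF elim(2)] sp(1)[OF elim(2)] elim(1)] by simp
  qed
  have "distr P (borel_on (paths T)) X = distr P (borel_on (paths T)) (\<lambda>\<omega>. flow_map m (Y \<omega>))"
    by (rule distr_cong_AE[OF refl refl ae X \<Phi>Y])
  also have "\<dots> = distr \<mu>Y (borel_on (paths T)) (flow_map m)"
    unfolding dY[symmetric] using distr_distr[OF \<Phi>m Y] by (simp add: comp_def)
  finally show "distr P (borel_on (paths T)) X = distr \<mu>Y (borel_on (paths T)) (flow_map m)" .
  have "marginal \<mu>Y (flow_map m) s = marginal P (\<lambda>\<omega>. flow_map m (Y \<omega>)) s"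
    unfolding dY[symmetric] by (rule marginal_comp[OF Y \<Phi>m])
  also have "\<dots> = m s"
    unfolding m_def by (rule marginal_cong_AE[OF X \<Phi>Y[unfolded m_def] ae[unfolded m_def],
      symmetric])
  finally show "marginal \<mu>Y (flow_map m) s = m s" .
  show "distr P (borel_on (paths T)) X \<in> P1 (paths T)" by (rule distr_in_P1[OF P X int])
qed

text \<open>The two sample types are independent of each other: in the application one solution
  lives on particle indices and the other on pairs of paths. The bound is shown for every
  \<open>r\<close> above the distance of the inputs, each with its own coupling, and then
  \<open>r\<close> decreases.\<close>

theorem weak_solution_stability:
  fixes X Y :: "'v \<Rightarrow> 'd path" and X' Y' :: "'w \<Rightarrow> 'd path"
  assumes w: "weak_solution T B \<mu> P X Y" "weak_solution T B \<mu>' P' X' Y'"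
    and \<mu>: "\<mu> \<in> P1 (paths T)" "\<mu>' \<in> P1 (paths T)"
  shows "d1 (distr P (borel_on (paths T)) X) (distr P' (borel_on (paths T)) X')
    \<le> (if d1 \<mu> \<mu>' = 0 then 0 else inv_into {0<..} G (G (d1 \<mu> \<mu>') + 2 * (LINT s|lborel. h s)))"
proof -
  define m where "m = marginal P X"
  define m' where "m' = marginal P' X'"
  note F = weak_solution_flow[OF w(1) \<mu>(1), folded m_def]
    and F' = weak_solution_flow[OF w(2) \<mu>(2), folded m'_def]
  note P = P1D(1)[OF \<mu>(1)] P1D(1)[OF \<mu>(2)]
  note \<Phi> = flow_map_measurable[OF F(4)] flow_map_measurable[OF F'(4)]
  have \<Phi>\<mu>: "flow_map m \<in> measurable \<mu> (borel_on (paths T))"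
    "flow_map m' \<in> measurable \<mu>' (borel_on (paths T))"
    using \<Phi> P1D(2)[OF \<mu>(1)] P1D(2)[OF \<mu>(2)] by (simp_all cong: measurable_cong_sets)
  let ?L = "distr P (borel_on (paths T)) X" and ?L' = "distr P' (borel_on (paths T)) X'"
  show ?thesis
  proof (rule le_osgood_M_of_approx)
    show "0 \<le> d1 \<mu> \<mu>'" using P by (rule d1_nonneg)
    show "0 \<le> d1 ?L ?L'" using P1D(1)[OF F(7)] P1D(1)[OF F'(7)] by (rule d1_nonneg)
    fix r assume r: "d1 \<mu> \<mu>' < r"
    then have r0: "0 < r" using d1_nonneg[OF P] by simp
    obtain \<pi> where \<pi>: "\<pi> \<in> couplings \<mu> \<mu>'" "(\<integral>z. dist (fst z) (snd z) \<partial>\<pi>) < r"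
      using d1_less[OF r P] by blast
    note \<pi>m = couplings_measurable(1,2)[OF \<pi>(1)]
    have d\<pi>: "distr \<pi> \<mu> fst = \<mu>" "distr \<pi> \<mu>' snd = \<mu>'" using \<pi>(1) by (auto simp: couplings_def)
    have \<pi>P: "prob_space \<pi>" by (rule couplings_prob[OF \<pi>(1) P(1)])
    have sp: "fst z \<in> paths T" "snd z \<in> paths T" if "z \<in> space \<pi>" for z
      using that unfolding couplings_space_P1[OF \<pi>(1) \<mu>] by auto
    define V where "V z = flow_map m (fst z)" for z :: "'d path \<times> 'd path"
    define V' where "V' z = flow_map m' (snd z)" for z :: "'d path \<times> 'd path"
    have V: "V \<in> measurable \<pi> (borel_on (paths T))" "V' \<in> measurable \<pi> (borel_on (paths T))"
      unfolding V_def V'_def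
      by (rule measurable_compose[OF \<pi>m(1) \<Phi>\<mu>(1)], rule measurable_compose[OF \<pi>m(2) \<Phi>\<mu>(2)])
    have "distr \<pi> (borel_on (paths T)) V = distr (distr \<pi> \<mu> fst) (borel_on (paths T)) (flow_map m)"
      unfolding V_def by (subst distr_distr[OF \<Phi>\<mu>(1) \<pi>m(1)]) (simp add: comp_def)
    then have dV: "distr \<pi> (borel_on (paths T)) V = ?L" using d\<pi>(1) F(5) by simp
    have "distr \<pi> (borel_on (paths T)) V' = distr (distr \<pi> \<mu>' snd) (borel_on (paths T))
      (flow_map m')"
      unfolding V'_def by (subst distr_distr[OF \<Phi>\<mu>(2) \<pi>m(2)]) (simp add: comp_def)
    then have dV': "distr \<pi> (borel_on (paths T)) V' = ?L'" using d\<pi>(2) F'(5) by simp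
    have mV: "marginal \<pi> V s = m s" for s
      using marginal_comp[OF \<pi>m(1) \<Phi>\<mu>(1), of s] unfolding d\<pi>(1) F(6) V_def by simp
    have mV': "marginal \<pi> V' s = m' s" for s
      using marginal_comp[OF \<pi>m(2) \<Phi>\<mu>(2), of s] unfolding d\<pi>(2) F'(6) V'_def by simp
    have intV: "integrable \<pi> (\<lambda>z. norm (V z))" "integrable \<pi> (\<lambda>z. norm (V' z))"
      by (rule integrable_norm_of_P1[OF V(1)], simp only: dV F(7))
        (rule integrable_norm_of_P1[OF V(2)], simp only: dV' F'(7))
    have intY: "integrable \<pi> (\<lambda>z. norm (fst z - snd z))"
      using dist_coupling(2)[OF small_partitions_paths \<mu> \<pi>(1)] by (simp add: dist_norm)
    define D where "D s = (\<integral>z. norm (apply_bcontfun (V z) s - apply_bcontfun (V' z) s) \<partial>\<pi>)" for s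
    define R where "R = (\<integral>z. norm (V z) \<partial>\<pi>) + (\<integral>z. norm (V' z) \<partial>\<pi>)"
    have sol: "AE z in \<pi>. solves_equation T B m (V z) (fst z) \<and> solves_equation T B m' (V' z)
      (snd z)"
      using flow_map(2)[OF F(4) sp(1)] flow_map(2)[OF F'(4) sp(2)]
        by (intro AE_I2) (auto simp: V_def V'_def)
    have dD: "d1 (m s) (m' s) \<le> D s" for s
      using d1_marginal_le[OF \<pi>P V, of s s] by (simp add: mV mV' D_def)
    have D: "D \<in> borel_measurable borel" "\<And>s. 0 \<le> D s" "\<And>s. D s \<le> R"
      unfolding D_def R_def by (rule mean_distance[OF \<pi>P V intV])+
    \<comment> \<open>The distance of the marginals is at most \<open>D\<close>, so
      \<open>e = D\<close> closes the inequality; the argument of \<open>f\<close> becomes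
      \<open>D s + D s\<close>.\<close>
    have DE: "0 \<le> t \<Longrightarrow> t \<le> T \<Longrightarrow>
        D t \<le> (\<integral>z. norm (fst z - snd z) \<partial>\<pi>) + (LINT s:{0..t}|lborel. h s * f (D s + D s))"
      "(\<integral>z. norm (V z - V' z) \<partial>\<pi>)
        \<le> (\<integral>z. norm (fst z - snd z) \<partial>\<pi>) + (LINT s:{0..T}|lborel. h s * f (D s + D s))" for t
      using expectation_diff_le[where e = D and R = R, OF \<pi>P V intV intY F(4) F'(4) D dD sol]
      by (simp_all only: D_def)
    define c where "c = (\<integral>z. norm (fst z - snd z) \<partial>\<pi>)"
    have cr: "c \<le> r" using \<pi>(2) by (simp add: c_def dist_norm)
    have twice: "(LINT s:{0..t}|lborel. h s * f (D s + D s))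
      \<le> (LINT s:{0..t}|lborel. 2 * h s * f (D s))" for t
    proof (rule set_integral_mono)
      show "set_integrable lborel {0..t} (\<lambda>s. h s * f (D s + D s))"
        using D by (intro set_integrable_lborelI integrable_kernel[OF h(1), where R = "R + R"])
          (auto intro: add_mono)
      show "set_integrable lborel {0..t} (\<lambda>s. 2 * h s * f (D s))"
        using D h(1) by (intro set_integrable_lborelI integrable_kernel[where R = R]) auto
      fix s
      have "h s * f (D s + D s) \<le> h s * (2 * f (D s))"
        using concave_add[OF D(2)[of s]] h(2) by (intro mult_left_mono) simp_all
      then show "h s * f (D s + D s) \<le> 2 * h s * f (D s)" by simp
    qed
    define v where "v = r + (LINT s:{0..T}|lborel. 2 * h s * f (D s))"
    have "G v \<le> G r + (LINT s|lborel. 2 * h s)"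
      unfolding v_def
    proof (rule bihari_le[where R = R])
      show "D t \<le> r + (LINT s:{0..t}|lborel. 2 * h s * f (D s))" if "0 \<le> t" "t \<le> T" for t
        using DE(1)[OF that] twice[of t] cr unfolding c_def by linarith
    qed (use h D r0 T in simp_all)
    moreover have "0 < v"
      unfolding v_def using h(2) D(2) nonneg r0
      by (intro add_pos_nonneg set_LINT_nonneg mult_nonneg_nonneg) simp_all
    ultimately have v: "v \<le> inv_into {0<..} G (G r + 2 * (LINT s|lborel. h s))"
      by (intro le_inv_into_G) simp_all
    have "d1 ?L ?L' \<le> (\<integral>z. dist (V z) (V' z) \<partial>\<pi>)"
      unfolding dV[symmetric] dV'[symmetric]
        by (rule d1_le_expectation[OF \<pi>P V small_partitions_paths])
    also have "\<dots> \<le> v"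
      using DE(2) twice[of T] cr unfolding c_def v_def dist_norm by linarith
    finally show "d1 ?L ?L' \<le> inv_into {0<..} G (G r + 2 * (LINT s|lborel. h s))" using v
      by linarith
  qed
qed

end

text \<open>Indicators of open sets are limits of bounded continuous functions built from the
  distance to the complement, and open sets determine a finite Borel measure.\<close>

lemma P1_eqI:
  fixes \<mu> \<nu> :: "'e::real_normed_vector measure"
  assumes P: "\<mu> \<in> P1 E" "\<nu> \<in> P1 E"
    and eq: "\<And>\<phi>::'e \<Rightarrow> real. continuous_on E \<phi> \<Longrightarrow> bounded (\<phi> ` E) \<Longrightarrow> (\<integral>x. \<phi> x \<partial>\<mu>) = (\<integral>x. \<phi> x \<partial>\<nu>)"
  shows "\<mu> = \<nu>"
proof -
  interpret \<mu>: prob_space \<mu> by (rule P1D(1)[OF P(1)])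
  interpret \<nu>: prob_space \<nu> by (rule P1D(1)[OF P(2)])
  have id: "(\<lambda>x. x) \<in> measurable (borel_on E) borel" by (rule measurable_restrict_space1) simp
  then have id\<mu>: "(\<lambda>x. x) \<in> measurable \<mu> borel" and id\<nu>: "(\<lambda>x. x) \<in> measurable \<nu> borel"
    using P1D(2)[OF P(1)] P1D(2)[OF P(2)] by (simp_all cong: measurable_cong_sets)
  \<comment> \<open>Both measures are pushed forward to the whole type, where the generator consists
    of all open sets rather than their traces on \<open>E\<close>.\<close>
  have "distr \<mu> borel (\<lambda>x. x) = distr \<nu> borel (\<lambda>x. x)"
  proof (rule measure_eqI_generator_eq[where E = "{U. open U}" and \<Omega> = UNIV and A = "\<lambda>_. UNIV"])
    show "Int_stable {U::'e set. open U}" by (auto simp: Int_stable_def)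
    show "sets (distr \<mu> borel (\<lambda>x. x)) = sigma_sets UNIV {U::'e set. open U}"
      "sets (distr \<nu> borel (\<lambda>x. x)) = sigma_sets UNIV {U::'e set. open U}"
      by (simp_all add: borel_def)
    show "emeasure (distr \<mu> borel (\<lambda>x. x)) UNIV \<noteq> \<infinity>" for i :: nat
      using id\<mu> by (simp add: emeasure_distr)
    fix U :: "'e set" assume "U \<in> {U. open U}"
    then have U: "open U" by simp
    have U\<mu>: "U \<inter> E \<in> sets \<mu>" "U \<inter> E \<in> sets \<nu>"
      using U P1D(2)[OF P(1)] P1D(2)[OF P(2)] by (auto simp: sets_restrict_space)
    have emU: "emeasure (distr \<mu> borel (\<lambda>x. x)) U = ennreal (\<integral>x. indicator (U \<inter> E) x \<partial>\<mu>)"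
      "emeasure (distr \<nu> borel (\<lambda>x. x)) U = ennreal (\<integral>x. indicator (U \<inter> E) x \<partial>\<nu>)"
      using U U\<mu> id\<mu> id\<nu> P1D(3)[OF P(1)] P1D(3)[OF P(2)]
      by (simp_all add: emeasure_distr vimage_def Int_def \<mu>.emeasure_eq_measure
        \<nu>.emeasure_eq_measure conj_commute)
    \<comment> \<open>The whole space is treated separately: its complement is empty, where
      \<open>infdist\<close> has the value 0 by convention.\<close>
    define \<phi> where "\<phi> n x = (if U = UNIV then 1 else min 1 (real n * infdist x (- U)))"
      for n :: nat and x
    have c: "continuous_on E (\<phi> n)" for n
      unfolding \<phi>_def by (cases "U = UNIV") (auto intro!: continuous_intros)
    have b: "\<bar>\<phi> n x\<bar> \<le> 1" for n x by (auto simp: \<phi>_def infdist_nonneg)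
    have lim: "(\<lambda>n. \<phi> n x) \<longlonglongrightarrow> indicator (U \<inter> E) x" if x: "x \<in> E" for x
    proof (cases "x \<in> U \<and> U \<noteq> UNIV")
      case False
      then have "\<phi> n x = indicator (U \<inter> E) x" for n using x by (auto simp: \<phi>_def infdist_zero)
      then show ?thesis by simp
    next
      case True
      then have "infdist x (- U) > 0"
        using U by (intro infdist_pos_not_in_closed) auto
      then obtain N where N: "1 / infdist x (- U) \<le> real N" using real_arch_simple by blast
      have "\<forall>\<^sub>F n in sequentially. \<phi> n x = indicator (U \<inter> E) x"
        using eventually_ge_at_top[of N]
      proof eventually_elim
        case (elim n)
        have "1 \<le> real N * infdist x (- U)" using N \<open>infdist x (- U) > 0\<close> by (simp add: field_simps)
        also have "\<dots> \<le> real n * infdist x (- U)"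
          using elim by (intro mult_right_mono) (auto simp: infdist_nonneg)
        finally show ?case using True x by (simp add: \<phi>_def)
      qed
      then show ?thesis by (rule tendsto_eventually)
    qed
    have m: "\<phi> n \<in> borel_measurable \<mu>" "\<phi> n \<in> borel_measurable \<nu>" for n
      using borel_measurable_continuous_on_restrict[OF c[of n]] P1D(2)[OF P(1)] P1D(2)[OF P(2)]
      by (simp_all cong: measurable_cong_sets)
    have l1: "(\<lambda>n. \<integral>x. \<phi> n x \<partial>\<mu>) \<longlonglongrightarrow> (\<integral>x. indicator (U \<inter> E) x \<partial>\<mu>)"
      by (rule integral_dominated_convergence[where w = "\<lambda>_. 1"])
        (use m lim b U\<mu> P1D(3)[OF P(1)] in auto)
    have l2: "(\<lambda>n. \<integral>x. \<phi> n x \<partial>\<nu>) \<longlonglongrightarrow> (\<integral>x. indicator (U \<inter> E) x \<partial>\<nu>)"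
      by (rule integral_dominated_convergence[where w = "\<lambda>_. 1"])
        (use m lim b U\<mu> P1D(3)[OF P(2)] in auto)
    have "(\<integral>x. \<phi> n x \<partial>\<mu>) = (\<integral>x. \<phi> n x \<partial>\<nu>)" for n
      using b by (intro eq c) (auto simp: bounded_iff)
    with l2 have "(\<integral>x. indicator (U \<inter> E) x \<partial>\<mu>) = (\<integral>x. indicator (U \<inter> E) x \<partial>\<nu> :: real)"
      by (intro LIMSEQ_unique[OF l1]) (simp only:)
    then show "emeasure (distr \<mu> borel (\<lambda>x. x)) U = emeasure (distr \<nu> borel (\<lambda>x. x)) U"
      unfolding emU by (simp only:)
  qed auto
  then have *: "emeasure (distr \<mu> borel (\<lambda>x. x)) A = emeasure (distr \<nu> borel (\<lambda>x. x)) A" for A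
    by simp
  show ?thesis
  proof (rule measure_eqI)
    show "sets \<mu> = sets \<nu>" using P1D(2)[OF P(1)] P1D(2)[OF P(2)] by simp
    fix A assume "A \<in> sets \<mu>"
    then obtain A' where A': "A' \<in> sets borel" "A = A' \<inter> E"
      using P1D(2)[OF P(1)] by (auto simp: sets_restrict_space)
    show "emeasure \<mu> A = emeasure \<nu> A"
      using *[of A'] A' id\<mu> id\<nu> P1D(3)[OF P(1)] P1D(3)[OF P(2)] by (simp add: emeasure_distr)
  qed
qed

text \<open>The constant sequence \<mu> converges to \<nu> weakly, so all integrals of bounded
  continuous functions agree.\<close>

lemma d1_eq_0D:
  assumes "\<mu> \<in> P1 E" "\<nu> \<in> P1 E" "small_partitions E" "d1 \<mu> \<nu> = 0"
  shows "\<mu> = \<nu>"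
proof (rule P1_eqI[OF assms(1,2)])
  have "weakly_converges (\<lambda>_. \<mu>) \<nu>"
    by (rule weakly_converges_of_d1[OF assms(1,2,3)]) (simp add: assms(4))
  then show "(\<integral>x. \<phi> x \<partial>\<mu>) = (\<integral>x. \<phi> x \<partial>\<nu>)" if "continuous_on E \<phi>" "bounded (\<phi> ` E)"
    for \<phi> :: "'a \<Rightarrow> real"
    using that P1D(3)[OF assms(2)] LIMSEQ_const_iff unfolding weakly_converges_def by fastforce
qed

section \<open>Existence and uniqueness of the solution law\<close>

lemma concave_modulus_id: "concave_modulus (\<lambda>u. u)"
  by unfold_locales (auto simp: modulus_of_continuity_def mono_on_def concave_on_def convex_on_def
    algebra_simps)

lemma weak_solution_cong_marginal:
  "weak_solution T B \<mu>Y P X Y \<longleftrightarrow> prob_space P \<and>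
      X \<in> measurable P (borel_on (paths T)) \<and> Y \<in> measurable P (borel_on (paths T)) \<and>
      distr P (borel_on (paths T)) Y = \<mu>Y \<and>
      (\<forall>t\<in>{0..T}. marginal P X t \<in> P1 UNIV) \<and> bdd_above ((\<lambda>t. norm1 (marginal P X t)) ` {0..T}) \<and>
      (AE \<omega> in P. solves_equation T B (marginal P X) (X \<omega>) (Y \<omega>))"
  unfolding weak_solution_def Let_def marginal_def[abs_def] ..

context mckean
begin

text \<open>
  The Picard iterates converge uniformly in the driving path, so the limit flow is the flow of an
  actual random variable and completeness of \<open>P1\<close> is not needed.
\<close>

proposition flow_fixed_point:
  assumes \<mu>: "\<mu> \<in> P1 (paths T :: 'd path set)"
  shows "\<exists>X. X \<in> measurable \<mu> (borel_on (paths T)) \<and> integrable \<mu> (\<lambda>y. norm (X y)) \<and>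
    (\<forall>y\<in>paths T. X y = flow_map (marginal \<mu> X) y)"
proof -
  have \<mu>P: "prob_space \<mu>" by (rule P1D(1)[OF \<mu>])
  interpret prob_space \<mu> by (rule \<mu>P)
  interpret id: concave_modulus "\<lambda>u. u" by (rule concave_modulus_id)
  have sp\<mu>: "space \<mu> = paths T" by (rule P1D(3)[OF \<mu>])
  have idm: "(\<lambda>y. y) \<in> measurable \<mu> (borel_on (paths T))"
    using P1D(2)[OF \<mu>] by (simp cong: measurable_cong_sets)
  have idi: "integrable \<mu> (\<lambda>y. norm y)" using P1D(4)[OF \<mu>] .
  \<comment> \<open>Every iterate is a function of the driving path on the probability space \<mu>
    itself. The iteration starts from the input, and each step freezes the flow of the last iterate
    and solves the equation exactly for that flow.\<close>
  define X where "X n = ((\<lambda>Z. flow_map (marginal \<mu> Z)) ^^ n) (\<lambda>y. y)" for n :: nat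
  have X0: "X 0 = (\<lambda>y. y)" and XS: "X (Suc n) = flow_map (marginal \<mu> (X n))" for n
    by (simp_all add: X_def)
  have XX: "X n \<in> measurable \<mu> (borel_on (paths T)) \<and> integrable \<mu> (\<lambda>y. norm (X n y))" for n
  proof (induction n)
    case 0
    then show ?case using idm idi by (simp add: X0)
  next
    case (Suc n)
    then have IH: "X n \<in> measurable \<mu> (borel_on (paths T))" "integrable \<mu> (\<lambda>y. norm (X n y))"
      by auto
    have adm: "admissible T (marginal \<mu> (X n))" by (rule admissible_marginal[OF \<mu>P IH])
    have m: "X (Suc n) \<in> measurable \<mu> (borel_on (paths T))"
      unfolding XS using flow_map_measurable[OF adm] P1D(2)[OF \<mu>]
        by (simp cong: measurable_cong_sets)
    have "\<exists>D. \<forall>x y. x \<in> paths T \<longrightarrow> solves_equation T B (marginal \<mu> (X n)) x y \<longrightarrow>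
      norm x \<le> D * (1 + norm y)"
      by (rule solution_growth[of "marginal \<mu> (X n)" "\<integral>y. norm (X n y) \<partial>\<mu>"])
        (use marginal_P1[OF \<mu>P IH] norm1_marginal_le[OF \<mu>P IH] in \<open>blast+\<close>)
    then obtain D where D: "\<And>x y. x \<in> paths T \<Longrightarrow> solves_equation T B (marginal \<mu> (X n)) x y \<Longrightarrow>
        norm x \<le> D * (1 + norm y)" by blast
    have "integrable \<mu> (\<lambda>y. norm (X (Suc n) y))"
    proof (rule Bochner_Integration.integrable_bound)
      show "integrable \<mu> (\<lambda>y. D * (1 + norm y))" using idi by simp
      show "(\<lambda>y. norm (X (Suc n) y)) \<in> borel_measurable \<mu>"
        by (rule measurable_compose[OF m norm_measurable_on])
      show "AE y in \<mu>. norm (norm (X (Suc n) y)) \<le> norm (D * (1 + norm y))"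
      proof (rule AE_I2)
        fix y assume "y \<in> space \<mu>"
        then have y: "y \<in> paths T" by (simp only: sp\<mu>)
        have "norm (X (Suc n) y) \<le> D * (1 + norm y)"
          unfolding XS by (rule D[OF flow_map[OF adm y]])
        then show "norm (norm (X (Suc n) y)) \<le> norm (D * (1 + norm y))" by simp
      qed
    qed
    with m show ?case by blast
  qed
  note Xm = XX[THEN conjunct1] and Xi = XX[THEN conjunct2]
  have adm: "admissible T (marginal \<mu> (X n))" for n by (rule admissible_marginal[OF \<mu>P Xm Xi])
  have Xp: "X n y \<in> paths T" if "y \<in> paths T" for n y
    using measurable_space[OF Xm[of n], of y] that by (simp add: sp\<mu>)
  have XSsol: "solves_equation T B (marginal \<mu> (X n)) (X (Suc n) y) y" if "y \<in> paths T" for n y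
    unfolding XS by (rule flow_map(2)[OF adm that])
  define b where "b n s = (\<integral>y. norm (apply_bcontfun (X n y) s) \<partial>\<mu>)" for n s
  have bm: "norm1 (marginal \<mu> (X n) s) = b n s" for n s
    unfolding b_def by (rule norm1_marginal[OF \<mu>P Xm Xi])
  have Zm: "(\<lambda>z. norm (apply_bcontfun (X n (snd z)) (fst z))) \<in> borel_measurable (borel \<Otimes>\<^sub>M \<mu>)"
    for n
    using path_jointly_measurable[OF Xm[of n]] by measurable
  have bmeas: "b n \<in> borel_measurable borel" for n
    using id.expectation_kernel_le(1)[where e = "\<lambda>_. 0"
      and R = 0, OF \<mu>P Zm[of n] norm_ge_zero norm_apply_le Xi k]
    unfolding b_def[abs_def] by simp
  have b0: "0 \<le> b n s" for n s by (simp add: b_def)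
  have bR: "b n s \<le> (\<integral>y. norm (X n y) \<partial>\<mu>)" for n s
    using norm1_marginal_le[OF \<mu>P Xm Xi, of n s] by (simp add: bm)
  define c where "c = (\<integral>y. norm y \<partial>\<mu>)"
  define K where "K = (c + 1) * exp (2 * (LINT s|lborel. k s))"
  have bK': "b n t \<le> K" if t: "0 \<le> t" "t \<le> T" for n t
    unfolding K_def
  proof (rule gronwall_iterates[where a = b and T = T
    and R = "\<lambda>n. \<integral>y. norm (X n y) \<partial>\<mu>", OF k bmeas b0 bR _ _ _ t])
    show "0 \<le> c" by (simp add: c_def)
    show "b 0 t \<le> c" for t using bR[of 0 t] by (simp add: c_def X0)
    fix n t assume t: "0 \<le> t" "t \<le> T"
    have e: "(\<lambda>s. 1 + b n s) \<in> borel_measurable borel" "\<And>s. 0 \<le> 1 + b n s"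
      "\<And>s. 1 + b n s \<le> 1 + (\<integral>y. norm (X n y) \<partial>\<mu>)"
      using bmeas[of n] b0[of n] bR[of n] by (auto intro: add_nonneg_nonneg)
    note E = id.expectation_kernel_le[OF \<mu>P Zm[of "Suc n"] norm_ge_zero norm_apply_le
      Xi[of "Suc n"] k e]
    have "b (Suc n) t \<le>
      (\<integral>y. norm y + (LINT s:{0..t}|lborel. k s * (norm (apply_bcontfun (X (Suc n) y) s) +
      (1 + b n s))) \<partial>\<mu>)"
      unfolding b_def[of "Suc n"]
    proof (rule integral_mono)
      show "integrable \<mu> (\<lambda>y. norm (apply_bcontfun (X (Suc n) y) t))"
        by (rule integrable_apply[OF \<mu>P Xm Xi])
      show "integrable \<mu>
        (\<lambda>y. norm y + (LINT s:{0..t}|lborel. k s * (norm (apply_bcontfun (X (Suc n) y) s) +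
        (1 + b n s))))"
        by (rule Bochner_Integration.integrable_add[OF idi E(2)])
      fix y assume "y \<in> space \<mu>"
      then have y: "y \<in> paths T" by (simp only: sp\<mu>)
      have "norm (apply_bcontfun (X (Suc n) y) t)
          \<le> norm y + (LINT s:{0..t}|lborel. k s *
            (1 + b n s + norm (apply_bcontfun (X (Suc n) y) s)))"
        by (rule solution_norm_le[OF marginal_P1[OF \<mu>P Xm Xi] bmeas b0 bR _ t XSsol[OF y]])
          (simp add: bm)
      then show "norm (apply_bcontfun (X (Suc n) y) t)
          \<le> norm y + (LINT s:{0..t}|lborel. k s * (norm (apply_bcontfun (X (Suc n) y) s) +
            (1 + b n s)))"
        by (simp only: add.commute)
    qed
    also have "\<dots> = c +
      (\<integral>y. (LINT s:{0..t}|lborel. k s * (norm (apply_bcontfun (X (Suc n) y) s) + (1 + b n s))) \<partial>\<mu>)"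
      unfolding c_def by (rule Bochner_Integration.integral_add[OF idi E(2)])
    also have "\<dots> \<le> c + (LINT s:{0..t}|lborel. k s * (b (Suc n) s + (1 + b n s)))"
      unfolding b_def[of "Suc n"] by (intro add_left_mono E(3))
    also have "(\<lambda>s. k s * (b (Suc n) s + (1 + b n s))) = (\<lambda>s. k s * (1 + b n s + b (Suc n) s))"
      by (simp add: ac_simps)
    finally show "b (Suc n) t \<le> c + (LINT s:{0..t}|lborel. k s * (1 + b n s + b (Suc n) s))" .
  qed
  \<comment> \<open>Paths are constant outside \<open>{0..T}\<close>, so the moment bound extends to
    all times; the Osgood argument below asks for a bound at every real time.\<close>
  have bK: "b n t \<le> K" for n t
  proof -
    have "b n t = b n (max 0 (min t T))"
      unfolding b_def using path_clamp[OF Xp, of _ n t]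
      by (intro Bochner_Integration.integral_cong) (simp_all add: sp\<mu>)
    then show ?thesis using bK'[of "max 0 (min t T)" n] T by simp
  qed
  define a where "a n p s = (\<integral>y. norm (apply_bcontfun (X n y) s - apply_bcontfun (X p y) s) \<partial>\<mu>)"
    for n p s
  have am: "a n p \<in> borel_measurable borel" "0 \<le> a n p s" for n p s
    unfolding a_def[abs_def] by (rule mean_distance[OF \<mu>P Xm Xm Xi Xi])+
  have aK: "a n p s \<le> 2 * K" for n p s
  proof -
    have "a n p s \<le> (\<integral>y. norm (apply_bcontfun (X n y) s) + norm (apply_bcontfun (X p y) s) \<partial>\<mu>)"
      unfolding a_def
      by (intro integral_mono mean_distance(4)[OF \<mu>P Xm Xm Xi Xi] norm_triangle_ineq4
          Bochner_Integration.integrable_add integrable_apply[OF \<mu>P Xm Xi])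
    also have "\<dots> = b n s + b p s"
      unfolding b_def by (intro Bochner_Integration.integral_add integrable_apply[OF \<mu>P Xm Xi])
    also have "\<dots> \<le> 2 * K" using bK[of n s] bK[of p s] by simp
    finally show ?thesis .
  qed
  have da: "d1 (marginal \<mu> (X n) s) (marginal \<mu> (X p) s) \<le> a n p s" for n p s
    unfolding a_def by (rule d1_marginal_le[OF \<mu>P Xm Xm])
  \<comment> \<open>Both iterates have the same driving path, so the datum is the mean of
    \<open>norm (y - y)\<close>, and the differences satisfy the homogeneous recursion.\<close>
  have Cau: "\<exists>N. \<forall>n\<ge>N. \<forall>p\<ge>N. \<forall>t\<in>{0..T}. a n p t < \<epsilon>" if \<epsilon>: "\<epsilon> > 0" for \<epsilon>
  proof (rule picard_cauchy[OF h _ am aK _ \<epsilon>])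
    fix n p t assume t: "0 \<le> t" "t \<le> T"
    have sol: "AE y in \<mu>. solves_equation T B (marginal \<mu> (X n)) (X (Suc n) y) y \<and>
        solves_equation T B (marginal \<mu> (X p)) (X (Suc p) y) y"
      using XSsol by (intro AE_I2) (simp add: sp\<mu>)
    have "a (Suc n) (Suc p) t \<le> (\<integral>y. norm (y - y) \<partial>\<mu>) +
      (LINT s:{0..t}|lborel. h s * f (a (Suc n) (Suc p) s + a n p s))"
      unfolding a_def[of "Suc n" "Suc p"]
      by (rule expectation_diff_le(1)[where e = "a n p" and R = "2 * K",
            OF \<mu>P Xm Xm Xi Xi _ adm adm am aK da sol t]) simp
    then show "a (Suc n) (Suc p) t
      \<le> (LINT s:{0..t}|lborel. h s * f (a n p s + a (Suc n) (Suc p) s))"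
      by (simp add: add.commute)
  qed (use T in simp)
  \<comment> \<open>Small mean distances make the flows \<open>d1\<close>-close at all times, and
    pathwise stability turns this into closeness uniform over all driving paths. The index shifts by
    one because \<open>X (Suc n)\<close> is driven by the flow of \<open>X n\<close>.\<close>
  have unif: "\<exists>N. \<forall>n\<ge>N. \<forall>p\<ge>N. \<forall>y\<in>paths T. norm (X n y - X p y) \<le> \<epsilon>" if \<epsilon>: "\<epsilon> > 0" for \<epsilon>
  proof (rule solution_stable[OF \<epsilon>])
    fix \<rho> :: real assume \<rho>: "\<rho> > 0" and st: "stable_within \<epsilon> \<rho>"
    note * = stable_withinD[OF st]
    obtain N where N: "\<And>n p t. n \<ge> N \<Longrightarrow> p \<ge> N \<Longrightarrow> t \<in> {0..T} \<Longrightarrow> a n p t < \<rho>"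
      using Cau[OF \<rho>] by blast
    have "norm (X (Suc n) y - X (Suc p) y) \<le> \<epsilon>" if n: "n \<ge> N" "p \<ge> N" and y: "y \<in> paths T" for n p y
    proof (rule *[OF adm adm Xp[OF y] Xp[OF y] XSsol[OF y] XSsol[OF y]])
      show "d1 (marginal \<mu> (X n) s) (marginal \<mu> (X p) s) \<le> \<rho>" if "s \<in> {0..T}" for s
        using da[of n s p] N[OF n that] by linarith
    qed (use \<rho> in simp)
    then have "norm (X n y - X p y) \<le> \<epsilon>" if "n \<ge> Suc N" "p \<ge> Suc N" "y \<in> paths T" for n p y
      using that by (cases n; cases p) auto
    then show ?thesis by blast
  qed
  have "\<exists>x. (\<lambda>n. X n y) \<longlonglongrightarrow> x" if y: "y \<in> paths T" for y
  proof -
    have "Cauchy (\<lambda>n. X n y)"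
    proof (rule metric_CauchyI)
      fix \<epsilon> :: real assume "\<epsilon> > 0"
      then have "\<epsilon> / 2 > 0" by simp
      from unif[OF this] obtain N where N: "\<And>n p. n \<ge> N \<Longrightarrow> p \<ge> N \<Longrightarrow> norm (X n y - X p y) \<le> \<epsilon> / 2"
        using y by blast
      have "dist (X n y) (X p y) < \<epsilon>" if "n \<ge> N" "p \<ge> N" for n p
        using N[OF that] \<open>\<epsilon> > 0\<close> by (simp add: dist_norm)
      then show "\<exists>M. \<forall>n\<ge>M. \<forall>p\<ge>M. dist (X n y) (X p y) < \<epsilon>" by blast
    qed
    then show ?thesis using convergent_eq_Cauchy by blast
  qed
  then obtain Z where Z: "\<And>y. y \<in> paths T \<Longrightarrow> (\<lambda>n. X n y) \<longlonglongrightarrow> Z y" by metis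
  have Zp: "Z y \<in> paths T" if "y \<in> paths T" for y
    by (rule paths_limit[OF Xp[OF that] Z[OF that]])
  have unifZ: "\<exists>N. \<forall>n\<ge>N. \<forall>y\<in>paths T. norm (X n y - Z y) \<le> \<epsilon>" if \<epsilon>: "\<epsilon> > 0" for \<epsilon>
  proof -
    obtain N where N: "\<And>n p y. n \<ge> N \<Longrightarrow> p \<ge> N \<Longrightarrow> y \<in> paths T \<Longrightarrow> norm (X n y - X p y) \<le> \<epsilon>"
      using unif[OF \<epsilon>] by blast
    have "norm (X n y - Z y) \<le> \<epsilon>" if n: "n \<ge> N" and y: "y \<in> paths T" for n y
    proof (rule LIMSEQ_le_const2)
      show "(\<lambda>p. norm (X n y - X p y)) \<longlonglongrightarrow> norm (X n y - Z y)" by (intro tendsto_intros Z y)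
      show "\<exists>M. \<forall>p\<ge>M. norm (X n y - X p y) \<le> \<epsilon>" using N[OF n _ y] by blast
    qed
    then show ?thesis by blast
  qed
  have Zmeas: "Z \<in> measurable \<mu> (borel_on (paths T))"
  proof (rule measurable_restrict_space2)
    show "Z \<in> space \<mu> \<rightarrow> paths T" using Zp by (simp add: sp\<mu>)
    show "Z \<in> borel_measurable \<mu>"
    proof (rule borel_measurable_LIMSEQ_metric)
      show "X n \<in> borel_measurable \<mu>" for n using Xm[of n]
        by (simp add: measurable_restrict_space2_iff)
      show "(\<lambda>n. X n y) \<longlonglongrightarrow> Z y" if "y \<in> space \<mu>" for y using Z that by (simp add: sp\<mu>)
    qed
  qed
  have Zi: "integrable \<mu> (\<lambda>y. norm (Z y))"
  proof -
    obtain N where N: "\<And>y. y \<in> paths T \<Longrightarrow> norm (X N y - Z y) \<le> 1" using unifZ[of 1] by auto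
    show ?thesis
    proof (rule Bochner_Integration.integrable_bound)
      show "integrable \<mu> (\<lambda>y. norm (X N y) + 1)" using Xi[of N] by simp
      show "(\<lambda>y. norm (Z y)) \<in> borel_measurable \<mu>"
        by (rule measurable_compose[OF Zmeas norm_measurable_on])
      show "AE y in \<mu>. norm (norm (Z y)) \<le> norm (norm (X N y) + 1)"
      proof (rule AE_I2)
        fix y assume "y \<in> space \<mu>"
        then have "norm (X N y - Z y) \<le> 1" using N by (simp add: sp\<mu>)
        then show "norm (norm (Z y)) \<le> norm (norm (X N y) + 1)"
          using norm_triangle_ineq2[of "Z y" "X N y"] by (simp add: norm_minus_commute)
      qed
    qed
  qed
  have admZ: "admissible T (marginal \<mu> Z)" by (rule admissible_marginal[OF \<mu>P Zmeas Zi])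
  have "Z y = flow_map (marginal \<mu> Z) y" if y: "y \<in> paths T" for y
  proof -
    have "norm (Z y - flow_map (marginal \<mu> Z) y) \<le> 0 + \<epsilon>" if \<epsilon>: "\<epsilon> > 0" for \<epsilon>
    proof (rule solution_stable[of "\<epsilon> / 2"])
      show "\<epsilon> / 2 > 0" using \<epsilon> by simp
      fix \<rho> :: real assume \<rho>: "\<rho> > 0" and st: "stable_within (\<epsilon> / 2) \<rho>"
      note * = stable_withinD[OF st]
      \<comment> \<open>The bound \<rho> is what stability asks of the flows, and \<epsilon>/2 is
        the share of the triangle inequality between the iterate and its limit.\<close>
      define \<eta> where "\<eta> = min \<rho> (\<epsilon> / 2)"
      have "\<eta> > 0" using \<rho> \<epsilon> by (simp add: \<eta>_def)
      from unifZ[OF this] obtain n where n: "\<And>p y. p \<ge> n \<Longrightarrow> y \<in> paths T \<Longrightarrow> norm (X p y - Z y) \<le> \<eta>"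
        by blast
      have "norm (X (Suc n) y - flow_map (marginal \<mu> Z) y) \<le> \<epsilon> / 2"
      proof (rule *[OF adm admZ Xp[OF y] flow_map(1)[OF admZ y] XSsol[OF y] flow_map(2)[OF admZ y]])
        fix s
        have "d1 (marginal \<mu> (X n) s) (marginal \<mu> Z s)
            \<le> (\<integral>y. norm (apply_bcontfun (X n y) s - apply_bcontfun (Z y) s) \<partial>\<mu>)"
          by (rule d1_marginal_le[OF \<mu>P Xm Zmeas])
        also have "\<dots> \<le> (\<integral>y. \<eta> \<partial>\<mu>)"
        proof (rule integral_mono[OF mean_distance(4)[OF \<mu>P Xm Zmeas Xi Zi]])
          fix y assume "y \<in> space \<mu>"
          then have "norm (X n y - Z y) \<le> \<eta>" using n by (simp add: sp\<mu>)
          then show "norm (apply_bcontfun (X n y) s - apply_bcontfun (Z y) s) \<le> \<eta>"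
            by (rule order_trans[OF dist_apply_le])
        qed simp
        also have "\<dots> \<le> \<rho>" by (simp add: prob_space \<eta>_def)
        finally show "d1 (marginal \<mu> (X n) s) (marginal \<mu> Z s) \<le> \<rho>" .
      qed (use \<rho> in simp)
      moreover have "norm (X (Suc n) y - Z y) \<le> \<epsilon> / 2" using n[of "Suc n" y] y by (simp add: \<eta>_def)
      moreover have "norm (Z y - flow_map (marginal \<mu> Z) y)
          \<le> norm (Z y - X (Suc n) y) + norm (X (Suc n) y - flow_map (marginal \<mu> Z) y)"
        using norm_triangle_ineq[of "Z y - X (Suc n) y" "X (Suc n) y - flow_map (marginal \<mu> Z) y"]
          by simp
      ultimately show "norm (Z y - flow_map (marginal \<mu> Z) y) \<le> 0 + \<epsilon>"
        by (simp add: norm_minus_commute)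
    qed
    then have "norm (Z y - flow_map (marginal \<mu> Z) y) \<le> 0" by (rule field_le_epsilon)
    then show ?thesis by simp
  qed
  then show ?thesis using Zmeas Zi by blast
qed

lemma distr_pair_fst_comp:
  assumes "prob_space \<mu>" "X \<in> measurable \<mu> N"
  shows "distr (\<mu> \<Otimes>\<^sub>M \<mu>) N (\<lambda>\<omega>. X (fst \<omega>)) = distr \<mu> N X"
proof -
  interpret prob_space \<mu> by fact
  have "distr (\<mu> \<Otimes>\<^sub>M \<mu>) N (\<lambda>\<omega>. X (fst \<omega>)) = distr (distr (\<mu> \<Otimes>\<^sub>M \<mu>) \<mu> fst) N X"
    by (subst distr_distr[OF assms(2)]) (simp_all add: comp_def)
  also have "distr (\<mu> \<Otimes>\<^sub>M \<mu>) \<mu> fst = \<mu>"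
    using pair_coupling[OF assms(1,1)] by (simp add: couplings_def)
  finally show ?thesis .
qed

theorem solution_law_ex1:
  assumes \<mu>: "\<mu> \<in> P1 (paths T)"
  shows "\<exists>!\<mu>X. solution_law T B \<mu> \<mu>X"
proof -
  have \<mu>P: "prob_space \<mu>" by (rule P1D(1)[OF \<mu>])
  obtain X where X: "X \<in> measurable \<mu> (borel_on (paths T))" "integrable \<mu> (\<lambda>y. norm (X y))"
    "\<And>y. y \<in> paths T \<Longrightarrow> X y = flow_map (marginal \<mu> X) y"
    using flow_fixed_point[OF \<mu>] by blast
  have adm: "admissible T (marginal \<mu> X)" by (rule admissible_marginal[OF \<mu>P X(1,2)])
  \<comment> \<open>\<open>solution_law\<close> wants pairs of paths as sample points; the fixed
    point uses the first coordinate, and the second is an idle copy.\<close>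
  define Q where "Q = \<mu> \<Otimes>\<^sub>M \<mu>"
  have QP: "prob_space Q" unfolding Q_def by (rule couplings_prob[OF pair_coupling[OF \<mu>P \<mu>P] \<mu>P])
  have idm: "(\<lambda>y. y) \<in> measurable \<mu> (borel_on (paths T))"
    using P1D(2)[OF \<mu>] by (simp cong: measurable_cong_sets)
  have fst: "fst \<in> measurable Q \<mu>" unfolding Q_def by simp
  have XQ: "(\<lambda>\<omega>. X (fst \<omega>)) \<in> measurable Q (borel_on (paths T))"
    by (rule measurable_compose[OF fst X(1)])
  have YQ: "fst \<in> measurable Q (borel_on (paths T))" using measurable_compose[OF fst idm] by simp
  have mQ: "marginal Q (\<lambda>\<omega>. X (fst \<omega>)) = marginal \<mu> X"
    unfolding marginal_def[abs_def] Q_def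
    using distr_pair_fst_comp[OF \<mu>P measurable_compose[OF X(1) apply_bcontfun_measurable]] by simp
  have "weak_solution T B \<mu> Q (\<lambda>\<omega>. X (fst \<omega>)) fst"
    unfolding weak_solution_cong_marginal mQ
  proof (intro conjI QP XQ YQ ballI)
    show "distr Q (borel_on (paths T)) fst = \<mu>"
      unfolding Q_def using distr_pair_fst_comp[OF \<mu>P idm] distr_id2[of "borel_on (paths T)" \<mu>]
        P1D(2)[OF \<mu>] by simp
    show "marginal \<mu> X t \<in> P1 UNIV" for t by (rule marginal_P1[OF \<mu>P X(1,2)])
    show "bdd_above ((\<lambda>t. norm1 (marginal \<mu> X t)) ` {0..T})"
      by (rule bdd_aboveI2) (rule norm1_marginal_le[OF \<mu>P X(1,2)])
    show "AE \<omega> in Q. solves_equation T B (marginal \<mu> X) (X (fst \<omega>)) (fst \<omega>)"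
    proof (rule AE_I2)
      fix \<omega> assume "\<omega> \<in> space Q"
      then have y: "fst \<omega> \<in> paths T" using measurable_space[OF YQ] by simp
      show "solves_equation T B (marginal \<mu> X) (X (fst \<omega>)) (fst \<omega>)"
        unfolding X(3)[OF y] by (rule flow_map(2)[OF adm y])
    qed
  qed
  then have ex: "solution_law T B \<mu> (distr Q (borel_on (paths T)) (\<lambda>\<omega>. X (fst \<omega>)))"
    unfolding solution_law_def by blast
  have uniq: "\<mu>X = \<mu>X'" if sl: "solution_law T B \<mu> \<mu>X" "solution_law T B \<mu> \<mu>X'" for \<mu>X \<mu>X'
  proof -
    obtain P :: "('d path \<times> 'd path) measure" and X Y where
      w: "weak_solution T B \<mu> P X Y" "distr P (borel_on (paths T)) X = \<mu>X"
      using sl(1) unfolding solution_law_def by blast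
    obtain P' :: "('d path \<times> 'd path) measure" and X' Y' where
      w': "weak_solution T B \<mu> P' X' Y'" "distr P' (borel_on (paths T)) X' = \<mu>X'"
      using sl(2) unfolding solution_law_def by blast
    have P: "\<mu>X \<in> P1 (paths T)" "\<mu>X' \<in> P1 (paths T)"
      using weak_solution_flow(7)[OF w(1) \<mu>] weak_solution_flow(7)[OF w'(1) \<mu>] w(2) w'(2) by auto
    have "d1 \<mu>X \<mu>X' \<le> 0"
      using weak_solution_stability[OF w(1) w'(1) \<mu> \<mu>] d1_refl[OF \<mu> small_partitions_paths] w(2)
        w'(2) by simp
    then have "d1 \<mu>X \<mu>X' = 0" using d1_nonneg[OF P1D(1)[OF P(1)] P1D(1)[OF P(2)]] by simp
    then show ?thesis by (rule d1_eq_0D[OF P small_partitions_paths])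
  qed
  show ?thesis using ex uniq by blast
qed

end

section \<open>Empirical measures of i.i.d. samples\<close>

text \<open>The powers of 2 below \<open>z\<close> add up to less than twice the largest of them.
  Applied pointwise to \<open>g\<close>, it sums the truncation errors in the strong law.\<close>

lemma sum_geometric_below:
  fixes z :: real
  assumes "0 \<le> z"
  shows "(\<Sum>k<K. 2 ^ k * (if 2 ^ k < z then 1 else 0)) \<le> 2 * z"
proof (induction K)
  case (Suc K)
  show ?case
  proof (cases "2 ^ K < z")
    case True
    have "(\<Sum>k<Suc K. 2 ^ k * (if 2 ^ k < z then 1 else 0)) \<le> (\<Sum>k<Suc K. 2 ^ k :: real)"
      by (intro sum_mono) auto
    also have "\<dots> \<le> 2 * 2 ^ K" by (subst geometric_sum) simp_all
    also have "\<dots> \<le> 2 * z" using True by simp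
    finally show ?thesis .
  qed (use Suc in simp)
qed (use assms in simp)

text \<open>From the first power at or above \<open>z\<close> on, the quotients are at most 1, 1/2,
  1/4 and so on. Halving \<open>z\<close> shifts the index by one, which is the induction step.
  Applied pointwise to \<open>g\<close>, it sums the variances in the strong law.\<close>

lemma sum_geometric_above:
  fixes z :: real
  assumes "0 \<le> z"
  shows "(\<Sum>k<K. (if z \<le> 2 ^ k then z / 2 ^ k else 0)) \<le> 2"
  using assms
proof (induction K arbitrary: z)
  case (Suc K)
  have shift: "(\<Sum>k<Suc K. (if z \<le> 2 ^ k then z / 2 ^ k else 0))
      = (if z \<le> 1 then z else 0) + (\<Sum>k<K. (if z / 2 \<le> 2 ^ k then (z / 2) / 2 ^ k else 0))"
    by (subst sum.lessThan_Suc_shift) (auto simp: field_simps intro!: sum.cong)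
  show ?case
  proof (cases "z \<le> 1")
    case True
    have "(\<Sum>k<Suc K. (if z \<le> 2 ^ k then z / 2 ^ k else 0)) \<le> (\<Sum>k<Suc K. (1 / 2) ^ k :: real)"
      using True Suc.prems by (intro sum_mono) (auto simp: power_one_over divide_right_mono)
    also have "\<dots> \<le> 2" by (subst geometric_sum) simp_all
    finally show ?thesis .
  next
    case False
    then show ?thesis unfolding shift using Suc.IH[of "z / 2"] Suc.prems by simp
  qed
qed simp

section \<open>Laws of large numbers for an i.i.d. sample\<close>

locale iid_sample = prob_space P for P :: "'w measure" +
  fixes E :: "'e::real_normed_vector set" and \<mu> :: "'e measure" and Y :: "nat \<Rightarrow> 'w \<Rightarrow> 'e"
  assumes \<mu>: "\<mu> \<in> P1 E"
    and Y: "\<And>i. Y i \<in> measurable P (borel_on E)"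
    and indep: "indep_vars (\<lambda>_. borel_on E) Y UNIV"
    and law: "\<And>i. distr P (borel_on E) (Y i) = \<mu>"
begin

lemma law_integral:
  fixes \<phi> :: "'e \<Rightarrow> real"
  assumes "\<phi> \<in> borel_measurable (borel_on E)"
  shows "(\<integral>\<omega>. \<phi> (Y i \<omega>) \<partial>P) = (\<integral>x. \<phi> x \<partial>\<mu>)"
    "integrable P (\<lambda>\<omega>. \<phi> (Y i \<omega>)) \<longleftrightarrow> integrable \<mu> \<phi>"
  using integral_distr[OF Y[of i] assms] integrable_distr_eq[OF Y[of i] assms]
    by (simp_all add: law)

text \<open>Chebyshev's inequality for the sum: independence removes the mixed terms of the
  variance, and the variance of one term is at most its second moment.\<close>

lemma second_moment:
  fixes \<phi> :: "'e \<Rightarrow> real"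
  assumes \<phi>: "\<phi> \<in> borel_measurable (borel_on E)" "\<And>x. \<bar>\<phi> x\<bar> \<le> C" and n: "0 < n" and \<delta>: "0 < \<delta>"
  shows "prob {\<omega>\<in>space P. real n * (\<integral>x. \<phi> x \<partial>\<mu>) + real n * \<delta> \<le> (\<Sum>i<n. \<phi> (Y i \<omega>))}
    \<le> (\<integral>x. (\<phi> x)\<^sup>2 \<partial>\<mu>) / (real n * \<delta>\<^sup>2)"
proof -
  interpret \<mu>: prob_space \<mu> by (rule P1D(1)[OF \<mu>])
  define c where "c = (\<integral>x. \<phi> x \<partial>\<mu>)"
  define Z where "Z i \<omega> = \<phi> (Y i \<omega>)" for i \<omega>
  define W where "W i \<omega> = Z i \<omega> - c" for i \<omega>
  have Zm[measurable]: "Z i \<in> borel_measurable P" for i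
    unfolding Z_def by (rule measurable_compose[OF Y \<phi>(1)])
  have \<phi>\<mu>: "\<phi> \<in> borel_measurable \<mu>" using \<phi>(1) P1D(2)[OF \<mu>] by (simp cong: measurable_cong_sets)
  have C0: "0 \<le> C" using \<phi>(2) abs_ge_zero order_trans by blast
  have Zb: "\<bar>Z i \<omega>\<bar> \<le> C" for i \<omega> by (simp add: Z_def \<phi>(2))
  have Wb: "\<bar>W i \<omega>\<bar> \<le> C + \<bar>c\<bar>" for i \<omega>
    using Zb[of i \<omega>] by (simp add: W_def)
  have Wm[measurable]: "W i \<in> borel_measurable P" for i unfolding W_def by measurable
  have Wi: "integrable P (W i)" for i
    by (rule integrable_const_bound[of _ "C + \<bar>c\<bar>"]) (use Wb in auto)
  have Zi: "integrable P (Z i)" for i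
    by (rule integrable_const_bound[of _ C]) (use Zb in auto)
  have EZ: "expectation (Z i) = c" for i
    unfolding Z_def c_def by (rule law_integral(1)[OF \<phi>(1)])
  have EW: "expectation (W i) = 0" for i
    unfolding W_def using EZ[of i] Zi[of i] by (simp add: prob_space)
  have iZZ: "integrable P (\<lambda>\<omega>. (Z i \<omega>)\<^sup>2)" for i
    by (rule integrable_const_bound[of _ "C\<^sup>2"]) (use Zb abs_le_square_iff C0 in \<open>auto simp:
      power2_le_iff_abs_le abs_le_square_iff[symmetric]\<close>)
  have iWW: "integrable P (\<lambda>\<omega>. W i \<omega> * W j \<omega>)" for i j
    by (rule integrable_const_bound[of _ "(C + \<bar>c\<bar>) * (C + \<bar>c\<bar>)"])
      (use C0 in \<open>auto simp: abs_mult intro!: AE_I2 mult_mono Wb\<close>)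
  have EWW: "expectation (\<lambda>\<omega>. W i \<omega> * W j \<omega>) = (if i = j then expectation (\<lambda>\<omega>. (W i \<omega>)\<^sup>2) else 0)"
    for i j
  proof (cases "i = j")
    case False
    have "indep_vars (\<lambda>_. borel) (\<lambda>i \<omega>. \<phi> (Y i \<omega>) - c) UNIV"
      by (rule indep_vars_compose2[OF indep]) (use \<phi>(1) in simp)
    then have "indep_vars (\<lambda>_. borel) W {i, j}"
      unfolding W_def Z_def by (rule indep_vars_subset) simp
    then have "expectation (\<lambda>\<omega>. \<Prod>l\<in>{i, j}. W l \<omega>) = (\<Prod>l\<in>{i, j}. expectation (W l))"
      by (intro indep_vars_lebesgue_integral Wi) auto
    then show ?thesis using False by (simp add: EW)
  qed (simp add: power2_eq_square)
  have WW: "expectation (\<lambda>\<omega>. (W i \<omega>)\<^sup>2) \<le> (\<integral>x. (\<phi> x)\<^sup>2 \<partial>\<mu>)" for i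
  proof -
    have "expectation (\<lambda>\<omega>. (W i \<omega>)\<^sup>2) = expectation (\<lambda>\<omega>. (Z i \<omega>)\<^sup>2 - 2 * c * Z i \<omega> + c\<^sup>2)"
      by (simp add: W_def power2_diff algebra_simps)
    also have "\<dots> = expectation (\<lambda>\<omega>. (Z i \<omega>)\<^sup>2) - c\<^sup>2"
      using iZZ[of i] Zi[of i] by (simp add: EZ prob_space power2_eq_square)
    also have "expectation (\<lambda>\<omega>. (Z i \<omega>)\<^sup>2) = (\<integral>x. (\<phi> x)\<^sup>2 \<partial>\<mu>)"
      unfolding Z_def using \<phi>(1) by (intro law_integral(1)) measurable
    finally show ?thesis by simp
  qed
  define S where "S \<omega> = (\<Sum>i<n. Z i \<omega>)" for \<omega>
  have Sm: "S \<in> borel_measurable P" unfolding S_def by measurable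
  have ES: "expectation S = real n * c" unfolding S_def using Zi by (simp add: EZ)
  have SW: "S \<omega> - real n * c = (\<Sum>i<n. W i \<omega>)" for \<omega>
    by (simp add: S_def W_def sum_subtractf)
  have Sb: "\<bar>S \<omega>\<bar> \<le> real n * C" for \<omega>
  proof -
    have "\<bar>S \<omega>\<bar> \<le> (\<Sum>i<n. \<bar>Z i \<omega>\<bar>)" unfolding S_def by (rule sum_abs)
    also have "\<dots> \<le> (\<Sum>i<n. C)" by (intro sum_mono Zb)
    finally show ?thesis by simp
  qed
  have S2: "integrable P (\<lambda>\<omega>. (S \<omega>)\<^sup>2)"
  proof (rule integrable_const_bound[of _ "(real n * C)\<^sup>2"])
    show "AE \<omega> in P. norm ((S \<omega>)\<^sup>2) \<le> (real n * C)\<^sup>2"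
      using Sb C0 by (auto intro!: AE_I2 simp: abs_le_square_iff[symmetric])
  qed (use Sm in measurable)
  have "variance S = expectation (\<lambda>\<omega>. (\<Sum>i<n. \<Sum>j<n. W i \<omega> * W j \<omega>))"
    unfolding ES SW by (simp add: power2_eq_square sum_product)
  also have "\<dots> = (\<Sum>i<n. \<Sum>j<n. expectation (\<lambda>\<omega>. W i \<omega> * W j \<omega>))"
    by (subst Bochner_Integration.integral_sum, intro Bochner_Integration.integrable_sum iWW,
        subst Bochner_Integration.integral_sum, rule iWW, rule refl)
  also have "\<dots> = (\<Sum>i<n. expectation (\<lambda>\<omega>. (W i \<omega>)\<^sup>2))"
    unfolding EWW by simp
  also have "\<dots> \<le> (\<Sum>i<n. (\<integral>x. (\<phi> x)\<^sup>2 \<partial>\<mu>))" by (intro sum_mono WW)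
  finally have var: "variance S \<le> real n * (\<integral>x. (\<phi> x)\<^sup>2 \<partial>\<mu>)" by simp
  have n\<delta>: "0 < real n * \<delta>" using n \<delta> by simp
  have "prob {\<omega>\<in>space P. real n * c + real n * \<delta> \<le> S \<omega>} \<le> prob {\<omega>\<in>space P. \<bar>S \<omega> - expectation S\<bar> \<ge>
    real n * \<delta>}"
    using Sm by (intro finite_measure_mono) (auto simp: ES)
  also have "\<dots> \<le> variance S / (real n * \<delta>)\<^sup>2"
    by (rule Chebyshev_inequality[OF Sm S2 n\<delta>])
  also have "\<dots> \<le> (real n * (\<integral>x. (\<phi> x)\<^sup>2 \<partial>\<mu>)) / (real n * \<delta>)\<^sup>2"
    by (intro divide_right_mono var) simp
  also have "\<dots> = (\<integral>x. (\<phi> x)\<^sup>2 \<partial>\<mu>) / (real n * \<delta>\<^sup>2)"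
    using n by (simp add: power2_eq_square)
  finally show ?thesis by (simp add: S_def c_def Z_def)
qed

text \<open>
  A strong law up to the constant 2: truncating at level \<open>2\<^sup>k\<close> along the sample sizes \<open>2\<^sup>k\<close>,
  both the truncation errors and the variances are summable for integrable \<open>g\<close>, and
  monotonicity of the partial sums fills the gaps.
\<close>

proposition strong_law_upper:
  fixes g :: "'e \<Rightarrow> real"
  assumes g: "g \<in> borel_measurable (borel_on E)" "\<And>x. 0 \<le> g x" "integrable \<mu> g" and \<delta>: "0 < \<delta>"
  shows "AE \<omega> in P. \<forall>\<^sub>F N in sequentially. (\<Sum>i<N. g (Y i \<omega>)) \<le> real N * (2 * ((\<integral>x. g x \<partial>\<mu>) + \<delta>))"
proof -
  interpret \<mu>: prob_space \<mu> by (rule P1D(1)[OF \<mu>])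
  note [measurable] = g(1)
  have g\<mu>[measurable]: "g \<in> borel_measurable \<mu>" using g(3) by simp
  define m where "m = (\<integral>x. g x \<partial>\<mu>)"
  have m0: "0 \<le> m" unfolding m_def using g(2) by simp
  define t where "t k x = (if g x \<le> 2 ^ k then g x else 0)" for k :: nat and x
  define I where "I k x = (if 2 ^ k < g x then 1 else 0 :: real)" for k :: nat and x
  have tm: "t k \<in> borel_measurable (borel_on E)" for k unfolding t_def by measurable
  have Im: "I k \<in> borel_measurable (borel_on E)" for k unfolding I_def by measurable
  have tm\<mu>[measurable]: "t k \<in> borel_measurable \<mu>" "I k \<in> borel_measurable \<mu>" for k
    using tm Im P1D(2)[OF \<mu>] by (simp_all cong: measurable_cong_sets)
  have tb: "\<bar>t k x\<bar> \<le> 2 ^ k" for k x using g(2)[of x] by (auto simp: t_def)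
  have ti: "integrable \<mu> (t k)" for k
    by (rule \<mu>.integrable_const_bound[of _ "2 ^ k"]) (use tb in auto)
  have t2i: "integrable \<mu> (\<lambda>x. (t k x)\<^sup>2)" for k
  proof (rule \<mu>.integrable_const_bound[of _ "(2 ^ k)\<^sup>2"])
    show "AE x in \<mu>. norm ((t k x)\<^sup>2) \<le> (2 ^ k)\<^sup>2"
    proof (rule AE_I2)
      fix x
      have "\<bar>t k x\<bar>\<^sup>2 \<le> (2 ^ k)\<^sup>2" by (rule power_mono[OF tb abs_ge_zero])
      then show "norm ((t k x)\<^sup>2) \<le> (2 ^ k)\<^sup>2" by simp
    qed
  qed measurable
  have Ii: "integrable \<mu> (I k)" for k
    by (rule \<mu>.integrable_const_bound[of _ 1]) (auto simp: I_def)
  define F where "F k = {\<omega>\<in>space P. real (2 ^ k) * (m + \<delta>) < (\<Sum>i<2^k. g (Y i \<omega>))}" for k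
  note Ygm[measurable] = measurable_compose[OF Y g(1)]
  have Fm[measurable]: "F k \<in> sets P" for k unfolding F_def by measurable
  have bound: "prob (F k) \<le> 2 ^ k * (\<integral>x. I k x \<partial>\<mu>) + (\<integral>x. (t k x)\<^sup>2 \<partial>\<mu>) / (2 ^ k * \<delta>\<^sup>2)" for k
  proof -
    define n :: nat where "n = 2 ^ k"
    have n0: "0 < n" and rn: "real n = 2 ^ k" by (simp_all add: n_def)
    define A where "A i = {\<omega>\<in>space P. 2 ^ k < g (Y i \<omega>)}" for i
    define D where "D = {\<omega>\<in>space P. real n * (\<integral>x. t k x \<partial>\<mu>) + real n * \<delta> \<le> (\<Sum>i<n. t k (Y i \<omega>))}"
    have Am: "A i \<in> sets P" for i unfolding A_def by measurable
    have Dm: "D \<in> sets P" unfolding D_def using measurable_compose[OF Y tm] by measurable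
    have tm': "(\<integral>x. t k x \<partial>\<mu>) \<le> m"
      unfolding m_def by (intro integral_mono ti g(3)) (use g(2) in \<open>auto simp: t_def\<close>)
    \<comment> \<open>Either one of the first \<open>2 ^ k\<close> values exceeds the truncation
      level, or the truncated sum deviates from its mean; the truncated mean is at most
      \<open>m\<close>.\<close>
    have "F k \<subseteq> (\<Union>i<n. A i) \<union> D"
    proof
      fix \<omega> assume \<omega>: "\<omega> \<in> F k"
      show "\<omega> \<in> (\<Union>i<n. A i) \<union> D"
      proof (cases "\<exists>i<n. \<omega> \<in> A i")
        case False
        have "g (Y i \<omega>) = t k (Y i \<omega>)" if "i < n" for i
          using False that \<omega> by (auto simp: A_def F_def t_def)
        then have eq: "(\<Sum>i<n. g (Y i \<omega>)) = (\<Sum>i<n. t k (Y i \<omega>))" by (intro sum.cong) auto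
        have "real n * (m + \<delta>) < (\<Sum>i<n. g (Y i \<omega>))" using \<omega> by (simp add: F_def n_def)
        moreover have "real n * ((\<integral>x. t k x \<partial>\<mu>) + \<delta>) \<le> real n * (m + \<delta>)"
          using tm' by (intro mult_left_mono) auto
        ultimately have "\<omega> \<in> D"
          using \<omega> unfolding D_def F_def eq by (simp add: distrib_left)
        then show ?thesis by simp
      qed auto
    qed
    then have "prob (F k) \<le> prob ((\<Union>i<n. A i) \<union> D)" using Am Dm by (intro finite_measure_mono) auto
    also have "\<dots> \<le> prob (\<Union>i<n. A i) + prob D" using Am Dm by (intro measure_Un_le) auto
    also have "prob (\<Union>i<n. A i) \<le> (\<Sum>i<n. prob (A i))"
      using Am by (intro measure_UNION_le) auto
    also have "(\<Sum>i<n. prob (A i)) = 2 ^ k * (\<integral>x. I k x \<partial>\<mu>)"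
    proof -
      have "prob (A i) = (\<integral>x. I k x \<partial>\<mu>)" for i
      proof -
        have "prob (A i) = (\<integral>\<omega>. indicator (A i) \<omega> \<partial>P)" using Am[of i] by simp
        also have "\<dots> = (\<integral>\<omega>. I k (Y i \<omega>) \<partial>P)"
          by (intro Bochner_Integration.integral_cong) (auto simp: A_def I_def indicator_def)
        finally show ?thesis using law_integral(1)[OF Im] by simp
      qed
      then show ?thesis by (simp add: rn)
    qed
    also have "prob D \<le> (\<integral>x. (t k x)\<^sup>2 \<partial>\<mu>) / (real n * \<delta>\<^sup>2)"
      unfolding D_def by (rule second_moment[OF tm tb n0 \<delta>])
    finally show ?thesis by (simp add: rn)
  qed
  have s1: "summable (\<lambda>k. 2 ^ k * (\<integral>x. I k x \<partial>\<mu>))"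
  proof (rule summableI_nonneg_bounded)
    show "0 \<le> 2 ^ k * (\<integral>x. I k x \<partial>\<mu>)" for k by (auto simp: I_def)
    fix K
    have "(\<Sum>k<K. 2 ^ k * (\<integral>x. I k x \<partial>\<mu>)) = (\<integral>x. (\<Sum>k<K. 2 ^ k * I k x) \<partial>\<mu>)"
      using Ii by (subst Bochner_Integration.integral_sum) auto
    also have "\<dots> \<le> (\<integral>x. 2 * g x \<partial>\<mu>)"
    proof (intro integral_mono Bochner_Integration.integrable_sum)
      show "integrable \<mu> (\<lambda>x. 2 ^ k * I k x)" for k using Ii[of k] by simp
      show "integrable \<mu> (\<lambda>x. 2 * g x)" using g(3) by simp
      show "(\<Sum>k<K. 2 ^ k * I k x) \<le> 2 * g x" for x
        unfolding I_def by (rule sum_geometric_below[OF g(2)])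
    qed
    finally show "(\<Sum>k<K. 2 ^ k * (\<integral>x. I k x \<partial>\<mu>)) \<le> (\<integral>x. 2 * g x \<partial>\<mu>)" .
  qed
  have s2: "summable (\<lambda>k. (\<integral>x. (t k x)\<^sup>2 \<partial>\<mu>) / 2 ^ k)"
  proof (rule summableI_nonneg_bounded)
    show "0 \<le> (\<integral>x. (t k x)\<^sup>2 \<partial>\<mu>) / 2 ^ k" for k by simp
    fix K
    have "(\<Sum>k<K. (\<integral>x. (t k x)\<^sup>2 \<partial>\<mu>) / 2 ^ k) = (\<integral>x. (\<Sum>k<K. (t k x)\<^sup>2 / 2 ^ k) \<partial>\<mu>)"
      using t2i by (subst Bochner_Integration.integral_sum) auto
    also have "\<dots> \<le> (\<integral>x. 2 * g x \<partial>\<mu>)"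
    proof (intro integral_mono Bochner_Integration.integrable_sum)
      show "integrable \<mu> (\<lambda>x. (t k x)\<^sup>2 / 2 ^ k)" for k using t2i by simp
      show "integrable \<mu> (\<lambda>x. 2 * g x)" using g(3) by simp
      fix x
      have "(\<Sum>k<K. (t k x)\<^sup>2 / 2 ^ k) = g x * (\<Sum>k<K. (if g x \<le> 2 ^ k then g x / 2 ^ k else 0))"
        unfolding sum_distrib_left by (intro sum.cong) (auto simp: t_def power2_eq_square)
      also have "\<dots> \<le> g x * 2" using sum_geometric_above[OF g(2)] g(2) by (intro mult_left_mono)
      finally show "(\<Sum>k<K. (t k x)\<^sup>2 / 2 ^ k) \<le> 2 * g x" by simp
    qed
    finally show "(\<Sum>k<K. (\<integral>x. (t k x)\<^sup>2 \<partial>\<mu>) / 2 ^ k) \<le> (\<integral>x. 2 * g x \<partial>\<mu>)" .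
  qed
  have "summable (\<lambda>k. 2 ^ k * (\<integral>x. I k x \<partial>\<mu>) + (\<integral>x. (t k x)\<^sup>2 \<partial>\<mu>) / 2 ^ k * (1 / \<delta>\<^sup>2))"
    by (intro summable_add s1 summable_mult2 s2)
  then have sF: "summable (\<lambda>k. prob (F k))"
    by (rule summable_comparison_test'[where N = 0]) (use bound in simp)
  have "AE \<omega> in P. \<forall>\<^sub>F k in sequentially. \<omega> \<in> space P - F k"
    by (rule borel_cantelli_AE1[OF Fm _ sF]) (simp add: emeasure_eq_measure)
  then show ?thesis
  proof eventually_elim
    case (elim \<omega>)
    then obtain k0 where k0: "\<And>k. k \<ge> k0 \<Longrightarrow> \<omega> \<in> space P - F k"
      by (auto simp: eventually_sequentially)
    show ?case
      unfolding eventually_sequentially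
    proof (intro exI[of _ "2 ^ k0"] allI impI)
      fix N :: nat assume N: "2 ^ k0 \<le> N"
      then have "1 \<le> N" using one_le_power[of "2::nat" k0] by linarith
      \<comment> \<open>The sample size lies between two powers of 2 and its sum is bounded by the
        sum at the upper one, at most twice as large an index: this is the loss of the factor
        2.\<close>
      then obtain k where k: "2 ^ k \<le> N" "N < 2 ^ (k + 1)" using ex_power_ivl1[of 2 N] by auto
      have lt: "(2::nat) ^ k0 < 2 ^ (k + 1)" using N k by linarith
      have "k0 \<le> k + 1" by (rule less_imp_le[OF power_less_imp_less_exp[OF _ lt]]) simp
      then have "\<omega> \<in> space P - F (k + 1)" by (rule k0)
      then have "(\<Sum>i<2^(k+1). g (Y i \<omega>)) \<le> real (2 ^ (k + 1)) * (m + \<delta>)"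
        unfolding F_def by auto
      moreover have "(\<Sum>i<N. g (Y i \<omega>)) \<le> (\<Sum>i<2^(k+1). g (Y i \<omega>))"
        using k(2) g(2) by (intro sum_mono2) auto
      moreover have "real (2 ^ (k + 1)) * (m + \<delta>) \<le> (2 * real N) * (m + \<delta>)"
      proof (rule mult_right_mono)
        have "real (2 ^ k) \<le> real N" using k(1) by (simp only: of_nat_le_iff)
        then show "real (2 ^ (k + 1)) \<le> 2 * real N" by simp
      qed (use m0 \<delta> in simp)
      moreover have "(2 * real N) * (m + \<delta>) = real N * (2 * ((\<integral>x. g x \<partial>\<mu>) + \<delta>))"
        by (simp add: m_def)
      ultimately show "(\<Sum>i<N. g (Y i \<omega>)) \<le> real N * (2 * ((\<integral>x. g x \<partial>\<mu>) + \<delta>))"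
        by linarith
    qed
  qed
qed

text \<open>Indicators are bounded, so Hoeffding's inequality gives geometrically small deviation
  probabilities and Borel-Cantelli applies. Countably many tolerances
  \<open>1 / real (Suc j)\<close> keep the exceptional set null.\<close>

lemma frequency_converges:
  assumes A: "A \<in> sets (borel_on E)"
  shows "AE \<omega> in P. (\<lambda>N. (\<Sum>i<N. indicator A (Y i \<omega>)) / real N) \<longlonglongrightarrow> measure \<mu> A"
proof -
  define X where "X i \<omega> = (indicator A (Y i \<omega>) :: real)" for i \<omega>
  have ind: "(indicator A :: 'e \<Rightarrow> real) \<in> borel_measurable (borel_on E)" using A by simp
  have Xm[measurable]: "X i \<in> borel_measurable P" for i
    unfolding X_def by (rule measurable_compose[OF Y ind])
  have EX: "expectation (X i) = measure \<mu> A" for i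
    unfolding X_def using law_integral(1)[OF ind, of i] A P1D(2)[OF \<mu>]
      sets.sets_into_space[of A \<mu>] P1D(1)[OF \<mu>]
    by (simp add: Int_absorb2)
  have "AE \<omega> in P. \<forall>j. \<forall>\<^sub>F N in sequentially. \<bar>(\<Sum>i<N. X i \<omega>) / real N - measure \<mu> A\<bar>
    < 1 / real (Suc j)"
  proof (intro AE_all_countable[THEN iffD2] allI)
    fix j
    define \<epsilon> where "\<epsilon> = 1 / real (Suc j)"
    have \<epsilon>: "\<epsilon> > 0" by (simp add: \<epsilon>_def)
    \<comment> \<open>The sample size is shifted to \<open>Suc N\<close>, since Hoeffding's
      inequality and the division ask for a nonempty sample; the shift is undone at the end.\<close>
    define F where "F N = {\<omega>\<in>space P. \<bar>(\<Sum>i<Suc N. X i \<omega>) / real (Suc N) - measure \<mu> A\<bar> \<ge> \<epsilon>}" for N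
    have Fm: "F N \<in> sets P" for N unfolding F_def by measurable
    have pb: "prob (F N) \<le> 2 * exp (-2 * \<epsilon>\<^sup>2) ^ Suc N" for N
    proof -
      interpret H: Hoeffding_ineq_iid P "{..<Suc N}" X "X 0" 0 1 "expectation (X 0)"
      proof unfold_locales
        have "indep_vars (\<lambda>_. borel) (\<lambda>i \<omega>. indicator A (Y i \<omega>) :: real) UNIV"
          by (rule indep_vars_compose2[OF indep]) (use ind in simp)
        then show "indep_vars (\<lambda>_. borel) X {..<Suc N}"
          unfolding X_def by (rule indep_vars_subset) simp
        show "distr P borel (X i) = distr P borel (X 0)" for i
        proof -
          have "distr P borel (X l) = distr (distr P (borel_on E) (Y l)) borel (indicator A)" for l
            unfolding X_def by (subst distr_distr[OF ind Y]) (simp add: comp_def)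
          then show ?thesis by (simp add: law)
        qed
        show "AE x in P. X 0 x \<in> {0..1}" by (auto simp: X_def indicator_def)
      qed auto
      have pb: "prob (F N) \<le> 2 * exp (-2 * real (card {..<Suc N}) * \<epsilon>\<^sup>2 / (1 - 0)\<^sup>2)"
        unfolding F_def using H.Hoeffding_ineq_abs_ge'[of \<epsilon>] \<epsilon> by (simp add: EX lessThan_empty_iff)
      also have "\<dots> = 2 * exp (-2 * \<epsilon>\<^sup>2) ^ Suc N"
        by (simp add: exp_of_nat_mult[symmetric] algebra_simps del: power_Suc)
      finally show ?thesis .
    qed
    have sg: "summable (\<lambda>N. 2 * exp (-2 * \<epsilon>\<^sup>2) ^ Suc N)"
      using \<epsilon> by (intro summable_mult, subst summable_Suc_iff) (auto intro!: summable_geometric)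
    have "summable (\<lambda>N. prob (F N))"
      by (rule summable_comparison_test'[OF sg, of 0])
        (simp only: real_norm_def abs_of_nonneg[OF measure_nonneg] pb)
    then have "AE \<omega> in P. \<forall>\<^sub>F N in sequentially. \<omega> \<in> space P - F N"
      by (intro borel_cantelli_AE1 Fm) (auto simp: emeasure_eq_measure)
    then show "AE \<omega> in P. \<forall>\<^sub>F N in sequentially. \<bar>(\<Sum>i<N. X i \<omega>) / real N - measure \<mu> A\<bar>
      < 1 / real (Suc j)"
    proof eventually_elim
      case (elim \<omega>)
      then have "\<forall>\<^sub>F N in sequentially. \<bar>(\<Sum>i<Suc N. X i \<omega>) / real (Suc N) - measure \<mu> A\<bar>
        < 1 / real (Suc j)"
        by eventually_elim (auto simp: F_def \<epsilon>_def)
      then show ?case by (subst (asm) eventually_sequentially_Suc)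
    qed
  qed
  then show ?thesis
  proof eventually_elim
    case (elim \<omega>)
    show ?case
    proof (rule tendstoI)
      fix \<epsilon> :: real assume "\<epsilon> > 0"
      then obtain j where j: "1 / real (Suc j) < \<epsilon>" using nat_approx_posE by blast
      show "\<forall>\<^sub>F N in sequentially. dist ((\<Sum>i<N. indicator A (Y i \<omega>)) / real N) (measure \<mu> A) < \<epsilon>"
        using elim[rule_format, of j] by eventually_elim (use j in \<open>simp add: dist_real_def X_def\<close>)
    qed
  qed
qed

end

section \<open>A coupling along a finite partition\<close>

lemma integral_cells:
  fixes \<kappa> :: "'a \<Rightarrow> nat" and u :: "nat \<Rightarrow> real"
  assumes "prob_space \<alpha>" and \<kappa>[measurable]: "\<kappa> \<in> measurable \<alpha> (count_space UNIV)"
    and K: "\<And>x. x \<in> space \<alpha> \<Longrightarrow> \<kappa> x \<le> K"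
  shows "integrable \<alpha> (\<lambda>x. u (\<kappa> x))"
    "(\<integral>x. u (\<kappa> x) \<partial>\<alpha>) = (\<Sum>i\<le>K. u i * measure \<alpha> {x \<in> space \<alpha>. \<kappa> x = i})"
proof -
  interpret prob_space \<alpha> by fact
  have eq: "u (\<kappa> x) = (\<Sum>i\<le>K. u i * indicator {x \<in> space \<alpha>. \<kappa> x = i} x)" if "x \<in> space \<alpha>" for x
  proof -
    have "(\<Sum>i\<le>K. u i * indicator {x \<in> space \<alpha>. \<kappa> x = i} x) = (\<Sum>i\<le>K. if i = \<kappa> x then u i else 0)"
      using that by (intro sum.cong) (auto simp: indicator_def)
    then show ?thesis using K[OF that] by simp
  qed
  have i: "integrable \<alpha> (\<lambda>x. u i * indicator {x \<in> space \<alpha>. \<kappa> x = i} x)" for i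
    by (intro integrable_mult_right integrable_real_indicator)
      (measurable, simp add: less_top[symmetric])
  have "integrable \<alpha> (\<lambda>x. \<Sum>i\<le>K. u i * indicator {x \<in> space \<alpha>. \<kappa> x = i} x)"
    by (intro Bochner_Integration.integrable_sum i)
  then show "integrable \<alpha> (\<lambda>x. u (\<kappa> x))"
    using eq by (subst Bochner_Integration.integrable_cong) auto
  have "(\<integral>x. u (\<kappa> x) \<partial>\<alpha>) = (\<integral>x. (\<Sum>i\<le>K. u i * indicator {x \<in> space \<alpha>. \<kappa> x = i} x) \<partial>\<alpha>)"
    using eq by (intro Bochner_Integration.integral_cong) auto
  also have "\<dots> = (\<Sum>i\<le>K. u i * measure \<alpha> {x \<in> space \<alpha>. \<kappa> x = i})"
    using i by (subst Bochner_Integration.integral_sum) auto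
  finally show "(\<integral>x. u (\<kappa> x) \<partial>\<alpha>) = (\<Sum>i\<le>K. u i * measure \<alpha> {x \<in> space \<alpha>. \<kappa> x = i})" .
qed

text \<open>
  The coupling keeps the proportion \<open>\<theta>\<close> of the mass inside the cells of a finite partition, where
  it is moved by at most \<open>\<epsilon>\<close>, and couples the rest independently; cell \<open>K\<close> is the unbounded one.
\<close>

lemma d1_le_partition:
  fixes \<kappa> :: "'e::real_normed_vector \<Rightarrow> nat"
  assumes \<alpha>: "\<alpha> \<in> P1 E" and \<mu>: "\<mu> \<in> P1 E" and E: "small_partitions E"
    and \<kappa>: "\<kappa> \<in> measurable (borel_on E) (count_space UNIV)" "\<And>x. \<kappa> x \<le> K"
    and \<epsilon>: "0 \<le> \<epsilon>" "\<And>x y. x \<in> E \<Longrightarrow> y \<in> E \<Longrightarrow> \<kappa> x = \<kappa> y \<Longrightarrow> \<kappa> x < K \<Longrightarrow> dist x y \<le> \<epsilon>"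
    and R: "0 \<le> R" "\<And>x. x \<in> E \<Longrightarrow> \<kappa> x < K \<Longrightarrow> norm x \<le> R"
    and \<theta>: "0 \<le> \<theta>" "\<theta> \<le> 1"
      "\<And>i. i \<le> K \<Longrightarrow> \<theta> * measure \<mu> {x \<in> E. \<kappa> x = i} \<le> measure \<alpha> {x \<in> E. \<kappa> x = i}"
  defines "tail \<equiv> \<lambda>x. if \<kappa> x = K then norm x else 0"
  shows "d1 \<alpha> \<mu> \<le> \<epsilon> + 2 * (\<integral>x. tail x \<partial>\<alpha>) + (\<integral>x. tail x \<partial>\<mu>) + (1 - \<theta>) * (R + (\<integral>x. norm x \<partial>\<mu>))"
proof -
  interpret \<alpha>: prob_space \<alpha> by (rule P1D(1)[OF \<alpha>])
  interpret \<mu>: prob_space \<mu> by (rule P1D(1)[OF \<mu>])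
  interpret pair_sigma_finite \<alpha> \<mu> ..
  have sp: "space \<alpha> = E" "space \<mu> = E" by (rule P1D(3)[OF \<alpha>], rule P1D(3)[OF \<mu>])
  have \<kappa>m[measurable]: "\<kappa> \<in> measurable \<alpha> (count_space UNIV)" "\<kappa> \<in> measurable \<mu> (count_space UNIV)"
    using \<kappa>(1) P1D(2)[OF \<alpha>] P1D(2)[OF \<mu>] by (simp_all cong: measurable_cong_sets)
  define p where "p i = measure \<alpha> {x \<in> E. \<kappa> x = i}" for i
  define q where "q i = measure \<mu> {x \<in> E. \<kappa> x = i}" for i
  have \<theta>q: "\<theta> * q i \<le> p i" if "i \<le> K" for i using \<theta>(3)[OF that] by (simp add: p_def q_def)
  have p0: "0 \<le> p i" and q0: "0 \<le> q i" for i by (simp_all add: p_def q_def)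
  have cells: "integrable \<alpha> (\<lambda>x. w (\<kappa> x))" "(\<integral>x. w (\<kappa> x) \<partial>\<alpha>) = (\<Sum>i\<le>K. w i * p i)"
    "integrable \<mu> (\<lambda>x. w (\<kappa> x))" "(\<integral>x. w (\<kappa> x) \<partial>\<mu>) = (\<Sum>i\<le>K. w i * q i)" for w :: "nat \<Rightarrow> real"
    using integral_cells[OF \<alpha>.prob_space_axioms \<kappa>m(1) \<kappa>(2), of w]
      integral_cells[OF \<mu>.prob_space_axioms \<kappa>m(2) \<kappa>(2), of w]
    by (simp_all add: sp p_def q_def)
  have pick: "(\<Sum>i\<le>K. (if j = i then w i else 0) * v i) = w j * v j" if "j \<le> K"
    for w v :: "nat \<Rightarrow> real" and j
  proof -
    have "(\<Sum>i\<le>K. (if j = i then w i else 0) * v i) = (\<Sum>i\<le>K. if j = i then w i * v i else 0)"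
      by (intro sum.cong) auto
    then show ?thesis using that by simp
  qed
  \<comment> \<open>The share of the \<alpha>-mass of cell \<open>i\<close> that is paired within
    the cell. For \<open>p i = 0\<close> division yields 0, which is consistent, as then
    \<open>\<theta> * q i = 0\<close> too.\<close>
  define u where "u i = \<theta> * q i / p i" for i
  have u01: "0 \<le> u i" "u i \<le> 1" if "i \<le> K" for i
    using \<theta>q[OF that] \<theta>(1) p0[of i] q0[of i] by (auto simp: u_def divide_le_eq_1)
  have up: "u i * p i = \<theta> * q i" if "i \<le> K" for i
    using \<theta>q[OF that] \<theta>(1) q0[of i] mult_nonneg_nonneg[OF \<theta>(1) q0[of i]]
      by (cases "p i = 0") (auto simp: u_def)
  have sumq: "(\<Sum>i\<le>K. q i) = 1" using cells(4)[of "\<lambda>_. 1"] by (simp add: \<mu>.prob_space)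
  have Eu: "(\<integral>x. u (\<kappa> x) \<partial>\<alpha>) = \<theta>"
  proof -
    have "(\<integral>x. u (\<kappa> x) \<partial>\<alpha>) = (\<Sum>i\<le>K. \<theta> * q i)" unfolding cells(2) by (intro sum.cong) (auto simp: up)
    then show ?thesis by (simp add: sumq flip: sum_distrib_left)
  qed
  \<comment> \<open>On a diagonal block the density \<open>\<theta> / p i\<close> pairs \<alpha> and
    \<mu> within cell \<open>i\<close> with mass \<open>\<theta> * q i\<close>; the rest of
    \<alpha>, of density \<open>1 - u i\<close>, is paired with an independent \<mu>. Integrating
    over y gives u + (1 - u), integrating over x gives \<theta> + (1 - \<theta>).\<close>
  define g where "g z = (if \<kappa> (fst z) = \<kappa> (snd z) then \<theta> / p (\<kappa> (fst z)) else 0) +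
    (1 - u (\<kappa> (fst z)))"
    for z :: "'e \<times> 'e"
  have g1: "1 - u (\<kappa> (fst z)) \<le> g z" for z using p0 \<theta>(1) by (simp add: g_def)
  have g0: "0 \<le> g z" for z using g1[of z] u01(2)[OF \<kappa>(2)[of "fst z"]] by simp
  have gm[measurable]: "g \<in> borel_measurable (\<alpha> \<Otimes>\<^sub>M \<mu>)"
  proof -
    have "(\<lambda>z. (\<lambda>(k, l). (if k = l then \<theta> / p k else 0) + (1 - u k)) (\<kappa> (fst z), \<kappa> (snd z))) \<in>
      borel_measurable (\<alpha> \<Otimes>\<^sub>M \<mu>)"
    proof (rule measurable_compose[where N = "count_space UNIV \<Otimes>\<^sub>M count_space UNIV"])
      show "(\<lambda>z. (\<kappa> (fst z), \<kappa> (snd z))) \<in> measurable (\<alpha> \<Otimes>\<^sub>M \<mu>)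
        (count_space UNIV \<Otimes>\<^sub>M count_space UNIV)"
        by measurable
    qed (simp add: pair_measure_countable)
    then show ?thesis by (simp add: g_def[abs_def])
  qed
  define m where "m = density (\<alpha> \<Otimes>\<^sub>M \<mu>) (\<lambda>z. ennreal (g z))"
  have m: "m \<in> couplings \<alpha> \<mu>"
    unfolding m_def
  proof (rule density_coupling[OF \<alpha>.prob_space_axioms \<mu>.prob_space_axioms])
    show "(\<lambda>z. ennreal (g z)) \<in> borel_measurable (\<alpha> \<Otimes>\<^sub>M \<mu>)" by measurable
    show "AE x in \<alpha>. (\<integral>\<^sup>+y. ennreal (g (x, y)) \<partial>\<mu>) = 1"
    proof (rule AE_I2)
      fix x
      define w where "w i = (if \<kappa> x = i then \<theta> / p i else 0) + (1 - u (\<kappa> x))" for i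
      have gw: "g (x, y) = w (\<kappa> y)" for y by (auto simp: g_def w_def)
      have "(\<integral>y. g (x, y) \<partial>\<mu>) = (\<Sum>i\<le>K. (if \<kappa> x = i then \<theta> / p i else 0) * q i) + (1 - u (\<kappa> x)) *
        (\<Sum>i\<le>K. q i)"
        unfolding gw cells(4)[of w] by (simp add: w_def distrib_right sum.distrib sum_distrib_left)
      also have "\<dots> = 1" unfolding pick[OF \<kappa>(2)] sumq by (simp add: u_def)
      finally have "(\<integral>y. g (x, y) \<partial>\<mu>) = 1" .
      moreover have "integrable \<mu> (\<lambda>y. g (x, y))" unfolding gw by (rule cells(3))
      ultimately show "(\<integral>\<^sup>+y. ennreal (g (x, y)) \<partial>\<mu>) = 1"
        using g0 by (subst nn_integral_eq_integral) auto
    qed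
    \<comment> \<open>Cells of \<mu>-mass 0 have to be left out: there \<open>p\<close> may vanish,
      and the integral over x would then be \<open>1 - \<theta>\<close> instead of 1.\<close>
    have AEq: "AE y in \<mu>. q (\<kappa> y) \<noteq> 0"
    proof -
      have "AE y in \<mu>. \<forall>k. q k = 0 \<longrightarrow> \<kappa> y \<noteq> k"
      proof (intro AE_all_countable[THEN iffD2] allI)
        fix k
        show "AE y in \<mu>. q k = 0 \<longrightarrow> \<kappa> y \<noteq> k"
        proof (cases "q k = 0")
          case True
          have "{x \<in> space \<mu>. \<kappa> x = k} \<in> sets \<mu>" by measurable
          with True have "AE y in \<mu>. y \<notin> {x \<in> space \<mu>. \<kappa> x = k}"
            by (intro AE_not_in null_setsI) (simp_all add: q_def sp \<mu>.emeasure_eq_measure)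
          then show ?thesis using AE_space by eventually_elim auto
        qed simp
      qed
      then show ?thesis by eventually_elim auto
    qed
    show "AE y in \<mu>. (\<integral>\<^sup>+x. ennreal (g (x, y)) \<partial>\<alpha>) = 1"
      using AEq
    proof eventually_elim
      case (elim y)
      define w where "w i = (if \<kappa> y = i then \<theta> / p i else 0) + (1 - u i)" for i
      have gw: "g (x, y) = w (\<kappa> x)" for x by (auto simp: g_def w_def)
      have "\<theta> / p (\<kappa> y) * p (\<kappa> y) = \<theta>"
        using \<theta>q[OF \<kappa>(2)[of y]] elim q0[of "\<kappa> y"] \<theta>(1)
        by (cases "p (\<kappa> y) = 0") (auto simp: mult_le_0_iff)
      moreover have "(\<integral>x. (if \<kappa> y = \<kappa> x then \<theta> / p (\<kappa> x) else 0) \<partial>\<alpha>) = \<theta> / p (\<kappa> y) * p (\<kappa> y)"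
        unfolding cells(2)[of "\<lambda>i. if \<kappa> y = i then \<theta> / p i else 0"] by (rule pick[OF \<kappa>(2)])
      moreover have "(\<integral>x. w (\<kappa> x) \<partial>\<alpha>) = (\<integral>x. (if \<kappa> y = \<kappa> x then \<theta> / p (\<kappa> x) else 0) \<partial>\<alpha>) +
        (1 - (\<integral>x. u (\<kappa> x) \<partial>\<alpha>))"
        unfolding w_def using cells(1)[of "\<lambda>i. if \<kappa> y = i then \<theta> / p i else 0"] cells(1)[of u]
        by (simp add: \<alpha>.prob_space)
      ultimately have "(\<integral>x. g (x, y) \<partial>\<alpha>) = 1" unfolding gw Eu by simp
      moreover have "integrable \<alpha> (\<lambda>x. g (x, y))" unfolding gw by (rule cells(1))
      ultimately show ?case
        using g0 by (subst nn_integral_eq_integral) auto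
    qed
  qed
  have pc: "\<alpha> \<Otimes>\<^sub>M \<mu> \<in> couplings \<alpha> \<mu>"
    by (rule pair_coupling[OF \<alpha>.prob_space_axioms \<mu>.prob_space_axioms])
  have tail0: "0 \<le> tail x" and tailn: "tail x \<le> norm x" for x by (simp_all add: tail_def)
  have nm[measurable]: "norm \<in> borel_measurable \<alpha>" "norm \<in> borel_measurable \<mu>"
    using P1D(4)[OF \<alpha>] P1D(4)[OF \<mu>] by auto
  have ti: "integrable \<alpha> tail" "integrable \<mu> tail"
    by (rule Bochner_Integration.integrable_bound[OF P1D(4)[OF \<alpha>]], auto simp: tail_def)
      (rule Bochner_Integration.integrable_bound[OF P1D(4)[OF \<mu>]], auto simp: tail_def)
  define c where "c = (\<integral>x. norm x \<partial>\<mu>)"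
  \<comment> \<open>The three costs: \<open>A\<close> bounds the distance within a common cell,
    while \<open>D\<close> and \<open>F\<close> bound the two norms when the cells differ and only
    the independent part of the density is present. The tail of \<alpha> enters through
    \<open>A\<close> and \<open>D\<close>, hence its coefficient 2.\<close>
  define A where "A z = \<epsilon> + tail (fst z) + tail (snd z)" for z :: "'e \<times> 'e"
  define D where "D z = (1 - u (\<kappa> (fst z))) * (R + tail (fst z))" for z :: "'e \<times> 'e"
  define F where "F z = (1 - u (\<kappa> (fst z))) * norm (snd z)" for z :: "'e \<times> 'e"
  have Ai: "integrable m A" "(\<integral>z. A z \<partial>m) = \<epsilon> + (\<integral>x. tail x \<partial>\<alpha>) + (\<integral>x. tail x \<partial>\<mu>)"
  proof -
    interpret m: prob_space m by (rule couplings_prob[OF m \<alpha>.prob_space_axioms])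
    note t = couplings_integral(3)[OF m ti(1)] couplings_integral(4)[OF m ti(2)]
    show "integrable m A" unfolding A_def using t by simp
    show "(\<integral>z. A z \<partial>m) = \<epsilon> + (\<integral>x. tail x \<partial>\<alpha>) + (\<integral>x. tail x \<partial>\<mu>)"
      unfolding A_def using t couplings_integral(1)[OF m, of tail]
        couplings_integral(2)[OF m, of tail] ti
      by (simp add: m.prob_space)
  qed
  have Am: "A \<in> borel_measurable (\<alpha> \<Otimes>\<^sub>M \<mu>)"
    unfolding A_def using ti by measurable
  have gA: "integrable (\<alpha> \<Otimes>\<^sub>M \<mu>) (\<lambda>z. g z * A z)" "(\<integral>z. g z * A z \<partial>(\<alpha> \<Otimes>\<^sub>M \<mu>)) = (\<integral>z. A z \<partial>m)"
    using Ai(1) Am gm g0 unfolding m_def by (simp_all add: integrable_density integral_density)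
  have uu: "integrable \<alpha> (\<lambda>x. 1 - u (\<kappa> x))" "(\<integral>x. 1 - u (\<kappa> x) \<partial>\<alpha>) = 1 - \<theta>"
    using cells(1)[of u] Eu by (simp_all add: \<alpha>.prob_space)
  have dx: "integrable \<alpha> (\<lambda>x. (1 - u (\<kappa> x)) * (R + tail x))"
    "(\<integral>x. (1 - u (\<kappa> x)) * (R + tail x) \<partial>\<alpha>) \<le> (1 - \<theta>) * R + (\<integral>x. tail x \<partial>\<alpha>)"
  proof -
    have le: "(1 - u (\<kappa> x)) * (R + tail x) \<le> (1 - u (\<kappa> x)) * R + tail x" for x
      using u01[OF \<kappa>(2)[of x]] tail0[of x] by (simp add: algebra_simps)
    have nn: "0 \<le> (1 - u (\<kappa> x)) * (R + tail x)" for x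
      using u01[OF \<kappa>(2)[of x]] tail0[of x] R(1) by simp
    have i: "integrable \<alpha> (\<lambda>x. (1 - u (\<kappa> x)) * R + tail x)" using uu ti by simp
    show j: "integrable \<alpha> (\<lambda>x. (1 - u (\<kappa> x)) * (R + tail x))"
    proof (rule Bochner_Integration.integrable_bound[OF i])
      show "(\<lambda>x. (1 - u (\<kappa> x)) * (R + tail x)) \<in> borel_measurable \<alpha>"
        using borel_measurable_integrable[OF uu(1)] borel_measurable_integrable[OF ti(1)]
          by measurable
      show "AE x in \<alpha>. norm ((1 - u (\<kappa> x)) * (R + tail x)) \<le> norm ((1 - u (\<kappa> x)) * R + tail x)"
      proof (rule AE_I2)
        fix x
        show "norm ((1 - u (\<kappa> x)) * (R + tail x)) \<le> norm ((1 - u (\<kappa> x)) * R + tail x)"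
          using le[of x] nn[of x] unfolding real_norm_def by linarith
      qed
    qed
    have "(\<integral>x. (1 - u (\<kappa> x)) * (R + tail x) \<partial>\<alpha>) \<le> (\<integral>x. (1 - u (\<kappa> x)) * R + tail x \<partial>\<alpha>)"
      by (rule integral_mono[OF j i le])
    also have "\<dots> = (1 - \<theta>) * R + (\<integral>x. tail x \<partial>\<alpha>)" using uu ti by simp
    finally show "(\<integral>x. (1 - u (\<kappa> x)) * (R + tail x) \<partial>\<alpha>) \<le> (1 - \<theta>) * R + (\<integral>x. tail x \<partial>\<alpha>)" .
  qed
  have Di: "integrable (\<alpha> \<Otimes>\<^sub>M \<mu>) D" "(\<integral>z. D z \<partial>(\<alpha> \<Otimes>\<^sub>M \<mu>)) \<le> (1 - \<theta>) * R + (\<integral>x. tail x \<partial>\<alpha>)"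
    using couplings_integral(3)[OF pc dx(1)]
      couplings_integral(1)[OF pc, of "\<lambda>x. (1 - u (\<kappa> x)) * (R + tail x)"]
      borel_measurable_integrable[OF dx(1)] dx(2)
    unfolding D_def by simp_all
  have ny: "integrable (\<alpha> \<Otimes>\<^sub>M \<mu>) (\<lambda>z. norm (snd z))"
    by (rule couplings_integral(4)[OF pc P1D(4)[OF \<mu>]])
  have Fi: "integrable (\<alpha> \<Otimes>\<^sub>M \<mu>) F"
  proof (rule Bochner_Integration.integrable_bound[OF ny])
    show "F \<in> borel_measurable (\<alpha> \<Otimes>\<^sub>M \<mu>)"
      unfolding F_def using borel_measurable_integrable[OF uu(1)] by measurable
    show "AE z in \<alpha> \<Otimes>\<^sub>M \<mu>. norm (F z) \<le> norm (norm (snd z))"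
    proof (rule AE_I2)
      fix z :: "'e \<times> 'e"
      have "\<bar>1 - u (\<kappa> (fst z))\<bar> \<le> 1" using u01[OF \<kappa>(2)[of "fst z"]] by simp
      then have "\<bar>1 - u (\<kappa> (fst z))\<bar> * norm (snd z) \<le> 1 * norm (snd z)"
        by (rule mult_right_mono) simp
      then show "norm (F z) \<le> norm (norm (snd z))" by (simp add: F_def abs_mult)
    qed
  qed
  have F: "(\<integral>z. F z \<partial>(\<alpha> \<Otimes>\<^sub>M \<mu>)) = (1 - \<theta>) * c"
  proof -
    have "(\<integral>z. F z \<partial>(\<alpha> \<Otimes>\<^sub>M \<mu>)) = (\<integral>x. (\<integral>y. F (x, y) \<partial>\<mu>) \<partial>\<alpha>)"
      by (rule integral_fst'[OF Fi, symmetric])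
    also have "\<dots> = (\<integral>x. (1 - u (\<kappa> x)) * c \<partial>\<alpha>)" by (simp add: F_def c_def)
    also have "\<dots> = (1 - \<theta>) * c" using uu by simp
    finally show ?thesis .
  qed
  note dc = dist_coupling[OF E \<alpha> \<mu> m] and dp = dist_coupling(1)[OF E \<alpha> \<mu> pc]
  have gd: "integrable (\<alpha> \<Otimes>\<^sub>M \<mu>) (\<lambda>z. g z * dist (fst z) (snd z))"
    "(\<integral>z. dist (fst z) (snd z) \<partial>m) = (\<integral>z. g z * dist (fst z) (snd z) \<partial>(\<alpha> \<Otimes>\<^sub>M \<mu>))"
    using dc(2) dp gm g0 unfolding m_def by (simp_all add: integrable_density integral_density)
  have "d1 \<alpha> \<mu> \<le> (\<integral>z. dist (fst z) (snd z) \<partial>m)" by (rule d1_le[OF m])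
  also have "\<dots> \<le> (\<integral>z. g z * A z + D z + F z \<partial>(\<alpha> \<Otimes>\<^sub>M \<mu>))"
    unfolding gd(2)
  proof (rule integral_mono[OF gd(1)])
    show "integrable (\<alpha> \<Otimes>\<^sub>M \<mu>) (\<lambda>z. g z * A z + D z + F z)" using gA(1) Di(1) Fi by simp
    fix z assume "z \<in> space (\<alpha> \<Otimes>\<^sub>M \<mu>)"
    then have z: "fst z \<in> E" "snd z \<in> E" by (auto simp: space_pair_measure sp)
    have D0: "0 \<le> D z" "0 \<le> F z" using u01[OF \<kappa>(2)[of "fst z"]] tail0[of "fst z"] R(1)
      by (simp_all add: D_def F_def)
    have dn: "dist (fst z) (snd z) \<le> norm (fst z) + norm (snd z)"
      by (simp add: dist_norm norm_triangle_ineq4)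
    show "g z * dist (fst z) (snd z) \<le> g z * A z + D z + F z"
    proof (cases "\<kappa> (fst z) = \<kappa> (snd z)")
      case True
      have "dist (fst z) (snd z) \<le> A z"
      proof (cases "\<kappa> (fst z) = K")
        case True
        with \<open>\<kappa> (fst z) = \<kappa> (snd z)\<close> show ?thesis using dn \<epsilon>(1) by (simp add: A_def tail_def)
      next
        case False
        then have "\<kappa> (fst z) < K" using \<kappa>(2)[of "fst z"] by simp
        then show ?thesis using \<epsilon>(2)[OF z True] tail0[of "fst z"] tail0[of "snd z"]
          by (simp add: A_def)
      qed
      then have "g z * dist (fst z) (snd z) \<le> g z * A z" using g0 by (rule mult_left_mono)
      then show ?thesis using D0 by simp
    next
      case False
      have "norm (fst z) \<le> R + tail (fst z)"
        using R(1) R(2)[OF z(1)] \<kappa>(2)[of "fst z"] by (cases "\<kappa> (fst z) = K") (auto simp: tail_def)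
      with dn have "dist (fst z) (snd z) \<le> R + tail (fst z) + norm (snd z)" by simp
      then have "g z * dist (fst z) (snd z) \<le> g z * (R + tail (fst z) + norm (snd z))"
        using g0 by (rule mult_left_mono)
      also have "\<dots> = D z + F z" using False by (simp add: g_def D_def F_def algebra_simps)
      finally have "g z * dist (fst z) (snd z) \<le> D z + F z" .
      moreover have "0 \<le> A z" using tail0[of "fst z"] tail0[of "snd z"] \<epsilon>(1) by (simp add: A_def)
      then have "0 \<le> g z * A z" using g0 by simp
      ultimately show ?thesis by linarith
    qed
  qed
  also have "\<dots> = (\<integral>z. A z \<partial>m) + (\<integral>z. D z \<partial>(\<alpha> \<Otimes>\<^sub>M \<mu>)) + (1 - \<theta>) * c"
    using gA Di(1) Fi F by simp
  also have "\<dots> \<le> \<epsilon> + 2 * (\<integral>x. tail x \<partial>\<alpha>) + (\<integral>x. tail x \<partial>\<mu>) + (1 - \<theta>) * (R + c)"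
    using Ai(2) Di(2) by (simp add: algebra_simps)
  finally show ?thesis by (simp add: c_def)
qed

section \<open>Convergence of empirical measures in \<open>d1\<close>\<close>

context iid_sample
begin

theorem d1_empirical_tendsto:
  assumes E: "small_partitions E"
  shows "AE \<omega> in P. (\<lambda>N. d1 (empirical E N (\<lambda>i. Y i \<omega>)) \<mu>) \<longlonglongrightarrow> 0"
proof -
  interpret \<mu>: prob_space \<mu> by (rule P1D(1)[OF \<mu>])
  have sp\<mu>: "space \<mu> = E" by (rule P1D(3)[OF \<mu>])
  have "AE \<omega> in P. \<forall>l. \<forall>\<^sub>F N in sequentially. d1 (empirical E N (\<lambda>i. Y i \<omega>)) \<mu>
    \<le> 12 * (1 / real (Suc l))"
  proof (intro AE_all_countable[THEN iffD2] allI)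
    fix l
    define \<epsilon> where "\<epsilon> = 1 / real (Suc l)"
    have \<epsilon>: "\<epsilon> > 0" by (simp add: \<epsilon>_def)
    obtain j :: "'e \<Rightarrow> nat" where j: "j \<in> measurable (borel_on E) (count_space UNIV)"
      and jd: "\<And>x y. x \<in> E \<Longrightarrow> y \<in> E \<Longrightarrow> j x = j y \<Longrightarrow> dist x y \<le> \<epsilon>"
      using E[unfolded small_partitions_def, rule_format, OF \<epsilon>] by auto
    define tl where "tl K x = (if K \<le> j x then norm x else 0)" for K and x :: 'e
    have tlm: "tl K \<in> borel_measurable (borel_on E)" for K
    proof -
      note [measurable] = j
      show ?thesis unfolding tl_def by measurable
    qed
    have tlm\<mu>: "tl K \<in> borel_measurable \<mu>" for K using tlm P1D(2)[OF \<mu>]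
      by (simp cong: measurable_cong_sets)
    have "(\<lambda>K. \<integral>x. tl K x \<partial>\<mu>) \<longlonglongrightarrow> (\<integral>x. 0 \<partial>\<mu>)"
    proof (rule integral_dominated_convergence[where w = norm])
      show "AE x in \<mu>. (\<lambda>K. tl K x) \<longlonglongrightarrow> 0"
      proof (rule AE_I2)
        fix x
        have "\<forall>\<^sub>F K in sequentially. tl K x = 0"
          using eventually_gt_at_top[of "j x"] by eventually_elim (simp add: tl_def)
        then show "(\<lambda>K. tl K x) \<longlonglongrightarrow> 0" by (rule tendsto_eventually)
      qed
      show "AE x in \<mu>. norm (tl K x) \<le> norm x" for K by (simp add: tl_def)
    qed (use tlm\<mu> P1D(4)[OF \<mu>] in auto)
    then have "\<forall>\<^sub>F K in sequentially. (\<integral>x. tl K x \<partial>\<mu>) < \<epsilon>"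
      using \<epsilon> by (intro order_tendstoD(2)) auto
    then obtain K where K: "(\<integral>x. tl K x \<partial>\<mu>) < \<epsilon>" by (auto simp: eventually_sequentially)
    \<comment> \<open>All cells from \<open>K\<close> on are merged into one; the choice of
      \<open>K\<close> has made their contribution to the first moment of \<mu> less than
      \<epsilon>.\<close>
    define \<kappa> where "\<kappa> x = min (j x) K" for x
    have \<kappa>m: "\<kappa> \<in> measurable (borel_on E) (count_space UNIV)"
      unfolding \<kappa>_def by (rule measurable_compose[OF j]) simp
    have \<kappa>K: "\<kappa> x \<le> K" for x by (simp add: \<kappa>_def)
    have tl\<kappa>: "tl K = (\<lambda>x. if \<kappa> x = K then norm x else 0)" by (auto simp: tl_def \<kappa>_def)
    \<comment> \<open>A cell lies within \<epsilon> of any of its points and is therefore bounded.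
      The radii are later added up rather than maximised, which covers \<open>K = 0\<close> as
      well.\<close>
    have "\<exists>r\<ge>0. \<forall>x\<in>E. j x = i \<longrightarrow> norm x \<le> r" for i
    proof (cases "\<exists>x0\<in>E. j x0 = i")
      case True
      then obtain x0 where x0: "x0 \<in> E" "j x0 = i" by blast
      have "norm x \<le> norm x0 + \<epsilon>" if "x \<in> E" "j x = i" for x
        using jd[OF that(1) x0(1)] that x0(2) norm_triangle_ineq2[of x x0] by (simp add: dist_norm)
      then show ?thesis using \<epsilon> by (intro exI[of _ "norm x0 + \<epsilon>"]) auto
    qed auto
    then obtain r where r: "\<And>i. 0 \<le> r i" "\<And>i x. x \<in> E \<Longrightarrow> j x = i \<Longrightarrow> norm x \<le> r i" by metis
    define R where "R = (\<Sum>i<K. r i)"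
    have R0: "0 \<le> R" unfolding R_def using r(1) by (intro sum_nonneg)
    have RK: "norm x \<le> R" if "x \<in> E" "\<kappa> x < K" for x
    proof -
      have "j x < K" using that(2) by (simp add: \<kappa>_def min_def split: if_splits)
      then have "r (j x) \<le> R" unfolding R_def using r(1) by (intro member_le_sum) auto
      then show ?thesis using r(2)[OF that(1) refl] by linarith
    qed
    define c where "c = (\<integral>x. norm x \<partial>\<mu>)"
    have c0: "0 \<le> c" by (simp add: c_def)
    \<comment> \<open>The fraction \<eta> of the mass that is not paired within cells costs
      \<open>\<eta> * (R + c) \<le> \<epsilon>\<close>; the minimum keeps the paired fraction
      \<open>1 - \<eta>\<close> nonnegative, and the summand 1 keeps the denominator
      positive.\<close>
    define \<eta> where "\<eta> = min 1 (\<epsilon> / (R + c + 1))"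
    have \<eta>: "0 < \<eta>" "\<eta> \<le> 1" using \<epsilon> R0 c0 by (auto simp: \<eta>_def)
    have \<eta>R: "\<eta> * (R + c) \<le> \<epsilon>"
    proof -
      have "\<eta> * (R + c) \<le> \<epsilon> / (R + c + 1) * (R + c)"
        using R0 c0 by (intro mult_right_mono) (auto simp: \<eta>_def)
      also have "\<dots> \<le> \<epsilon>" using R0 c0 \<epsilon> by (simp add: field_simps)
      finally show ?thesis .
    qed
    define A where "A i = {x \<in> E. \<kappa> x = i}" for i
    have A: "A i \<in> sets (borel_on E)" for i
    proof -
      have "\<kappa> -` {i} \<inter> space (borel_on E) \<in> sets (borel_on E)" using \<kappa>m
        by (rule measurable_sets) simp
      moreover have "\<kappa> -` {i} \<inter> space (borel_on E) = A i" by (auto simp: A_def)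
      ultimately show ?thesis by simp
    qed
    have ev1: "AE \<omega> in P. \<forall>i. (\<lambda>N. (\<Sum>n<N. indicator (A i) (Y n \<omega>)) / real N) \<longlonglongrightarrow> measure \<mu> (A i)"
      by (intro AE_all_countable[THEN iffD2] allI frequency_converges A)
    have tli: "integrable \<mu> (tl K)"
      by (rule Bochner_Integration.integrable_bound[OF P1D(4)[OF \<mu>] tlm\<mu>]) (simp add: tl_def)
    have ev2: "AE \<omega> in P. \<forall>\<^sub>F N in sequentially. (\<Sum>n<N. tl K (Y n \<omega>))
      \<le> real N * (2 * ((\<integral>x. tl K x \<partial>\<mu>) + \<epsilon>))"
      by (rule strong_law_upper[OF tlm _ tli \<epsilon>]) (simp add: tl_def)
    show "AE \<omega> in P. \<forall>\<^sub>F N in sequentially. d1 (empirical E N (\<lambda>i. Y i \<omega>)) \<mu>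
      \<le> 12 * (1 / real (Suc l))"
      using ev1 ev2 AE_space
    proof eventually_elim
      case (elim \<omega>)
      have YE: "Y n \<omega> \<in> E" for n using measurable_space[OF Y elim(3), of n] by simp
      have "\<forall>\<^sub>F N in sequentially. (1 - \<eta>) * measure \<mu> (A i) \<le> (\<Sum>n<N. indicator (A i) (Y n \<omega>)) /
        real N" for i
      \<comment> \<open>Positive mass leaves room for a strict inequality, which convergence of the
        frequency makes hold eventually.\<close>
      proof (cases "measure \<mu> (A i) = 0")
        case True
        then show ?thesis by (auto intro!: always_eventually divide_nonneg_nonneg sum_nonneg)
      next
        case False
        then have "0 < measure \<mu> (A i)" by (simp add: less_le)
        then have "(1 - \<eta>) * measure \<mu> (A i) < measure \<mu> (A i)" using \<eta> by (simp add: algebra_simps)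
        from order_tendstoD(1)[OF elim(1)[rule_format, of i] this]
        show ?thesis by eventually_elim simp
      qed
      then have "\<forall>\<^sub>F N in sequentially. \<forall>i\<in>{..K}. (1 - \<eta>) * measure \<mu> (A i)
        \<le> (\<Sum>n<N. indicator (A i) (Y n \<omega>)) / real N"
        by (intro eventually_ball_finite) auto
      then show ?case
        using elim(2) eventually_ge_at_top[of 1]
      proof eventually_elim
        case (elim N)
        let ?\<alpha> = "empirical E N (\<lambda>i. Y i \<omega>)"
        note \<alpha> = empirical_in_P1(1)[of N "\<lambda>i. Y i \<omega>" E, OF elim(3) YE]
        have int: "(\<integral>x. \<phi> x \<partial>?\<alpha>) = (\<Sum>i<N. \<phi> (Y i \<omega>)) / real N"
          if "\<phi> \<in> borel_measurable (borel_on E)" for \<phi> :: "'e \<Rightarrow> real"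
          by (rule integral_empirical[OF elim(3) YE that])
        have freq: "measure ?\<alpha> (A i) = (\<Sum>n<N. indicator (A i) (Y n \<omega>)) / real N" for i
        proof -
          have "A i \<in> sets ?\<alpha>" using A P1D(2)[OF \<alpha>] by simp
          then have "measure ?\<alpha> (A i) = (\<integral>x. indicator (A i) x \<partial>?\<alpha>)"
            using sets.sets_into_space[of "A i" ?\<alpha>] by (simp add: Int_absorb2)
          also have "\<dots> = (\<Sum>n<N. indicator (A i) (Y n \<omega>)) / real N"
            using A by (intro int) simp
          finally show ?thesis .
        qed
        \<comment> \<open>Origin of 12: the summands are at most e, 4 (s + e), s and e with s < e,
          in total less than 11 e. The 2 of the strong law and the 2 of the coupling produce the
          4.\<close>
        have arith: "a \<le> 12 * e"
          if "a \<le> e + 2 * t + s + w" "t \<le> 2 * (s + e)" "w \<le> e" "s < e" "0 < e"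
          for a e t s w :: real using that by (simp add: algebra_simps)
        have *: "d1 ?\<alpha> \<mu> \<le> \<epsilon> + 2 * (\<integral>x. tl K x \<partial>?\<alpha>) + (\<integral>x. tl K x \<partial>\<mu>) + (1 - (1 - \<eta>)) *
          (R + (\<integral>x. norm x \<partial>\<mu>))"
          unfolding tl\<kappa>
        proof (rule d1_le_partition[OF \<alpha> \<mu> E \<kappa>m \<kappa>K _ _ R0 RK])
          show "dist x y \<le> \<epsilon>" if "x \<in> E" "y \<in> E" "\<kappa> x = \<kappa> y" "\<kappa> x < K" for x y
            using that by (intro jd) (auto simp: \<kappa>_def min_def split: if_splits)
          show "(1 - \<eta>) * measure \<mu> {x \<in> E. \<kappa> x = i} \<le> measure ?\<alpha> {x \<in> E. \<kappa> x = i}" if "i \<le> K" for i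
            using elim(1) that unfolding A_def[symmetric] freq by blast
        qed (use \<eta> \<epsilon> in auto)
        have "(\<integral>x. tl K x \<partial>?\<alpha>) \<le> 2 * ((\<integral>x. tl K x \<partial>\<mu>) + \<epsilon>)"
          unfolding int[OF tlm] using elim(2,3) by (simp add: divide_le_eq mult.commute)
        moreover have "(1 - (1 - \<eta>)) * (R + (\<integral>x. norm x \<partial>\<mu>)) \<le> \<epsilon>" using \<eta>R by (simp add: c_def)
        ultimately have "d1 ?\<alpha> \<mu> \<le> 12 * \<epsilon>" by (rule arith[OF * _ _ K \<epsilon>])
        then show ?case by (simp add: \<epsilon>_def)
      qed
    qed
  qed
  then show ?thesis
    using AE_space
  proof eventually_elim
    case (elim \<omega>)
    have YE: "Y n \<omega> \<in> E" for n using measurable_space[OF Y elim(2), of n] by simp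
    show ?case
    proof (rule tendstoI)
      fix \<epsilon> :: real assume "\<epsilon> > 0"
      then have "\<epsilon> / 12 > 0" by simp
      then obtain l where l: "1 / real (Suc l) < \<epsilon> / 12" using nat_approx_posE by blast
      show "\<forall>\<^sub>F N in sequentially. dist (d1 (empirical E N (\<lambda>i. Y i \<omega>)) \<mu>) 0 < \<epsilon>"
        using elim(1)[rule_format, of l] eventually_ge_at_top[of 1]
      proof eventually_elim
        case (elim N)
        have "0 \<le> d1 (empirical E N (\<lambda>i. Y i \<omega>)) \<mu>"
          using P1D(1)[OF empirical_in_P1(1)[of N "\<lambda>i. Y i \<omega>" E, OF elim(2) YE]] \<mu>.prob_space_axioms
          by (rule d1_nonneg)
        then show ?case using elim(1) l by (simp add: dist_real_def)
      qed
    qed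
  qed
qed

end

section \<open>The particle system\<close>

text \<open>Passage to Borel measurable kernels, so that all time integrals are over \<open>lborel\<close>.\<close>

lemma borel_kernel:
  fixes h :: "real \<Rightarrow> real"
  assumes "h absolutely_integrable_on {0<..<T}"
  obtains h' where "integrable lborel h'" "\<And>s. 0 \<le> h' s"
    "AE t in lborel. t \<in> {0..T} \<longrightarrow> h' t = \<bar>h t\<bar>"
    "(LINT s|lborel. h' s) = (LINT t:{0<..<T}|lebesgue. \<bar>h t\<bar>)"
proof -
  define h1 where "h1 t = indicator {0<..<T} t *\<^sub>R \<bar>h t\<bar>" for t
  have "integrable lebesgue (\<lambda>t. norm (indicator {0<..<T} t *\<^sub>R h t))"
    using assms unfolding set_integrable_def by (rule integrable_norm)
  moreover have "norm (indicator {0<..<T} t *\<^sub>R h t) = h1 t" for t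
    by (simp add: h1_def indicator_def)
  ultimately have i1: "integrable lebesgue h1" by simp
  then have m1: "h1 \<in> borel_measurable lebesgue" by (rule borel_measurable_integrable)
  obtain g where g: "g \<in> borel_measurable lborel" "AE t in lborel. h1 t = g t"
    using completion_ex_borel_measurable_real[OF m1] by blast
  define h' where "h' t = \<bar>g t\<bar>" for t
  have h'm: "h' \<in> borel_measurable lborel" unfolding h'_def using g(1) by measurable
  have ae: "AE t in lborel. h1 t = h' t"
    using g(2)
  proof eventually_elim
    case (elim t)
    have "0 \<le> h1 t" by (simp add: h1_def)
    then show ?case using elim by (simp add: h'_def)
  qed
  then have aeL: "AE t in lebesgue. h1 t = h' t" by (rule AE_completion)
  have h'L: "h' \<in> borel_measurable lebesgue" using h'm by (rule measurable_completion)
  have iL: "integrable lebesgue h'" by (rule integrable_cong_AE_imp[OF i1 h'L]) (use aeL in auto)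
  show ?thesis
  proof (rule that)
    show "integrable lborel h'" using iL integrable_completion[OF h'm] by simp
    show "0 \<le> h' s" for s by (simp add: h'_def)
    \<comment> \<open>The kernel was cut off to the open interval; the two end points form a null
      set.\<close>
    show "AE t in lborel. t \<in> {0..T} \<longrightarrow> h' t = \<bar>h t\<bar>"
      using ae AE_lborel_singleton[of 0] AE_lborel_singleton[of T]
      by eventually_elim (auto simp: h1_def indicator_def split: if_splits)
    have "(LINT s|lborel. h' s) = (LINT s|lebesgue. h' s)"
      by (rule integral_completion[OF h'm, symmetric])
    also have "\<dots> = (LINT s|lebesgue. h1 s)" by (rule integral_cong_AE[OF h'L m1]) (use aeL in auto)
    finally show "(LINT s|lborel. h' s) = (LINT t:{0<..<T}|lebesgue. \<bar>h t\<bar>)"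
      by (simp add: h1_def set_lebesgue_integral_def)
  qed
qed

text \<open>For a uniformly chosen index the law of the position at time s is the empirical measure
  of all positions, so the interaction term of the particles is the law term of the
  equation.\<close>

lemma empirical_weak_solution:
  fixes x y :: "nat \<Rightarrow> ('d::finite) path"
  assumes N: "N \<ge> 1" and x: "\<And>i. i < N \<Longrightarrow> x i \<in> paths T" and y: "\<And>i. i < N \<Longrightarrow> y i \<in> paths T"
    and sol: "\<And>i. i < N \<Longrightarrow> solves_equation T B (\<lambda>s. empirical UNIV N (\<lambda>j. apply_bcontfun (x j) s))
      (x i) (y i)"
  shows "weak_solution T B (empirical (paths T) N y) (uniform_count_measure {..<N}) x y"
proof -
  let ?U = "uniform_count_measure {..<N}"
  have U: "prob_space ?U" by (rule empirical_in_P1(2)[OF N x])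
  have xm: "x \<in> measurable ?U (borel_on (paths T))" by (rule empirical_in_P1(3)[OF N x])
  have ym: "y \<in> measurable ?U (borel_on (paths T))" by (rule empirical_in_P1(3)[OF N y])
  have int: "integrable ?U (\<lambda>i. norm (x i))"
    using N by (intro integrable_uniform_count_measure) (auto simp: lessThan_empty_iff)
  have m: "marginal ?U x = (\<lambda>s. empirical UNIV N (\<lambda>j. apply_bcontfun (x j) s))"
    unfolding marginal_def[abs_def] empirical_def distr_borel_on_UNIV ..
  show ?thesis
    unfolding weak_solution_cong_marginal
  proof (intro conjI U xm ym ballI)
    show "distr ?U (borel_on (paths T)) y = empirical (paths T) N y" by (simp add: empirical_def)
    show "marginal ?U x t \<in> P1 UNIV" for t by (rule marginal_P1[OF U xm int])
    show "bdd_above ((\<lambda>t. norm1 (marginal ?U x t)) ` {0..T})"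
      by (rule bdd_aboveI2) (rule norm1_marginal_le[OF U xm int])
    show "AE i in ?U. solves_equation T B (marginal ?U x) (x i) (y i)"
      unfolding m using sol by (intro AE_I2) (simp add: space_uniform_count_measure)
  qed
qed

section \<open>The estimate for particles and mean field convergence\<close>

context mckean
begin

text \<open>Outside the null set where the particle equations fail, the estimate is deterministic:
  stability compares the empirical solution at \<omega> with a solution whose law is
  \<open>solution_map T B \<mu>\<close>. The joint law of the inputs does not enter.\<close>

lemma particle_d1_le:
  fixes P :: "'w measure" and X Y :: "nat \<Rightarrow> 'w \<Rightarrow> 'd path"
  assumes \<mu>: "\<mu> \<in> P1 (paths T)" and N: "N \<ge> 1" and Y: "\<And>i. Y i \<in> measurable P (borel_on (paths T))"
    and X: "particle_solution T B P Y N X"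
  shows "AE \<omega> in P. d1 (empirical (paths T) N (\<lambda>i. X i \<omega>)) (solution_map T B \<mu>)
    \<le> (let r = d1 (empirical (paths T) N (\<lambda>i. Y i \<omega>)) \<mu> in
        if r = 0 then 0 else inv_into {0<..} G (G r + 2 * (LINT s|lborel. h s)))"
proof -
  have "solution_law T B \<mu> (solution_map T B \<mu>)"
    unfolding solution_map_def by (rule theI'[OF solution_law_ex1[OF \<mu>]])
  then obtain P' :: "('d path \<times> 'd path) measure" and X' Y' where
    w': "weak_solution T B \<mu> P' X' Y'" "distr P' (borel_on (paths T)) X' = solution_map T B \<mu>"
    unfolding solution_law_def by blast
  have Xm: "X i \<in> measurable P (borel_on (paths T))" if "i < N" for i
    using X that by (simp add: particle_solution_def)
  have "AE \<omega> in P. \<forall>i<N. solves_equation T B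
      (\<lambda>s. empirical UNIV N (\<lambda>j. apply_bcontfun (X j \<omega>) s)) (X i \<omega>) (Y i \<omega>)"
    using X by (simp add: particle_solution_def)
  then show ?thesis
    using AE_space
  proof eventually_elim
    case (elim \<omega>)
    have p: "X i \<omega> \<in> paths T" if "i < N" for i
      using measurable_space[OF Xm[OF that] elim(2)] by simp
    have p': "Y i \<omega> \<in> paths T" for i
      using measurable_space[OF Y elim(2)] by simp
    have w: "weak_solution T B (empirical (paths T) N (\<lambda>i. Y i \<omega>)) (uniform_count_measure {..<N})
        (\<lambda>i. X i \<omega>) (\<lambda>i. Y i \<omega>)"
      by (rule empirical_weak_solution[OF N p p']) (use elim(1) in auto)
    have P1: "empirical (paths T) N (\<lambda>i. Y i \<omega>) \<in> P1 (paths T)"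
      by (rule empirical_in_P1(1)[OF N p'])
    show ?case
      using weak_solution_stability[OF w w'(1) P1 \<mu>]
        unfolding w'(2) empirical_def[symmetric] Let_def .
  qed
qed

text \<open>M vanishes at 0 and is continuous there by the Osgood condition, so
  \<open>d1\<close>-convergence passes from the inputs to the solutions; weak convergence of both
  follows from it.\<close>

lemma mean_field_convergence_of_d1:
  fixes P :: "'w measure" and Y :: "nat \<Rightarrow> 'w \<Rightarrow> 'd path"
  assumes \<mu>: "\<mu> \<in> P1 (paths T)" and Y: "\<And>i. Y i \<in> measurable P (borel_on (paths T))"
    and lim: "AE \<omega> in P. (\<lambda>N. d1 (empirical (paths T) N (\<lambda>i. Y i \<omega>)) \<mu>) \<longlonglongrightarrow> 0"
  shows "mean_field_convergence T B P Y \<mu>"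
  unfolding mean_field_convergence_def
proof (intro conjI allI impI)
  have p': "Y i \<omega> \<in> paths T" if "\<omega> \<in> space P" for i \<omega>
    using measurable_space[OF Y that] by simp
  show "AE \<omega> in P. weakly_converges (\<lambda>N. empirical (paths T) N (\<lambda>i. Y i \<omega>)) \<mu>"
    using lim AE_space
  proof eventually_elim
    case (elim \<omega>)
    show ?case
      by (rule weakly_converges_of_d1[OF _ \<mu> small_partitions_paths elim(1)])
        (rule empirical_in_P1(1)[OF _ p'[OF elim(2)]])
  qed
  show "\<exists>!\<mu>X. solution_law T B \<mu> \<mu>X" by (rule solution_law_ex1[OF \<mu>])
  fix X :: "nat \<Rightarrow> nat \<Rightarrow> 'w \<Rightarrow> 'd path"
  assume X: "\<forall>N\<ge>1. particle_solution T B P Y N (X N)"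
  have "solution_law T B \<mu> (solution_map T B \<mu>)"
    unfolding solution_map_def by (rule theI'[OF solution_law_ex1[OF \<mu>]])
  then obtain P' :: "('d path \<times> 'd path) measure" and X' Y' where
    w': "weak_solution T B \<mu> P' X' Y'" "distr P' (borel_on (paths T)) X' = solution_map T B \<mu>"
    unfolding solution_law_def by blast
  have S: "solution_map T B \<mu> \<in> P1 (paths T)"
    using weak_solution_flow(7)[OF w'(1) \<mu>] by (simp only: w'(2))
  define c where "c = 2 * (LINT s|lborel. h s)"
  \<comment> \<open>The exceptional set depends on the system of size \<open>N\<close>; there are
    countably many systems, so a common null set exists.\<close>
  have "AE \<omega> in P. \<forall>N. N \<ge> 1 \<longrightarrow> d1 (empirical (paths T) N (\<lambda>i. X N i \<omega>)) (solution_map T B \<mu>)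
    \<le> (let r = d1 (empirical (paths T) N (\<lambda>i. Y i \<omega>)) \<mu> in
      if r = 0 then 0 else inv_into {0<..} G (G r + c))"
    unfolding c_def
  proof (intro AE_all_countable[THEN iffD2] allI)
    fix N
    show "AE \<omega> in P. N \<ge> 1 \<longrightarrow> d1 (empirical (paths T) N (\<lambda>i. X N i \<omega>)) (solution_map T B \<mu>)
      \<le> (let r = d1 (empirical (paths T) N (\<lambda>i. Y i \<omega>)) \<mu> in
          if r = 0 then 0 else inv_into {0<..} G (G r + 2 * (LINT s|lborel. h s)))"
    proof (cases "N \<ge> 1")
      case True
      then have "particle_solution T B P Y N (X N)" using X by simp
      from particle_d1_le[OF \<mu> True Y this] show ?thesis by eventually_elim simp
    qed simp
  qed
  then show "AE \<omega> in P. weakly_converges (\<lambda>N. empirical (paths T) N (\<lambda>i. X N i \<omega>))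
    (solution_map T B \<mu>)"
    using lim AE_space
  proof eventually_elim
    case (elim \<omega>)
    note bound = elim(1)[rule_format]
    have p: "X N i \<omega> \<in> paths T" if "N \<ge> 1" "i < N" for N i
    proof -
      have "X N i \<in> measurable P (borel_on (paths T))" using X that
        by (simp add: particle_solution_def)
      from measurable_space[OF this elim(3)] show ?thesis by simp
    qed
    have XP: "empirical (paths T) N (\<lambda>i. X N i \<omega>) \<in> P1 (paths T)" if "N \<ge> 1" for N
      by (rule empirical_in_P1(1)[OF that p[OF that]])
    have YP: "empirical (paths T) N (\<lambda>i. Y i \<omega>) \<in> P1 (paths T)" if "N \<ge> 1" for N
      by (rule empirical_in_P1(1)[OF that p'[OF elim(3)]])
    have lim0: "(\<lambda>N. d1 (empirical (paths T) N (\<lambda>i. X N i \<omega>)) (solution_map T B \<mu>)) \<longlonglongrightarrow> 0"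
    proof (rule tendstoI)
      fix \<epsilon> :: real assume \<epsilon>: "\<epsilon> > 0"
      show "\<forall>\<^sub>F N in sequentially. dist (d1 (empirical (paths T) N (\<lambda>i. X N i \<omega>))
        (solution_map T B \<mu>)) 0 < \<epsilon>"
      proof (rule small_data[OF \<epsilon>, of c])
        fix \<rho> assume \<rho>: "\<rho> > 0" and small: "\<And>r v. 0 < r \<Longrightarrow> r \<le> \<rho> \<Longrightarrow> 0 < v \<Longrightarrow> G v \<le> G r + c \<Longrightarrow> v < \<epsilon>"
        show ?thesis
          using order_tendstoD(2)[OF elim(2) \<rho>] eventually_ge_at_top[of 1]
        proof eventually_elim
          case (elim N)
          let ?r = "d1 (empirical (paths T) N (\<lambda>i. Y i \<omega>)) \<mu>"
          let ?d = "d1 (empirical (paths T) N (\<lambda>i. X N i \<omega>)) (solution_map T B \<mu>)"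
          have d0: "0 \<le> ?d" using P1D(1)[OF XP[OF elim(2)]] P1D(1)[OF S] by (rule d1_nonneg)
          have r0: "0 \<le> ?r" using P1D(1)[OF YP[OF elim(2)]] P1D(1)[OF \<mu>] by (rule d1_nonneg)
          have "?d \<le> (if ?r = 0 then 0 else inv_into {0<..} G (G ?r + c))"
            using bound elim(2) by (simp add: Let_def)
          also have "\<dots> < \<epsilon>"
          proof (cases "?r = 0")
            case False
            then have "inv_into {0<..} G (G ?r + c) < \<epsilon>"
              using r0 elim(1) inv_into_G[of "G ?r + c"] by (intro small[of ?r]) simp_all
            then show ?thesis using False by simp
          qed (use \<epsilon> in simp)
          finally show ?case using d0 by (simp add: dist_real_def)
        qed
      qed
    qed
    show ?case by (rule weakly_converges_of_d1[OF _ S small_partitions_paths lim0]) (rule XP)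
  qed
qed

end

text \<open>For i.i.d. inputs the third claim supplies the premise of the second. The norm of
  \<open>h\<close> is a Lebesgue integral over the open interval, and the proof replaces it by the
  integral of a Borel version over the whole line.\<close>

theorem corollary5p8:
  fixes T x0 :: real
    and h f :: "real \<Rightarrow> real"
    and B :: "('d::finite) drift"
    and \<mu>Y :: "'d path measure"
    and P :: "'w measure"
    and Y :: "nat \<Rightarrow> 'w \<Rightarrow> 'd path"
  assumes "T > 0"
    and "h absolutely_integrable_on {0<..<T}" and "\<forall>t\<in>{0..T}. h t \<ge> 0"
    and "modulus_of_continuity f" and "concave_on {0..} f"
    and "\<forall>\<epsilon>>0. (\<integral>\<^sup>+u\<in>{0<..<\<epsilon>}. ennreal (1 / f u) \<partial>lborel) = \<infinity>"
    and "x0 > 0"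
    and "(\<lambda>(t, x, \<mu>). B t x \<mu>)
      \<in> restrict_space borel {0..T} \<Otimes>\<^sub>M (borel \<Otimes>\<^sub>M borel_P1 UNIV) \<rightarrow>\<^sub>M borel"
    and "\<forall>t\<in>{0..T}. unif_cont_on_bounded (B t)"
    and "\<exists>k. k absolutely_integrable_on {0<..<T} \<and>
      (\<forall>t\<in>{0..T}. \<forall>x. \<forall>\<mu>\<in>P1 UNIV. norm (B t x \<mu>) \<le> k t * (1 + norm x + norm1 \<mu>))"
    and "\<forall>t\<in>{0..T}. \<forall>x y. \<forall>\<mu>\<in>P1 UNIV. \<forall>\<nu>\<in>P1 UNIV.
      norm (B t x \<mu> - B t y \<nu>) \<le> h t * f (norm (x - y) + d1 \<mu> \<nu>)"
    and "\<mu>Y \<in> P1 (paths T)"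
    and "prob_space P"
    and "\<forall>i. Y i \<in> measurable P (borel_on (paths T))"
  shows "(\<forall>N\<ge>1. \<forall>X. particle_solution T B P Y N X \<longrightarrow>
      (AE \<omega> in P.
        d1 (empirical (paths T) N (\<lambda>i. X i \<omega>)) (solution_map T B \<mu>Y)
        \<le> osgood_M f x0 (2 * (LINT t:{0<..<T}|lebesgue. \<bar>h t\<bar>))
            (d1 (empirical (paths T) N (\<lambda>i. Y i \<omega>)) \<mu>Y)))
    \<and> ((AE \<omega> in P. (\<lambda>N. d1 (empirical (paths T) N (\<lambda>i. Y i \<omega>)) \<mu>Y) \<longlonglongrightarrow> 0)
        \<longrightarrow> mean_field_convergence T B P Y \<mu>Y)
    \<and> (prob_space.indep_vars P (\<lambda>_. borel_on (paths T)) Y UNIV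
        \<and> (\<forall>i. distr P (borel_on (paths T)) (Y i) = \<mu>Y)
        \<longrightarrow> (AE \<omega> in P. (\<lambda>N. d1 (empirical (paths T) N (\<lambda>i. Y i \<omega>)) \<mu>Y) \<longlonglongrightarrow> 0))"
proof -
  note T = assms(1) and h = assms(2) and h0 = assms(3) and meas = assms(8) and lip = assms(11)
    and \<mu>Y = assms(12)
  have Y: "Y i \<in> measurable P (borel_on (paths T))" for i using assms(14) by simp
  define G where "G = osgood_G f x0"
  interpret osgood f G unfolding G_def by (rule osgood_osgood_G[OF assms(4-7)])
  obtain k where k: "k absolutely_integrable_on {0<..<T}"
    and growth: "\<And>t x \<mu>. t \<in> {0..T} \<Longrightarrow> \<mu> \<in> P1 UNIV \<Longrightarrow>
      norm (B t x \<mu>) \<le> k t * (1 + norm x + norm1 \<mu>)"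
    using assms(10) by blast
  obtain h' where h': "integrable lborel h'" "\<And>s. 0 \<le> h' s"
    "AE t in lborel. t \<in> {0..T} \<longrightarrow> h' t = \<bar>h t\<bar>"
    "(LINT s|lborel. h' s) = (LINT t:{0<..<T}|lebesgue. \<bar>h t\<bar>)"
    by (rule borel_kernel[OF h]) blast
  obtain k' where k': "integrable lborel k'" "\<And>s. 0 \<le> k' s"
    "AE t in lborel. t \<in> {0..T} \<longrightarrow> k' t = \<bar>k t\<bar>"
    by (rule borel_kernel[OF k]) blast
  interpret mckean f G T h' k' B
  proof unfold_locales
    fix x :: "real ^ 'd" and \<mu> :: "(real ^ 'd) measure" assume \<mu>: "\<mu> \<in> P1 UNIV"
    \<comment> \<open>The section at fixed \<open>x\<close> and \<mu> is a composition with a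
      pairing of constants; the constant \<mu> is a measurable map because the space of
      \<open>borel_P1 UNIV\<close> is \<open>P1 UNIV\<close>.\<close>
    have "(\<lambda>s. (s, x, \<mu>)) \<in> restrict_space borel {0..T} \<rightarrow>\<^sub>M restrict_space borel {0..T} \<Otimes>\<^sub>M
      (borel \<Otimes>\<^sub>M borel_P1 UNIV)"
      using \<mu> by (intro measurable_Pair measurable_const)
        (auto simp: borel_P1_def space_measure_of_conv)
    from measurable_compose[OF this meas]
    show "(\<lambda>s. B s x \<mu>) \<in> borel_measurable (restrict_space borel {0..T})" by simp
  next
    fix s assume "s \<in> {0..T}"
    then show "\<exists>c. \<forall>x y. \<forall>\<mu>\<in>P1 UNIV. \<forall>\<nu>\<in>P1 UNIV. norm (B s x \<mu> - B s y \<nu>)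
      \<le> c * f (norm (x - y) + d1 \<mu> \<nu>)"
      using lip by blast
  next
    show "AE s in lborel. s \<in> {0..T} \<longrightarrow>
      (\<forall>x. \<forall>\<mu>\<in>P1 UNIV. norm (B s x \<mu>) \<le> k' s * (1 + norm x + norm1 \<mu>))"
      using k'(3)
    proof eventually_elim
      case (elim s)
      show ?case
      proof (intro impI allI ballI)
        fix x :: "real ^ 'd" and \<mu> :: "(real ^ 'd) measure" assume s: "s \<in> {0..T}"
          and \<mu>: "\<mu> \<in> P1 UNIV"
        \<comment> \<open>The given \<open>k\<close> carries no sign; its absolute value may replace
          it because the growth factor is nonnegative.\<close>
        have "0 \<le> norm1 \<mu>" by (simp add: norm1_def)
        then have "k s * (1 + norm x + norm1 \<mu>) \<le> \<bar>k s\<bar> * (1 + norm x + norm1 \<mu>)"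
          by (intro mult_right_mono) auto
        then show "norm (B s x \<mu>) \<le> k' s * (1 + norm x + norm1 \<mu>)"
          using growth[OF s \<mu>, of x] elim s by simp
      qed
    qed
    show "AE s in lborel. s \<in> {0..T} \<longrightarrow> (\<forall>x y. \<forall>\<mu>\<in>P1 UNIV. \<forall>\<nu>\<in>P1 UNIV.
        norm (B s x \<mu> - B s y \<nu>) \<le> h' s * f (norm (x - y) + d1 \<mu> \<nu>))"
      using h'(3)
    proof eventually_elim
      case (elim s)
      then show ?case using lip h0 by simp
    qed
  qed (use T h'(1,2) k'(1,2) in auto)
  have M: "osgood_M f x0 (2 * (LINT t:{0<..<T}|lebesgue. \<bar>h t\<bar>)) r
      = (if r = 0 then 0 else inv_into {0<..} G (G r + 2 * (LINT s|lborel. h' s)))" for r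
    by (simp add: osgood_M_def G_def h'(4))
  show ?thesis
  proof (intro conjI allI impI)
    fix N :: nat and X :: "nat \<Rightarrow> 'w \<Rightarrow> 'd path"
    assume "1 \<le> N" "particle_solution T B P Y N X"
    from particle_d1_le[OF \<mu>Y this(1) Y this(2)]
    show "AE \<omega> in P. d1 (empirical (paths T) N (\<lambda>i. X i \<omega>)) (solution_map T B \<mu>Y)
        \<le> osgood_M f x0 (2 * (LINT t:{0<..<T}|lebesgue. \<bar>h t\<bar>))
          (d1 (empirical (paths T) N (\<lambda>i. Y i \<omega>)) \<mu>Y)"
      unfolding M Let_def .
  next
    assume "AE \<omega> in P. (\<lambda>N. d1 (empirical (paths T) N (\<lambda>i. Y i \<omega>)) \<mu>Y) \<longlonglongrightarrow> 0"
    with \<mu>Y Y show "mean_field_convergence T B P Y \<mu>Y" by (rule mean_field_convergence_of_d1)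
  next
    assume iid: "prob_space.indep_vars P (\<lambda>_. borel_on (paths T)) Y UNIV
        \<and> (\<forall>i. distr P (borel_on (paths T)) (Y i) = \<mu>Y)"
    interpret P: prob_space P by (rule assms(13))
    interpret iid_sample P "paths T" \<mu>Y Y
      by unfold_locales (use \<mu>Y Y iid in auto)
    show "AE \<omega> in P. (\<lambda>N. d1 (empirical (paths T) N (\<lambda>i. Y i \<omega>)) \<mu>Y) \<longlonglongrightarrow> 0"
      by (rule d1_empirical_tendsto[OF small_partitions_paths])
  qed
qed

end
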